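(* Let $C>1$, $\beta=\int\phi\in(0,\infty)$, $0<z\le\min\{Ce^{-C\beta},2Ce^{-2C\beta}\}$ (and $z<C/2$ if $C\beta=\ln 2$), let $\alpha_1$ be as defined below, and assume $\bar\phi:=\sup_{x\in\mathbb R^d}\phi(x)<\infty$. Then for every $\alpha\in(\alpha_1,1)$ there is a constant $A>0$ depending only on $\alpha$, $C$ and $\bar\phi$ such that for every $k\in\mathcal K_{\alpha C}$, $t\ge0$ and $\varepsilon>0$, $$\|\hat T^*_{\varepsilon,\mathrm{ren}}(t)k-\hat T^*_V(t)k\|_{\mathcal K_C}\le\varepsilon tA\|k\|_{\mathcal K_{\alpha C}}.$$
   Context: $\Gamma_0$: finite subsets of $\mathbb R^d$ with Lebesgue–Poisson measure $\lambda=\sum_{n\ge0}\frac1{n!}m^{(n)}$ ($m^{(0)}=\delta_\emptyset$, $m^{(n)}$ the image of Lebesgue measure on $n$-tuples of distinct points). $|\eta|$ cardinality, $\xi\cup x:=\xi\cup\{x\}$. $e_\lambda(f,\eta)=\prod_{x\in\eta}f(x)$, $e_\lambda(f,\emptyset)=1$. $\mathcal L_C$: measurable $G$ with $\|G\|_C=\int|G(\eta)|C^{|\eta|}d\lambda(\eta)<\infty$; $\mathcal K_C$: measurable $k$ with $\|k\|_{\mathcal K_C}=\operatorname{ess\,sup}_\eta C^{-|\eta|}|k(\eta)|<\infty$; pairing $\langle G,k\rangle=\int Gk\,d\lambda$. $\phi:\mathbb R^d\to[0,\infty)$ even measurable. $(L_1G)(\eta)=-|\eta|G(\eta)$; $(L_{2,\varepsilon}G)(\eta)=z\sum_{\xi\subset\eta}\int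 e_\lambda(e^{-\varepsilon\phi(x-\cdot)},\xi)e_\lambda\big(\tfrac{e^{-\varepsilon\phi(x-\cdot)}-1}{\varepsilon},\eta\setminus\xi\big)G(\xi\cup x)dx$; $(L_2^VG)(\eta)=z\sum_{\xi\subset\eta}\int G(\xi\cup x)e_\lambda(-\phi(x-\cdot),\eta\setminus\xi)dx$; $\hat L_{\varepsilon,\mathrm{ren}}=L_1+L_{2,\varepsilon}$, $\hat L_V=L_1+L_2^V$ on $\mathcal L_{2C}$. Under the hypotheses these are closable in $\mathcal L_C$ and their closures generate strongly continuous contraction semigroups $\hat T_{\varepsilon,\mathrm{ren}}(t)$, $\hat T_V(t)$ on $\mathcal L_C$; their adjoint semigroups $\hat T^*_{\varepsilon,\mathrm{ren}}(t)$, $\hat T^*_V(t)$ on $\mathcal K_C$ are defined by $\langle G,\hat T^*(t)k\rangle=\langle\hat T(t)G,k\rangle$ for all $G\in\mathcal L_C$, $k\in\mathcal K_C$. Definition of $\alpha_1$: let $x_1\in(0,1)$ be the smaller root of $xe^{-x}=z\beta$; if $C\beta>1$ put $\alpha_1=\max\{\tfrac12,\tfrac1{C\beta},\tfrac1C\}$, and if $C\beta\le1$ put $\alpha_1=\max\{\tfrac12,\tfrac{x_1}{C\beta},\tfrac1C\}$. *)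

theory Defs
  imports "HOL-Analysis.Analysis"
begin

text \<open>Gamma_0 = finite subsets of R^d, represented as sets of points of type real^('d::finite).
  The Lebesgue--Poisson measure is handled through its decomposition
  lambda = sum_n (1/n!) m^(n): an n-point configuration is the image of an
  n-tuple x : {..<n} -> R^d under Lebesgue (product) measure; tuples with
  repeated points form a null set.\<close>

type_synonym 'd cfg = "(real^'d) set"

definition Pn :: "nat \<Rightarrow> (nat \<Rightarrow> real^('d::finite)) measure" where
  "Pn n = PiM {..<n} (\<lambda>_. lborel)"

definition cfg_of :: "nat \<Rightarrow> (nat \<Rightarrow> real^('d::finite)) \<Rightarrow> ('d::finite) cfg" where
  "cfg_of n x = x ` {..<n}"

text \<open>Measurability on Gamma_0 (w.r.t. the final sigma-algebra of the maps cfg_of n).\<close>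
definition lp_measurable :: "(('d::finite) cfg \<Rightarrow> real) \<Rightarrow> bool" where
  "lp_measurable G \<longleftrightarrow> (\<forall>n. (\<lambda>x. G (cfg_of n x)) \<in> borel_measurable (Pn n))"

definition LP_nn :: "(('d::finite) cfg \<Rightarrow> ennreal) \<Rightarrow> ennreal" where
  "LP_nn F = (\<Sum>n. ennreal (1 / fact n) * (\<integral>\<^sup>+ x. F (cfg_of n x) \<partial>(Pn n)))"

definition LP_int :: "(('d::finite) cfg \<Rightarrow> real) \<Rightarrow> real" where
  "LP_int F = (\<Sum>n. (1 / fact n) * (\<integral> x. F (cfg_of n x) \<partial>(Pn n)))"

definition in_L :: "real \<Rightarrow> (('d::finite) cfg \<Rightarrow> real) \<Rightarrow> bool" where
  "in_L C G \<longleftrightarrow> lp_measurable G \<and>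
     LP_nn (\<lambda>\<eta>. ennreal (\<bar>G \<eta>\<bar> * C ^ card \<eta>)) < \<infinity>"

definition L_norm :: "real \<Rightarrow> (('d::finite) cfg \<Rightarrow> real) \<Rightarrow> real" where
  "L_norm C G = enn2real (LP_nn (\<lambda>\<eta>. ennreal (\<bar>G \<eta>\<bar> * C ^ card \<eta>)))"

definition K_bound :: "real \<Rightarrow> (('d::finite) cfg \<Rightarrow> real) \<Rightarrow> real \<Rightarrow> bool" where
  "K_bound C k M \<longleftrightarrow>
     (\<forall>n. AE x in Pn n. \<bar>k (cfg_of n x)\<bar> \<le> M * C ^ card (cfg_of n x))"

definition in_K :: "real \<Rightarrow> (('d::finite) cfg \<Rightarrow> real) \<Rightarrow> bool" where
  "in_K C k \<longleftrightarrow> lp_measurable k \<and> (\<exists>M. K_bound C k M)"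

definition K_norm :: "real \<Rightarrow> (('d::finite) cfg \<Rightarrow> real) \<Rightarrow> real" where
  "K_norm C k = Inf {M. 0 \<le> M \<and> K_bound C k M}"

definition pairing :: "(('d::finite) cfg \<Rightarrow> real) \<Rightarrow> (('d::finite) cfg \<Rightarrow> real) \<Rightarrow> real" where
  "pairing G k = LP_int (\<lambda>\<eta>. G \<eta> * k \<eta>)"

definition L1 :: "(('d::finite) cfg \<Rightarrow> real) \<Rightarrow> ('d::finite) cfg \<Rightarrow> real" where
  "L1 G \<eta> = - real (card \<eta>) * G \<eta>"

definition L2eps :: "real \<Rightarrow> (real^('d::finite) \<Rightarrow> real) \<Rightarrow> real \<Rightarrow> (('d::finite) cfg \<Rightarrow> real) \<Rightarrow> ('d::finite) cfg \<Rightarrow> real" where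
  "L2eps z \<phi> \<epsilon> G \<eta> = z * (\<Sum>\<xi>\<in>Pow \<eta>. \<integral> x.
      (\<Prod>y\<in>\<xi>. exp (- \<epsilon> * \<phi> (x - y))) *
      (\<Prod>y\<in>\<eta> - \<xi>. (exp (- \<epsilon> * \<phi> (x - y)) - 1) / \<epsilon>) *
      G (insert x \<xi>) \<partial>lborel)"

definition L2V :: "real \<Rightarrow> (real^('d::finite) \<Rightarrow> real) \<Rightarrow> (('d::finite) cfg \<Rightarrow> real) \<Rightarrow> ('d::finite) cfg \<Rightarrow> real" where
  "L2V z \<phi> G \<eta> = z * (\<Sum>\<xi>\<in>Pow \<eta>. \<integral> x.
      G (insert x \<xi>) * (\<Prod>y\<in>\<eta> - \<xi>. - \<phi> (x - y)) \<partial>lborel)"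

definition L_ren :: "real \<Rightarrow> (real^('d::finite) \<Rightarrow> real) \<Rightarrow> real \<Rightarrow> (('d::finite) cfg \<Rightarrow> real) \<Rightarrow> ('d::finite) cfg \<Rightarrow> real" where
  "L_ren z \<phi> \<epsilon> G \<eta> = L1 G \<eta> + L2eps z \<phi> \<epsilon> G \<eta>"

definition L_V :: "real \<Rightarrow> (real^('d::finite) \<Rightarrow> real) \<Rightarrow> (('d::finite) cfg \<Rightarrow> real) \<Rightarrow> ('d::finite) cfg \<Rightarrow> real" where
  "L_V z \<phi> G \<eta> = L1 G \<eta> + L2V z \<phi> G \<eta>"

text \<open>Strongly continuous contraction semigroup of (linear) operators on L_C;
  functions are identified when they agree lambda-a.e. (norm of difference 0).\<close>
definition C0_contraction_semigroup ::
  "real \<Rightarrow> (real \<Rightarrow> (('d::finite) cfg \<Rightarrow> real) \<Rightarrow> (('d::finite) cfg \<Rightarrow> real)) \<Rightarrow> bool" where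
  "C0_contraction_semigroup C T \<longleftrightarrow>
     (\<forall>t\<ge>0. \<forall>G. in_L C G \<longrightarrow> in_L C (T t G) \<and> L_norm C (T t G) \<le> L_norm C G) \<and>
     (\<forall>t\<ge>0. \<forall>G1 G2 a b. in_L C G1 \<and> in_L C G2 \<longrightarrow>
         L_norm C (\<lambda>\<eta>. T t (\<lambda>\<xi>. a * G1 \<xi> + b * G2 \<xi>) \<eta> - (a * T t G1 \<eta> + b * T t G2 \<eta>)) = 0) \<and>
     (\<forall>G. in_L C G \<longrightarrow> L_norm C (\<lambda>\<eta>. T 0 G \<eta> - G \<eta>) = 0) \<and>
     (\<forall>s\<ge>0. \<forall>t\<ge>0. \<forall>G. in_L C G \<longrightarrow> L_norm C (\<lambda>\<eta>. T (s + t) G \<eta> - T s (T t G) \<eta>) = 0) \<and>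
     (\<forall>G. in_L C G \<longrightarrow> ((\<lambda>t. L_norm C (\<lambda>\<eta>. T t G \<eta> - G \<eta>)) \<longlongrightarrow> 0) (at_right 0))"

definition generator_is_closure ::
  "real \<Rightarrow> (real \<Rightarrow> (('d::finite) cfg \<Rightarrow> real) \<Rightarrow> (('d::finite) cfg \<Rightarrow> real)) \<Rightarrow> ((('d::finite) cfg \<Rightarrow> real) \<Rightarrow> (('d::finite) cfg \<Rightarrow> real)) \<Rightarrow> bool" where
  "generator_is_closure C T Op \<longleftrightarrow>
     (\<forall>G F. in_L C G \<and> in_L C F \<longrightarrow>
        (((\<lambda>h. L_norm C (\<lambda>\<eta>. (T h G \<eta> - G \<eta>) / h - F \<eta>)) \<longlongrightarrow> 0) (at_right 0)
         \<longleftrightarrow>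
         (\<exists>Gs. (\<forall>n. in_L (2 * C) (Gs n) \<and> in_L C (Op (Gs n))) \<and>
               (\<lambda>n. L_norm C (\<lambda>\<eta>. Gs n \<eta> - G \<eta>)) \<longlonglongrightarrow> 0 \<and>
               (\<lambda>n. L_norm C (\<lambda>\<eta>. Op (Gs n) \<eta> - F \<eta>)) \<longlonglongrightarrow> 0)))"

definition is_adjoint_image ::
  "real \<Rightarrow> (real \<Rightarrow> (('d::finite) cfg \<Rightarrow> real) \<Rightarrow> (('d::finite) cfg \<Rightarrow> real)) \<Rightarrow> real \<Rightarrow> (('d::finite) cfg \<Rightarrow> real) \<Rightarrow> (('d::finite) cfg \<Rightarrow> real) \<Rightarrow> bool" where
  "is_adjoint_image C T t k k' \<longleftrightarrow>
     in_K C k' \<and> (\<forall>G. in_L C G \<longrightarrow> pairing G k' = pairing (T t G) k)"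

definition x1_root :: "real \<Rightarrow> real \<Rightarrow> real" where
  "x1_root z \<beta> = (THE x. 0 < x \<and> x \<le> 1 \<and> x * exp (- x) = z * \<beta>)"

definition alpha1 :: "real \<Rightarrow> real \<Rightarrow> real \<Rightarrow> real" where
  "alpha1 C z \<beta> =
     (if C * \<beta> > 1 then max (1/2) (max (1 / (C * \<beta>)) (1 / C))
      else max (1/2) (max (x1_root z \<beta> / (C * \<beta>)) (1 / C)))"

end

theory Submission
  imports Defs
begin

text \<open>
  Fix \<open>q = sqrt \<alpha>\<close>.  The comparison is done on the predual side, in the weaker norm of
  \<open>L_{\<alpha>C}\<close>.  Since \<open>\<alpha> > \<alpha>\<^sub>1\<close>, one has \<open>z exp (cC\<beta>) \<le> cC\<close> for \<open>c = q\<close> and \<open>c = \<alpha>\<close>, so that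
  the birth term of the limiting operator is dominated by the death term and the operator is
  dissipative in \<open>L_{\<alpha>C}\<close>.  The elementary bound \<open>x exp (-x) \<le> 1 - exp (-x) \<le> x\<close> shows that the two
  kernels differ by at most \<open>\<epsilon> B |\<eta>|\<close> times the limiting one, where \<open>B\<close> is the supremum of the
  potential; hence the two operators differ by at most \<open>\<epsilon> B / (1 - q)\<^sup>2\<close> as maps from \<open>L_C\<close> to
  \<open>L_{\<alpha>C}\<close>.  Dissipativity, applied along backward difference quotients of the difference of the two
  orbits, bounds the left derivative of its \<open>L_{\<alpha>C}\<close> norm by \<open>\<epsilon> B / (1 - q)\<^sup>2\<close> times the \<open>L_C\<close> norm
  of the initial datum, which avoids both Duhamel's formula and any invariance of the domains.
  Duality turns the resulting linear growth into the claim.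
\<close>

section \<open>The Lebesgue--Poisson measure\<close>

text \<open>Why \<open>sqrt \<alpha>\<close>: comparing the two kernels costs one power of the
  configuration size, and bounding the birth term itself costs another. Each power is paid by
  shrinking the base of the weight by a factor \<open>q\<close>, at the price
  \<open>1 / (1 - q)\<close>, so two payments lead from \<open>C\<close> through
  \<open>q * C\<close> to \<open>q\<^sup>2 * C\<close>, which must be \<open>\<alpha> * C\<close>.
  The activity condition is then used twice: at \<open>q * C\<close> for the birth term inside the
  error, at \<open>\<alpha> * C\<close> for dissipativity. The main obstacle is that an orbit
  starting in \<open>L_{2C}\<close> is not known to stay there, so along it the explicit operators
  are available only as limits over elements of the core. Moreover the dissipative estimate is
  implicit: it bounds the difference \<open>w\<close> of two orbits by \<open>w - h * w'\<close>,
  which is the value of \<open>w\<close> at the earlier time up to \<open>o(h)\<close>. This is why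
  left derivatives enter. Finally, the semigroup laws hold only up to functions of norm zero, so
  each use of them appears as a correction term of norm zero.\<close>

definition lebesgue_poisson :: "('d::finite) cfg measure" where
  "lebesgue_poisson = measure_of UNIV {A. \<forall>n. cfg_of n -` A \<inter> space (Pn n) \<in> sets (Pn n)}
     (\<lambda>A. \<Sum>n. ennreal (1 / fact n) * emeasure (Pn n) (cfg_of n -` A \<inter> space (Pn n)))"

lemma sigma_algebra_cfg:
  "sigma_algebra UNIV {A :: ('d::finite) cfg set. \<forall>n. cfg_of n -` A \<inter> space (Pn n) \<in> sets (Pn n)}"
proof (unfold sigma_algebra_iff2, intro conjI ballI allI impI)
  fix A :: "'d cfg set" assume "A \<in> {A. \<forall>n. cfg_of n -` A \<inter> space (Pn n) \<in> sets (Pn n)}"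
  moreover have "cfg_of n -` (UNIV - A) \<inter> space (Pn n) = space (Pn n) - (cfg_of n -` A \<inter> space (Pn n))" for n
    by auto
  ultimately show "UNIV - A \<in> {A. \<forall>n. cfg_of n -` A \<inter> space (Pn n) \<in> sets (Pn n)}" by auto
next
  fix A :: "nat \<Rightarrow> 'd cfg set"
  assume "range A \<subseteq> {A. \<forall>n. cfg_of n -` A \<inter> space (Pn n) \<in> sets (Pn n)}"
  moreover have "cfg_of n -` (\<Union>i. A i) \<inter> space (Pn n) = (\<Union>i. cfg_of n -` A i \<inter> space (Pn n))" for n
    by auto
  moreover have "(\<Union>i. cfg_of n -` A i \<inter> space (Pn n)) \<in> sets (Pn n)" for n
    using calculation(1) by (intro sets.countable_UN) auto
  ultimately show "(\<Union>i. A i) \<in> {A. \<forall>n. cfg_of n -` A \<inter> space (Pn n) \<in> sets (Pn n)}"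
    by simp
qed auto

lemma space_lebesgue_poisson [simp]: "space lebesgue_poisson = UNIV"
  by (simp add: lebesgue_poisson_def space_measure_of_conv)

lemma sets_lebesgue_poisson:
  "sets lebesgue_poisson = {A. \<forall>n. cfg_of n -` A \<inter> space (Pn n) \<in> sets (Pn n)}"
  using sigma_algebra.sigma_sets_eq[OF sigma_algebra_cfg]
  by (simp add: lebesgue_poisson_def sets_measure_of_conv)

lemma measurable_cfg_of [measurable]: "cfg_of n \<in> Pn n \<rightarrow>\<^sub>M lebesgue_poisson"
  by (auto simp: measurable_def sets_lebesgue_poisson)

text \<open>Universal property of the final sigma-algebra. From here on the level-by-level
  definitions can be replaced by measurability and integration with respect to a single
  measure.\<close>

lemma lp_measurable_iff: "lp_measurable G \<longleftrightarrow> G \<in> borel_measurable lebesgue_poisson"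
proof
  assume "lp_measurable G"
  then show "G \<in> borel_measurable lebesgue_poisson"
    unfolding lp_measurable_def
    by (auto simp: measurable_def sets_lebesgue_poisson vimage_def Int_def)
next
  assume [measurable]: "G \<in> borel_measurable lebesgue_poisson"
  show "lp_measurable G" unfolding lp_measurable_def by measurable
qed

text \<open>Tonelli's theorem, with one of the two series read as an integral against counting
  measure.\<close>

lemma suminf_swap_ennreal:
  fixes f :: "nat \<Rightarrow> nat \<Rightarrow> ennreal"
  shows "(\<Sum>i. \<Sum>n. f i n) = (\<Sum>n. \<Sum>i. f i n)"
  using nn_integral_suminf[of f "count_space UNIV"] by (simp add: nn_integral_count_space_nat)

lemma emeasure_lebesgue_poisson:
  fixes A :: "('d::finite) cfg set"
  assumes "A \<in> sets lebesgue_poisson"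
  shows "emeasure lebesgue_poisson A =
    (\<Sum>n. ennreal (1 / fact n) * emeasure (Pn n) (cfg_of n -` A \<inter> space (Pn n)))"
proof (rule emeasure_measure_of[OF lebesgue_poisson_def])
  show "countably_additive (sets lebesgue_poisson)
     (\<lambda>A :: 'd cfg set. \<Sum>n. ennreal (1 / fact n) * emeasure (Pn n) (cfg_of n -` A \<inter> space (Pn n)))"
  proof (rule countably_additiveI)
    fix A :: "nat \<Rightarrow> 'd cfg set"
    assume A: "range A \<subseteq> sets lebesgue_poisson" "disjoint_family A"
    have "(\<Sum>i. emeasure (Pn n) (cfg_of n -` A i \<inter> space (Pn n))) =
        emeasure (Pn n) (cfg_of n -` (\<Union>i. A i) \<inter> space (Pn n))" for n
    proof -
      have "cfg_of n -` (\<Union>i. A i) \<inter> space (Pn n) = (\<Union>i. cfg_of n -` A i \<inter> space (Pn n))" by auto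
      moreover have "(\<Sum>i. emeasure (Pn n) (cfg_of n -` A i \<inter> space (Pn n))) =
         emeasure (Pn n) (\<Union>i. cfg_of n -` A i \<inter> space (Pn n))"
      proof (rule suminf_emeasure[where A = "\<lambda>i. cfg_of n -` A i \<inter> space (Pn n)"])
        show "range (\<lambda>i. cfg_of n -` A i \<inter> space (Pn n)) \<subseteq> sets (Pn n)"
          using A(1) by (auto simp: sets_lebesgue_poisson)
        show "disjoint_family (\<lambda>i. cfg_of n -` A i \<inter> space (Pn n))"
          using A(2) unfolding disjoint_family_on_def by blast
      qed
      ultimately show ?thesis by simp
    qed
    moreover have "(\<Sum>i. \<Sum>n. ennreal (1 / fact n) * emeasure (Pn n) (cfg_of n -` A i \<inter> space (Pn n)))
      = (\<Sum>n. \<Sum>i. ennreal (1 / fact n) * emeasure (Pn n) (cfg_of n -` A i \<inter> space (Pn n)))"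
      by (rule suminf_swap_ennreal)
    ultimately show "(\<Sum>i. \<Sum>n. ennreal (1 / fact n) * emeasure (Pn n) (cfg_of n -` A i \<inter> space (Pn n)))
      = (\<Sum>n. ennreal (1 / fact n) * emeasure (Pn n) (cfg_of n -` (\<Union>i. A i) \<inter> space (Pn n)))"
      by simp
  qed
qed (use assms in \<open>auto simp: positive_def\<close>)

text \<open>Both sides are linear and respect increasing limits, so agreement on indicators is
  enough. In the limit case the supremum has to pass through the series, which is allowed because
  every level integral increases.\<close>

lemma nn_integral_lebesgue_poisson:
  assumes "F \<in> borel_measurable lebesgue_poisson"
  shows "(\<integral>\<^sup>+\<eta>. F \<eta> \<partial>lebesgue_poisson) = LP_nn F"
  using assms
proof (induction rule: borel_measurable_induct)
  case (cong f g)
  then show ?case by (metis ext space_lebesgue_poisson UNIV_I)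
next
  case (set A)
  have "(\<integral>\<^sup>+ x. indicator A (cfg_of n x) \<partial>Pn n) = emeasure (Pn n) (cfg_of n -` A \<inter> space (Pn n))" for n
  proof -
    have "(\<integral>\<^sup>+ x. indicator A (cfg_of n x) \<partial>Pn n) =
        (\<integral>\<^sup>+ x. indicator (cfg_of n -` A \<inter> space (Pn n)) x \<partial>Pn n)"
      by (intro nn_integral_cong) (auto simp: indicator_def)
    then show ?thesis using set by (simp add: sets_lebesgue_poisson)
  qed
  with set show ?case by (simp add: LP_nn_def emeasure_lebesgue_poisson)
next
  case (mult u c)
  then show ?case
    by (simp add: LP_nn_def nn_integral_cmult mult.left_commute[of _ c] ennreal_suminf_cmult)
next
  case (add u v)
  then show ?case
    by (simp add: LP_nn_def nn_integral_add distrib_left suminf_add[symmetric])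
next
  case (seq U)
  have "(\<integral>\<^sup>+ x. (SUP i. U i (cfg_of n x)) \<partial>Pn n) = (SUP i. \<integral>\<^sup>+ x. U i (cfg_of n x) \<partial>Pn n)" for n
    using seq by (intro nn_integral_monotone_convergence_SUP) (auto simp: incseq_def le_fun_def)
  moreover have "(\<integral>\<^sup>+\<eta>. (SUP i. U i \<eta>) \<partial>lebesgue_poisson) = (SUP i. \<integral>\<^sup>+\<eta>. U i \<eta> \<partial>lebesgue_poisson)"
    using seq by (intro nn_integral_monotone_convergence_SUP) (auto simp: incseq_def le_fun_def)
  ultimately show ?case
    using seq
    apply (simp add: LP_nn_def SUP_mult_left_ennreal image_comp)
    apply (subst ennreal_suminf_SUP_eq)
    apply (auto intro!: mult_left_mono nn_integral_mono simp: incseq_def le_fun_def)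
    done
qed


text \<open>All weights \<open>1 / fact n\<close> are strictly positive, so a set is null exactly
  when it is null on each level. This makes \<open>K_bound\<close> an essential bound for one
  measure.\<close>

lemma AE_lebesgue_poisson_iff:
  assumes [measurable]: "Measurable.pred lebesgue_poisson P"
  shows "(AE \<eta> in lebesgue_poisson. P \<eta>) \<longleftrightarrow> (\<forall>n. AE x in Pn n. P (cfg_of n x))"
proof -
  have "{\<eta>. \<not> P \<eta>} \<in> sets lebesgue_poisson"
    using measurable_sets[OF assms, of "{False}"] by (simp add: vimage_def)
  then have "(AE \<eta> in lebesgue_poisson. P \<eta>) \<longleftrightarrow>
     (\<Sum>n. ennreal (1 / fact n) * emeasure (Pn n) (cfg_of n -` {\<eta>. \<not> P \<eta>} \<inter> space (Pn n))) = 0"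
    by (subst AE_iff_measurable[OF _ refl]) (simp_all add: emeasure_lebesgue_poisson)
  also have "\<dots> \<longleftrightarrow> (\<forall>n. emeasure (Pn n) (cfg_of n -` {\<eta>. \<not> P \<eta>} \<inter> space (Pn n)) = 0)"
    by (subst suminf_eq_zero_iff) auto
  also have "\<dots> \<longleftrightarrow> (\<forall>n. AE x in Pn n. P (cfg_of n x))"
  proof -
    have "{x \<in> space (Pn n). \<not> P (cfg_of n x)} \<in> sets (Pn n)" for n by measurable
    then show ?thesis
      by (subst AE_iff_measurable[OF _ refl]) (auto simp: vimage_def Int_def conj_commute)
  qed
  finally show ?thesis .
qed

text \<open>\<open>LP_int\<close> is a bare series of level integrals. Integrability makes the
  series of the positive and of the negative part converge separately, and these may then be
  subtracted.\<close>

lemma integral_lebesgue_poisson: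
  fixes F :: "('d::finite) cfg \<Rightarrow> real"
  assumes F: "integrable lebesgue_poisson F"
  shows "(\<integral>\<eta>. F \<eta> \<partial>lebesgue_poisson) = LP_int F"
proof -
  have [measurable]: "F \<in> borel_measurable lebesgue_poisson" using F by auto
  have nonneg: "integrable (Pn n) (\<lambda>x. f (cfg_of n x))"
      "(\<lambda>n. (1 / fact n) * (\<integral>x. f (cfg_of n x) \<partial>Pn n)) sums (\<integral>\<eta>. f \<eta> \<partial>lebesgue_poisson)"
    if f: "integrable lebesgue_poisson f" and pos: "\<And>\<eta>. 0 \<le> f \<eta>" for f :: "'d cfg \<Rightarrow> real" and n
  proof -
    have [measurable]: "f \<in> borel_measurable lebesgue_poisson" using f by auto
    have eq: "ennreal (\<integral>\<eta>. f \<eta> \<partial>lebesgue_poisson) =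
        (\<Sum>n. ennreal (1 / fact n) * (\<integral>\<^sup>+x. f (cfg_of n x) \<partial>Pn n))"
      using nn_integral_eq_integral[OF f] pos by (simp add: nn_integral_lebesgue_poisson LP_nn_def)
    have "ennreal (1 / fact n) * (\<integral>\<^sup>+x. f (cfg_of n x) \<partial>Pn n) < \<infinity>" for n
      using ennreal_suminf_lessD[OF eq[symmetric, THEN eq_refl, THEN le_less_trans, OF ennreal_less_top]]
      by simp
    then have "(\<integral>\<^sup>+x. f (cfg_of n x) \<partial>Pn n) < \<infinity>" for n
      by (simp add: ennreal_mult_less_top) (metis ennreal_zero_less_top)
    then have int: "integrable (Pn n) (\<lambda>x. f (cfg_of n x))" for n
      by (intro integrableI_nonneg) (auto simp: pos)
    show "integrable (Pn n) (\<lambda>x. f (cfg_of n x))" by (rule int)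
    have "(\<lambda>n. ennreal ((1 / fact n) * (\<integral>x. f (cfg_of n x) \<partial>Pn n))) sums ennreal (\<integral>\<eta>. f \<eta> \<partial>lebesgue_poisson)"
      using int eq by (simp add: nn_integral_eq_integral pos ennreal_mult[symmetric] sums_iff)
    then show "(\<lambda>n. (1 / fact n) * (\<integral>x. f (cfg_of n x) \<partial>Pn n)) sums (\<integral>\<eta>. f \<eta> \<partial>lebesgue_poisson)"
      by (subst (asm) sums_ennreal) (auto intro!: integral_nonneg_AE simp: pos)
  qed
  have pos: "integrable lebesgue_poisson (\<lambda>\<eta>. max 0 (F \<eta>))"
    and neg: "integrable lebesgue_poisson (\<lambda>\<eta>. max 0 (- F \<eta>))"
    using F by auto
  have split: "F \<eta> = max 0 (F \<eta>) - max 0 (- F \<eta>)" for \<eta> by auto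
  have "(\<lambda>n. (1 / fact n) * (\<integral>x. F (cfg_of n x) \<partial>Pn n)) sums (\<integral>\<eta>. F \<eta> \<partial>lebesgue_poisson)"
    using sums_diff[OF nonneg(2)[OF pos] nonneg(2)[OF neg]] nonneg(1)[OF pos] nonneg(1)[OF neg] pos neg
    by (simp add: diff_divide_distrib[symmetric] Bochner_Integration.integral_diff[symmetric] split[symmetric])
  then show ?thesis by (simp add: LP_int_def sums_iff)
qed

section \<open>Labelled tuples and the configurations they represent\<close>

lemma product_sigma_finite_lborel: "product_sigma_finite (\<lambda>_::'i. lborel :: ('a::euclidean_space) measure)"
  by standard

lemma sigma_finite_Pn: "sigma_finite_measure (Pn n)"
  unfolding Pn_def by (rule product_sigma_finite.sigma_finite[OF product_sigma_finite_lborel]) simp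

lemma measurable_Pn_component [measurable (raw)]: "i < n \<Longrightarrow> (\<lambda>x. x i) \<in> borel_measurable (Pn n)"
  using measurable_component_singleton[of i "{..<n}" "\<lambda>_. lborel"] unfolding Pn_def by simp

lemma pred_component_eq:
  assumes "i < n" "j < n"
  shows "Measurable.pred (Pn n) (\<lambda>x. x i = x j)"
proof -
  have "Measurable.pred (Pn n) (\<lambda>x. dist (x i) (x j) = 0)"
    using assms by measurable
  then show ?thesis by simp
qed

text \<open>\<open>cfg_of\<close> accepts only initial segments of labels, whereas splitting a
  configuration produces arbitrary finite label sets. A bijection with \<open>{..<card I}\<close>
  reconciles the two.\<close>

lemma measurable_image_configuration:
  fixes f :: "'i \<Rightarrow> 'b \<Rightarrow> real^('d::finite)"
  assumes "finite I" and f: "\<And>i. i \<in> I \<Longrightarrow> f i \<in> borel_measurable M"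
  shows "(\<lambda>\<omega>. (\<lambda>i. f i \<omega>) ` I) \<in> M \<rightarrow>\<^sub>M lebesgue_poisson"
proof -
  obtain e where e: "bij_betw e {..<card I} I"
    using ex_bij_betw_nat_finite[OF \<open>finite I\<close>] by (auto simp: lessThan_atLeast0)
  have "(\<lambda>\<omega>. \<lambda>j\<in>{..<card I}. f (e j) \<omega>) \<in> M \<rightarrow>\<^sub>M Pn (card I)"
    unfolding Pn_def using bij_betwE[OF e] f by (intro measurable_restrict) auto
  from measurable_compose[OF this measurable_cfg_of]
  have "(\<lambda>\<omega>. cfg_of (card I) (\<lambda>j\<in>{..<card I}. f (e j) \<omega>)) \<in> M \<rightarrow>\<^sub>M lebesgue_poisson" .
  moreover have "cfg_of (card I) (\<lambda>j\<in>{..<card I}. f (e j) \<omega>) = (\<lambda>i. f i \<omega>) ` I" for \<omega>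
  proof -
    have "cfg_of (card I) (\<lambda>j\<in>{..<card I}. f (e j) \<omega>) = (\<lambda>i. f i \<omega>) ` e ` {..<card I}"
      by (auto simp: cfg_of_def)
    then show ?thesis using bij_betw_imp_surj_on[OF e] by simp
  qed
  ultimately show ?thesis by simp
qed

lemma measurable_insert_image:
  fixes f :: "'i \<Rightarrow> 'b \<Rightarrow> real^('d::finite)"
  assumes "finite I" and f: "\<And>i. i \<in> I \<Longrightarrow> f i \<in> borel_measurable M" and g: "g \<in> borel_measurable M"
  shows "(\<lambda>\<omega>. insert (g \<omega>) ((\<lambda>i. f i \<omega>) ` I)) \<in> M \<rightarrow>\<^sub>M lebesgue_poisson"
proof -
  \<comment> \<open>The label \<open>None\<close> stands for the inserted point, so the insertion
    becomes an image over a finite index set.\<close>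
  let ?h = "\<lambda>i \<omega>. case i of None \<Rightarrow> g \<omega> | Some i \<Rightarrow> f i \<omega>"
  have "(\<lambda>\<omega>. (\<lambda>i. ?h i \<omega>) ` insert None (Some ` I)) \<in> M \<rightarrow>\<^sub>M lebesgue_poisson"
    by (rule measurable_image_configuration) (use assms in auto)
  then show ?thesis by (simp add: image_image)
qed

lemma measurable_insert_point: "insert y \<in> lebesgue_poisson \<rightarrow>\<^sub>M lebesgue_poisson"
proof -
  have "(\<lambda>x. insert y (cfg_of n x)) \<in> Pn n \<rightarrow>\<^sub>M lebesgue_poisson" for n
    unfolding cfg_of_def by (rule measurable_insert_image) (auto intro: measurable_Pn_component)
  from measurable_sets[OF this] show ?thesis
    by (auto simp: measurable_def sets_lebesgue_poisson vimage_def Int_def)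
qed

lemma measurable_insert_const:
  assumes "finite \<xi>"
  shows "(\<lambda>x. insert x \<xi>) \<in> lborel \<rightarrow>\<^sub>M lebesgue_poisson"
  using measurable_insert_image[of \<xi> "\<lambda>i _. i" lborel "\<lambda>x. x"] assms by simp

text \<open>The tuples with repeated points, although negligible, matter for the sigma-algebra; on them a
  configuration is already described by a shorter tuple.\<close>

lemma sets_lebesgue_poissonI:
  fixes A :: "('d::finite) cfg set"
  assumes inj: "\<And>n. {x \<in> space (Pn n). inj_on x {..<n} \<and> cfg_of n x \<in> A} \<in> sets (Pn n)"
  shows "A \<in> sets lebesgue_poisson"
proof -
  have "{x \<in> space (Pn n). cfg_of n x \<in> A} \<in> sets (Pn n)" for n
  proof (induction n)
    case 0
    then show ?case using inj[of 0] by simp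
  next
    case (Suc m)
    let ?P = "Pn (Suc m) :: (nat \<Rightarrow> real^'d) measure"
    \<comment> \<open>Deleting coordinate \<open>j\<close> loses no point when another coordinate
      has the same value. The shortened tuple has length \<open>m\<close>, where the induction
      hypothesis applies.\<close>
    let ?skip = "\<lambda>j (x::nat \<Rightarrow> real^'d). \<lambda>k\<in>{..<m}. x (if k < j then k else Suc k)"
    have skip: "?skip j \<in> ?P \<rightarrow>\<^sub>M Pn m" for j
      unfolding Pn_def[of m] by (intro measurable_restrict) auto
    have sk: "{x \<in> space ?P. x i = x j \<and> cfg_of m (?skip j x) \<in> A} \<in> sets ?P"
      if "i < Suc m" "j < Suc m" for i j
    proof -
      have "{x \<in> space ?P. x i = x j} \<in> sets ?P"
        using pred_component_eq[OF that] by (simp add: pred_def)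
      moreover have "?skip j -` {x \<in> space (Pn m). cfg_of m x \<in> A} \<inter> space ?P \<in> sets ?P"
        by (rule measurable_sets[OF skip Suc.IH])
      ultimately have "{x \<in> space ?P. x i = x j} \<inter>
          (?skip j -` {x \<in> space (Pn m). cfg_of m x \<in> A} \<inter> space ?P) \<in> sets ?P" by (rule sets.Int)
      also have "{x \<in> space ?P. x i = x j} \<inter> (?skip j -` {x \<in> space (Pn m). cfg_of m x \<in> A} \<inter> space ?P) =
          {x \<in> space ?P. x i = x j \<and> cfg_of m (?skip j x) \<in> A}"
        using measurable_space[OF skip] by auto
      finally show ?thesis .
    qed
    have eq: "cfg_of (Suc m) x = cfg_of m (?skip j x)"
      if ij: "i < Suc m" "j < Suc m" "i \<noteq> j" "x i = x j" for i j x
    proof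
      show "cfg_of (Suc m) x \<subseteq> cfg_of m (?skip j x)"
      proof
        fix y assume "y \<in> cfg_of (Suc m) x"
        then obtain k where "k < Suc m" "y = x k" by (auto simp: cfg_of_def)
        then obtain k where k: "k < Suc m" "y = x k" "k \<noteq> j" using ij by metis
        \<comment> \<open>Labels beyond the deleted \<open>j\<close> move down by one.\<close>
        let ?k = "if k < j then k else k - 1"
        have "?k < m" "?skip j x ?k = y" using k ij by auto
        then show "y \<in> cfg_of m (?skip j x)" unfolding cfg_of_def by blast
      qed
      show "cfg_of m (?skip j x) \<subseteq> cfg_of (Suc m) x"
        by (auto simp: cfg_of_def)
    qed
    let ?D = "\<lambda>(i, j). {x \<in> space ?P. x i = x j \<and> cfg_of m (?skip j x) \<in> A}"
    have decomp: "{x \<in> space ?P. cfg_of (Suc m) x \<in> A} =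
       {x \<in> space ?P. inj_on x {..<Suc m} \<and> cfg_of (Suc m) x \<in> A} \<union>
       (\<Union>p\<in>{(i, j). i < Suc m \<and> j < Suc m \<and> i \<noteq> j}. ?D p)" (is "_ = ?R")
    proof (intro equalityI subsetI)
      fix x assume x: "x \<in> {x \<in> space ?P. cfg_of (Suc m) x \<in> A}"
      show "x \<in> ?R"
      proof (cases "inj_on x {..<Suc m}")
        case True then show ?thesis using x by auto
      next
        case False
        then obtain i j where ij: "i < Suc m" "j < Suc m" "i \<noteq> j" "x i = x j"
          unfolding inj_on_def by blast
        have "x \<in> ?D (i, j)" using x ij(4) by (simp add: eq[OF ij, symmetric])
        then show ?thesis using ij by (intro UnI2 UN_I[of "(i, j)"]) simp_all
      qed
    next
      fix x assume "x \<in> ?R"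
      then consider "x \<in> {x \<in> space ?P. inj_on x {..<Suc m} \<and> cfg_of (Suc m) x \<in> A}"
        | i j where "i < Suc m" "j < Suc m" "i \<noteq> j" "x \<in> ?D (i, j)" by blast
      then show "x \<in> {x \<in> space ?P. cfg_of (Suc m) x \<in> A}"
        by cases (simp_all add: eq)
    qed
    have "finite {(i,j). i < Suc m \<and> j < Suc m \<and> i \<noteq> j}"
      by (rule finite_subset[of _ "{..<Suc m} \<times> {..<Suc m}"]) auto
    then have UN: "(\<Union>p\<in>{(i, j). i < Suc m \<and> j < Suc m \<and> i \<noteq> j}. ?D p) \<in> sets ?P"
    proof (rule sets.finite_UN)
      fix p assume "p \<in> {(i, j). i < Suc m \<and> j < Suc m \<and> i \<noteq> j}"
      then obtain i j where "p = (i, j)" "i < Suc m" "j < Suc m" by blast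
      with sk[of i j] show "?D p \<in> sets ?P" by simp
    qed
    show ?case
      unfolding decomp by (rule sets.Un[OF inj UN])
  qed
  then show ?thesis by (simp add: sets_lebesgue_poisson vimage_def Int_def conj_commute)
qed

lemma pred_inj_on_Pn [measurable]: "Measurable.pred (Pn n) (\<lambda>x. inj_on x {..<n})"
  unfolding inj_on_def
  by (intro pred_intros_finite pred_intros_logic) (auto intro: pred_component_eq)

text \<open>Cardinalities and sums over subsets have a formula in the coordinates only when no point
  is repeated. By the preceding reduction to shorter tuples, agreement with such a formula on
  injective tuples already gives measurability; \<open>g n\<close> may differ from \<open>f\<close>
  elsewhere.\<close>

lemma measurable_lebesgue_poissonI:
  fixes f :: "('d::finite) cfg \<Rightarrow> 'b"
  assumes "space N = UNIV"
    and g: "\<And>n. g n \<in> Pn n \<rightarrow>\<^sub>M N"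
    and eq: "\<And>n x. inj_on x {..<n} \<Longrightarrow> f (cfg_of n x) = g n x"
  shows "f \<in> lebesgue_poisson \<rightarrow>\<^sub>M N"
proof (rule measurableI)
  fix B assume B: "B \<in> sets N"
  have "{x \<in> space (Pn n). inj_on x {..<n} \<and> cfg_of n x \<in> f -` B} \<in> sets (Pn n)" for n
  proof -
    have "{x \<in> space (Pn n). inj_on x {..<n}} \<inter> (g n -` B \<inter> space (Pn n)) \<in> sets (Pn n)"
      by (intro sets.Int[OF _ measurable_sets[OF g B]] pred_inj_on_Pn[unfolded pred_def])
    also have "{x \<in> space (Pn n). inj_on x {..<n}} \<inter> (g n -` B \<inter> space (Pn n)) =
        {x \<in> space (Pn n). inj_on x {..<n} \<and> cfg_of n x \<in> f -` B}"
      using eq by auto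
    finally show ?thesis .
  qed
  then show "f -` B \<inter> space lebesgue_poisson \<in> sets lebesgue_poisson"
    by (simp add: sets_lebesgue_poissonI)
qed (simp add: assms)

lemma card_cfg_of: "inj_on x {..<n} \<Longrightarrow> card (cfg_of n x) = n"
  by (simp add: cfg_of_def card_image)

lemma measurable_card_configuration [measurable]: "card \<in> lebesgue_poisson \<rightarrow>\<^sub>M count_space UNIV"
  by (rule measurable_lebesgue_poissonI[where g = "\<lambda>n _. n"]) (auto simp: card_cfg_of)

text \<open>Integrating out coordinate \<open>i\<close> first, the coincidence
  \<open>x i = x j\<close> confines it to a single point, which has Lebesgue measure zero. There are
  finitely many pairs.\<close>

lemma AE_inj_on_Pn: "AE x in Pn n. inj_on (x :: nat \<Rightarrow> real^('d::finite)) {..<n}"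
proof -
  interpret product_sigma_finite "\<lambda>_::nat. lborel :: (real^'d) measure"
    by (rule product_sigma_finite_lborel)
  have "AE x in Pn n. x i \<noteq> (x j :: real^'d)" if "i < n" "j < n" "i \<noteq> j" for i j
  proof -
    let ?I = "{..<n} - {i}"
    let ?f = "\<lambda>x :: nat \<Rightarrow> real^'d. indicator {x. x i = x j} x :: ennreal"
    have I: "{..<n} = insert i ?I" using that by auto
    have m: "?f \<in> borel_measurable (Pn n)"
      using pred_component_eq[of i n j] that by measurable
    have "(\<integral>\<^sup>+x. ?f x \<partial>Pn n) = (\<integral>\<^sup>+x. \<integral>\<^sup>+y. ?f (x(i := y)) \<partial>lborel \<partial>PiM ?I (\<lambda>_. lborel))"
      using m unfolding Pn_def by (subst (asm) I, subst I, intro product_nn_integral_insert) auto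
    also have "\<dots> = (\<integral>\<^sup>+x. \<integral>\<^sup>+y. indicator {x j} y \<partial>lborel \<partial>PiM ?I (\<lambda>_. lborel :: (real^'d) measure))"
      using that by (intro nn_integral_cong) (auto simp: indicator_def)
    also have "\<dots> = 0" by simp
    finally have "AE x in Pn n. ?f x = 0" using m by (simp add: nn_integral_0_iff_AE)
    then show ?thesis by eventually_elim (auto simp: indicator_def)
  qed
  then have "AE x in Pn n. \<forall>i\<in>{..<n}. \<forall>j\<in>{..<n}. i \<noteq> j \<longrightarrow> x i \<noteq> (x j :: real^'d)"
    by (auto simp: AE_finite_all intro!: AE_impI)
  then show ?thesis by eventually_elim (auto simp: inj_on_def)
qed

lemma nn_integral_insert_configuration:
  fixes H :: "('d::finite) cfg \<Rightarrow> ennreal" and T :: "nat set"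
  assumes "finite T" "b \<notin> T" and [measurable]: "H \<in> borel_measurable lebesgue_poisson"
  shows "(\<integral>\<^sup>+x. H (x ` insert b T) \<partial>PiM (insert b T) (\<lambda>_. lborel)) =
      (\<integral>\<^sup>+y. \<integral>\<^sup>+x. H (insert y (x ` T)) \<partial>PiM T (\<lambda>_. lborel) \<partial>lborel)"
proof -
  interpret product_sigma_finite "\<lambda>_::nat. lborel :: (real^'d) measure"
    by (rule product_sigma_finite_lborel)
  have [measurable]: "(\<lambda>x. x ` insert b T) \<in> PiM (insert b T) (\<lambda>_::nat. lborel) \<rightarrow>\<^sub>M lebesgue_poisson"
    using assms by (intro measurable_image_configuration) auto
  have "x(b := y) ` insert b T = insert y (x ` T)" for x :: "nat \<Rightarrow> real^'d" and y
    using assms by auto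
  then show ?thesis using assms
    by (subst product_nn_integral_insert_rev) (auto simp del: image_insert)
qed

text \<open>A function of the configuration does not see the labels, so only their number matters.
  Peeling one point off on both sides reduces this to the smaller set, with \<open>H\<close>
  replaced by \<open>\<lambda>\<eta>. H (insert y \<eta>)\<close>; hence the induction is over all
  \<open>H\<close>.\<close>

lemma nn_integral_image_configuration:
  fixes H :: "('d::finite) cfg \<Rightarrow> ennreal"
  assumes "finite S" "H \<in> borel_measurable lebesgue_poisson"
  shows "(\<integral>\<^sup>+x. H (x ` S) \<partial>PiM S (\<lambda>_::nat. lborel)) = (\<integral>\<^sup>+x. H (cfg_of (card S) x) \<partial>Pn (card S))"
  using assms
proof (induction S arbitrary: H rule: finite_induct)
  case empty
  then show ?case by (simp add: Pn_def cfg_of_def)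
next
  case (insert a S)
  note [measurable] = insert.prems
  note peel = nn_integral_insert_configuration[OF _ _ insert.prems]
  have "(\<lambda>\<eta>. H (insert y \<eta>)) \<in> borel_measurable lebesgue_poisson" for y
    using measurable_insert_point[of y] by measurable
  note IH = insert.IH[OF this]
  have "(\<integral>\<^sup>+x. H (x ` insert a S) \<partial>PiM (insert a S) (\<lambda>_::nat. lborel)) =
     (\<integral>\<^sup>+y. \<integral>\<^sup>+x. H (insert y (x ` {..<card S})) \<partial>PiM {..<card S} (\<lambda>_. lborel) \<partial>lborel)"
    by (simp only: peel[OF insert.hyps(1,2)] IH) (simp add: Pn_def cfg_of_def)
  also have "\<dots> = (\<integral>\<^sup>+x. H (cfg_of (Suc (card S)) x) \<partial>Pn (Suc (card S)))"
    by (subst peel[symmetric]) (auto simp: Pn_def cfg_of_def lessThan_Suc)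
  finally show ?case using insert.hyps by simp
qed

section \<open>Bounds for the birth term\<close>

text \<open>A nonnegative birth operator, valued in \<open>ennreal\<close> so that Tonelli's theorem
  applies before anything is known to be integrable. With \<open>w = \<phi>\<close> it dominates the
  birth terms of both operators.\<close>

definition majorant_op :: "(real^('d::finite) \<Rightarrow> ennreal) \<Rightarrow> ('d cfg \<Rightarrow> ennreal) \<Rightarrow> 'd cfg \<Rightarrow> ennreal" where
  "majorant_op w G \<eta> = (\<Sum>\<xi>\<in>Pow \<eta>. \<integral>\<^sup>+y. G (insert y \<xi>) * (\<Prod>u\<in>\<eta> - \<xi>. w (y - u)) \<partial>lborel)"

lemma sum_Pow_image:
  assumes "inj_on x I"
  shows "(\<Sum>\<xi>\<in>Pow (x ` I). h \<xi> (x ` I - \<xi>)) = (\<Sum>S\<in>Pow I. h (x ` S) (x ` (I - S)))"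
proof -
  have "(\<Sum>\<xi>\<in>Pow (x ` I). h \<xi> (x ` I - \<xi>)) = (\<Sum>S\<in>Pow I. h (x ` S) (x ` I - x ` S))"
    by (simp add: image_Pow_surj[symmetric, OF refl] sum.reindex[OF inj_on_image_Pow[OF assms]])
  also have "\<dots> = (\<Sum>S\<in>Pow I. h (x ` S) (x ` (I - S)))"
    using assms by (intro sum.cong refl) (simp add: inj_on_image_set_diff[OF assms])
  finally show ?thesis .
qed

text \<open>Summing over label sets instead of subsets makes the index set independent of
  \<open>x\<close>, as measurability and termwise integration require.\<close>

lemma majorant_op_cfg_of:
  assumes "inj_on x {..<n}"
  shows "majorant_op w G (cfg_of n x) =
    (\<Sum>S\<in>Pow {..<n}. \<integral>\<^sup>+y. G (insert y (x ` S)) * (\<Prod>i\<in>{..<n} - S. w (y - x i)) \<partial>lborel)"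
  unfolding majorant_op_def cfg_of_def
  by (subst sum_Pow_image[OF assms])
     (auto intro!: sum.cong nn_integral_cong simp: prod.reindex inj_on_subset[OF assms])

lemma measurable_insert_image_pair [measurable]:
  assumes "S \<subseteq> {..<n}"
  shows "(\<lambda>(x, y). insert y (x ` S)) \<in> Pn n \<Otimes>\<^sub>M lborel \<rightarrow>\<^sub>M lebesgue_poisson"
proof -
  have "(\<lambda>p. insert (snd p) ((\<lambda>i. fst p i) ` S)) \<in> Pn n \<Otimes>\<^sub>M lborel \<rightarrow>\<^sub>M lebesgue_poisson"
    using assms by (intro measurable_insert_image)
      (auto intro: finite_subset measurable_compose[OF measurable_fst measurable_Pn_component])
  then show ?thesis by (simp add: case_prod_beta')
qed

lemma measurable_prod_shift_pair [measurable]: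
  fixes w :: "real^('d::finite) \<Rightarrow> 'a::{second_countable_topology, real_normed_field}"
  assumes "T \<subseteq> {..<n}" and [measurable]: "w \<in> borel_measurable lborel"
  shows "(\<lambda>(x, y). \<Prod>i\<in>T. w (y - x i)) \<in> borel_measurable (Pn n \<Otimes>\<^sub>M lborel)"
proof -
  have [measurable]: "w \<in> borel_measurable borel" using assms(2) by simp
  have "(\<lambda>p. w (snd p - fst p i)) \<in> borel_measurable (Pn n \<Otimes>\<^sub>M lborel)" if "i \<in> T" for i
  proof -
    have [measurable]: "(\<lambda>p. fst p i) \<in> borel_measurable (Pn n \<Otimes>\<^sub>M lborel)"
      using that assms(1) by (intro measurable_compose[OF measurable_fst measurable_Pn_component]) auto
    show ?thesis by measurable
  qed
  then show ?thesis by (simp add: case_prod_beta')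
qed

lemma measurable_prod_shift_pair_ennreal [measurable]:
  fixes w :: "real^('d::finite) \<Rightarrow> ennreal"
  assumes "T \<subseteq> {..<n}" and [measurable]: "w \<in> borel_measurable lborel"
  shows "(\<lambda>(x, y). \<Prod>i\<in>T. w (y - x i)) \<in> borel_measurable (Pn n \<Otimes>\<^sub>M lborel)"
proof -
  have [measurable]: "w \<in> borel_measurable borel" using assms(2) by simp
  have "(\<lambda>p. w (snd p - fst p i)) \<in> borel_measurable (Pn n \<Otimes>\<^sub>M lborel)" if "i \<in> T" for i
  proof -
    have [measurable]: "(\<lambda>p. fst p i) \<in> borel_measurable (Pn n \<Otimes>\<^sub>M lborel)"
      using that assms(1) by (intro measurable_compose[OF measurable_fst measurable_Pn_component]) auto
    show ?thesis by measurable
  qed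
  then show ?thesis by (simp add: case_prod_beta')
qed

lemma measurable_majorant_summand:
  assumes S: "S \<subseteq> {..<n}" and G [measurable]: "G \<in> borel_measurable lebesgue_poisson"
    and w: "w \<in> borel_measurable lborel"
  shows "(\<lambda>(x, y). G (insert y (x ` S)) * (\<Prod>i\<in>{..<n} - S. w (y - x i)) :: ennreal)
      \<in> borel_measurable (Pn n \<Otimes>\<^sub>M lborel)"
  using measurable_compose[OF measurable_insert_image_pair[OF S] G]
    measurable_prod_shift_pair_ennreal[of "{..<n} - S" n w] w
  by (auto simp: case_prod_beta' intro: borel_measurable_times)

lemma measurable_majorant_op [measurable (raw)]:
  assumes "G \<in> borel_measurable lebesgue_poisson" "w \<in> borel_measurable lborel"
  shows "majorant_op w G \<in> borel_measurable lebesgue_poisson"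
proof (rule measurable_lebesgue_poissonI)
  show "(\<lambda>x. \<Sum>S\<in>Pow {..<n}. \<integral>\<^sup>+y. G (insert y (x ` S)) * (\<Prod>i\<in>{..<n} - S. w (y - x i)) \<partial>lborel)
      \<in> borel_measurable (Pn n)" for n
    using measurable_majorant_summand[OF _ assms]
    by (intro borel_measurable_sum lborel.borel_measurable_nn_integral) auto
qed (auto simp: majorant_op_cfg_of)

lemma nn_integral_even_shift:
  fixes w :: "real^('d::finite) \<Rightarrow> ennreal"
  assumes w: "w \<in> borel_measurable lborel" and even: "\<And>u. w (- u) = w u"
  shows "(\<integral>\<^sup>+u. w (y - u) \<partial>lborel) = (\<integral>\<^sup>+u. w u \<partial>lborel)"
proof -
  have [measurable]: "w \<in> borel_measurable borel" using w by simp
  have "(\<integral>\<^sup>+u. w u \<partial>lborel) = (\<integral>\<^sup>+u. w (- y + u) \<partial>lborel)"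
    by (subst lborel_distr_plus[of "- y", symmetric]) (simp add: nn_integral_distr)
  also have "\<dots> = (\<integral>\<^sup>+u. w (y - u) \<partial>lborel)"
    by (intro nn_integral_cong) (metis even minus_diff_eq uminus_add_conv_diff)
  finally show ?thesis by simp
qed

text \<open>For a fixed new point \<open>y\<close>, the coordinates in \<open>S\<close> enter only
  \<open>G\<close> and the remaining ones only the product of \<open>w\<close>, so the integral
  factorizes. By evenness and translation invariance each remaining coordinate contributes the total
  mass of \<open>w\<close>, whatever \<open>y\<close> is.\<close>

lemma nn_integral_majorant_summand:
  fixes G :: "('d::finite) cfg \<Rightarrow> ennreal"
  assumes S: "S \<subseteq> {..<n}" and G [measurable]: "G \<in> borel_measurable lebesgue_poisson"
    and w: "w \<in> borel_measurable lborel" and even: "\<And>u. w (- u) = w u"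
  shows "(\<integral>\<^sup>+x. \<integral>\<^sup>+y. G (insert y (x ` S)) * (\<Prod>i\<in>{..<n} - S. w (y - x i)) \<partial>lborel \<partial>Pn n) =
    (\<integral>\<^sup>+u. w u \<partial>lborel) ^ (n - card S) * (\<integral>\<^sup>+x. G (cfg_of (Suc (card S)) x) \<partial>Pn (Suc (card S)))"
proof -
  interpret product_sigma_finite "\<lambda>_::nat. lborel :: (real^'d) measure"
    by (rule product_sigma_finite_lborel)
  interpret P: sigma_finite_measure "Pn n :: (nat \<Rightarrow> real^'d) measure" by (rule sigma_finite_Pn)
  interpret PL: pair_sigma_finite "Pn n :: (nat \<Rightarrow> real^'d) measure" "lborel :: (real^'d) measure" ..
  have [measurable]: "w \<in> borel_measurable borel" using w by simp
  let ?T = "{..<n} - S" and ?m = "card S"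
  have fin: "finite S" using S finite_subset by blast
  have n: "{..<n} = S \<union> ?T" using S by auto
  have "(\<integral>\<^sup>+x. \<integral>\<^sup>+y. G (insert y (x ` S)) * (\<Prod>i\<in>?T. w (y - x i)) \<partial>lborel \<partial>Pn n) =
      (\<integral>\<^sup>+y. \<integral>\<^sup>+x. G (insert y (x ` S)) * (\<Prod>i\<in>?T. w (y - x i)) \<partial>Pn n \<partial>lborel)"
    using PL.Fubini[OF measurable_majorant_summand[OF S G w]] by simp
  also have "\<dots> = (\<integral>\<^sup>+y. (\<integral>\<^sup>+u. w u \<partial>lborel) ^ (n - ?m) * (\<integral>\<^sup>+x. G (insert y (x ` S)) \<partial>PiM S (\<lambda>_. lborel)) \<partial>lborel)"
  proof (intro nn_integral_cong)
    fix y :: "real^'d"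
    have m: "(\<lambda>x. G (insert y (x ` S)) * (\<Prod>i\<in>?T. w (y - x i))) \<in> borel_measurable (Pn n)"
      using measurable_compose[OF measurable_Pair2'[of y lborel "Pn n"] measurable_majorant_summand[OF S G w]]
      by simp
    have [measurable]: "(\<lambda>x. G (insert y (x ` S))) \<in> borel_measurable (PiM S (\<lambda>_. lborel))"
      using fin by (intro measurable_compose[OF measurable_insert_image G]) auto
    have "(\<integral>\<^sup>+x. G (insert y (x ` S)) * (\<Prod>i\<in>?T. w (y - x i)) \<partial>Pn n) =
       (\<integral>\<^sup>+x. \<integral>\<^sup>+x'. G (insert y (merge S ?T (x, x') ` S)) * (\<Prod>i\<in>?T. w (y - merge S ?T (x, x') i))
           \<partial>PiM ?T (\<lambda>_. lborel) \<partial>PiM S (\<lambda>_. lborel))"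
      using m fin unfolding Pn_def by (subst (asm) n, subst (1) n, intro product_nn_integral_fold) auto
    also have "\<dots> = (\<integral>\<^sup>+x. \<integral>\<^sup>+x'. G (insert y (x ` S)) * (\<Prod>i\<in>?T. w (y - x' i))
           \<partial>PiM ?T (\<lambda>_. lborel) \<partial>PiM S (\<lambda>_. lborel))"
    proof (intro nn_integral_cong)
      fix x x' :: "nat \<Rightarrow> real^'d"
      have "merge S ?T (x, x') ` S = x ` S" by (intro image_cong) (auto simp: merge_def)
      moreover have "(\<Prod>i\<in>?T. w (y - merge S ?T (x, x') i)) = (\<Prod>i\<in>?T. w (y - x' i))"
        by (intro prod.cong) (auto simp: merge_def)
      ultimately show "G (insert y (merge S ?T (x, x') ` S)) * (\<Prod>i\<in>?T. w (y - merge S ?T (x, x') i)) =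
         G (insert y (x ` S)) * (\<Prod>i\<in>?T. w (y - x' i))" by simp
    qed
    also have "\<dots> = (\<integral>\<^sup>+x. G (insert y (x ` S)) * (\<integral>\<^sup>+x'. (\<Prod>i\<in>?T. w (y - x' i)) \<partial>PiM ?T (\<lambda>_. lborel)) \<partial>PiM S (\<lambda>_. lborel))"
      by (intro nn_integral_cong nn_integral_cmult) simp
    also have "(\<integral>\<^sup>+x'. (\<Prod>i\<in>?T. w (y - x' i)) \<partial>PiM ?T (\<lambda>_. lborel)) = (\<integral>\<^sup>+u. w u \<partial>lborel) ^ (n - ?m)"
      using fin S card_Diff_subset[OF fin S]
      by (subst product_nn_integral_prod) (simp_all add: nn_integral_even_shift[OF w even])
    finally show "(\<integral>\<^sup>+x. G (insert y (x ` S)) * (\<Prod>i\<in>?T. w (y - x i)) \<partial>Pn n) =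
      (\<integral>\<^sup>+u. w u \<partial>lborel) ^ (n - ?m) * (\<integral>\<^sup>+x. G (insert y (x ` S)) \<partial>PiM S (\<lambda>_. lborel))"
      by (simp add: nn_integral_multc mult.commute)
  qed
  also have "\<dots> = (\<integral>\<^sup>+y. (\<integral>\<^sup>+u. w u \<partial>lborel) ^ (n - ?m) * (\<integral>\<^sup>+x. G (insert y (cfg_of ?m x)) \<partial>Pn ?m) \<partial>lborel)"
    using measurable_compose[OF measurable_insert_point G]
    by (subst nn_integral_image_configuration[OF fin]) auto
  also have "\<dots> = (\<integral>\<^sup>+u. w u \<partial>lborel) ^ (n - ?m) * (\<integral>\<^sup>+y. \<integral>\<^sup>+x. G (insert y (cfg_of ?m x)) \<partial>Pn ?m \<partial>lborel)"
  proof (rule nn_integral_cmult)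
    interpret Pm: sigma_finite_measure "Pn ?m :: (nat \<Rightarrow> real^'d) measure" by (rule sigma_finite_Pn)
    have "(\<lambda>(y, x). G (insert y (cfg_of ?m x))) \<in> borel_measurable (lborel \<Otimes>\<^sub>M Pn ?m)"
      using measurable_compose[OF measurable_pair_swap'
          measurable_compose[OF measurable_insert_image_pair[OF order_refl, of ?m] G]]
      by (simp add: cfg_of_def case_prod_beta')
    then show "(\<lambda>y. \<integral>\<^sup>+x. G (insert y (cfg_of ?m x)) \<partial>Pn ?m) \<in> borel_measurable lborel"
      by (rule Pm.borel_measurable_nn_integral)
  qed
  \<comment> \<open>The point \<open>y\<close> now joins the coordinates from \<open>S\<close> as
    one further coordinate, whence the level \<open>Suc ?m\<close>.\<close>
  also have "(\<integral>\<^sup>+y. \<integral>\<^sup>+x. G (insert y (cfg_of ?m x)) \<partial>Pn ?m \<partial>lborel) = (\<integral>\<^sup>+x. G (cfg_of (Suc ?m) x) \<partial>Pn (Suc ?m))"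
    using nn_integral_insert_configuration[of "{..<?m}" ?m, OF _ _ G]
    by (simp add: Pn_def cfg_of_def lessThan_Suc)
  finally show ?thesis .
qed

lemma sum_Pow_card:
  fixes f :: "nat \<Rightarrow> 'a::comm_semiring_1"
  shows "(\<Sum>S\<in>Pow {..<n}. f (card S)) = (\<Sum>m\<le>n. of_nat (n choose m) * f m)"
proof -
  have "(\<Sum>S\<in>Pow {..<n}. f (card S)) = (\<Sum>m\<le>n. \<Sum>S\<in>{S \<in> Pow {..<n}. card S = m}. f (card S))"
    by (rule sum.group[symmetric]) (auto intro: order_trans[OF card_mono[of "{..<n}"]])
  also have "\<dots> = (\<Sum>m\<le>n. of_nat (n choose m) * f m)"
  proof (intro sum.cong refl)
    fix m assume "m \<in> {..n}"
    have "card {S. S \<subseteq> {..<n} \<and> card S = m} = n choose m" using n_subsets[of "{..<n}" m] by simp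
    then show "(\<Sum>S\<in>{S \<in> Pow {..<n}. card S = m}. f (card S)) = of_nat (n choose m) * f m" by simp
  qed
  finally show ?thesis .
qed

text \<open>Extending the triangular sum by zero to all pairs allows the order of summation to be
  swapped; the shift \<open>n = l + m\<close> then separates the factors.\<close>

lemma suminf_Cauchy_product_ennreal:
  fixes a b :: "nat \<Rightarrow> ennreal"
  shows "(\<Sum>n. \<Sum>m\<le>n. a m * b (n - m)) = (\<Sum>m. a m) * (\<Sum>l. b l)"
proof -
  have "(\<Sum>n. \<Sum>m\<le>n. a m * b (n - m)) = (\<Sum>n. \<Sum>m. if m \<le> n then a m * b (n - m) else 0)"
  proof (rule suminf_cong)
    fix n
    show "(\<Sum>m\<le>n. a m * b (n - m)) = (\<Sum>m. if m \<le> n then a m * b (n - m) else 0)"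
      by (subst suminf_finite[of "{..n}"]) auto
  qed
  also have "\<dots> = (\<Sum>m. \<Sum>n. if m \<le> n then a m * b (n - m) else 0)" by (rule suminf_swap_ennreal)
  also have "\<dots> = (\<Sum>m. a m * (\<Sum>l. b l))"
  proof (rule suminf_cong)
    fix m
    have "(\<Sum>n. if m \<le> n then a m * b (n - m) else 0) =
       (\<Sum>n. if m \<le> n + m then a m * b (n + m - m) else 0) + (\<Sum>n<m. if m \<le> n then a m * b (n - m) else 0)"
      by (rule suminf_offset) simp
    then show "(\<Sum>n. if m \<le> n then a m * b (n - m) else 0) = a m * (\<Sum>l. b l)"
      by (simp add: ennreal_suminf_cmult)
  qed
  finally show ?thesis by (simp add: ennreal_suminf_multc)
qed

lemma nn_integral_level_sum:
  fixes F :: "('d::finite) cfg \<Rightarrow> ennreal"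
  assumes F [measurable]: "F \<in> borel_measurable lebesgue_poisson"
  shows "(\<integral>\<^sup>+\<eta>. h (card \<eta>) * F \<eta> \<partial>lebesgue_poisson) =
    (\<Sum>n. ennreal (1 / fact n) * (h n * (\<integral>\<^sup>+x. F (cfg_of n x) \<partial>Pn n)))"
proof -
  have "(\<integral>\<^sup>+x. h (card (cfg_of n x)) * F (cfg_of n x) \<partial>Pn n) = h n * (\<integral>\<^sup>+x. F (cfg_of n x) \<partial>Pn n)" for n
  proof -
    have "(\<integral>\<^sup>+x. h (card (cfg_of n x)) * F (cfg_of n x) \<partial>Pn n) = (\<integral>\<^sup>+x. h n * F (cfg_of n x) \<partial>Pn n)"
      by (rule nn_integral_cong_AE, rule AE_mp[OF AE_inj_on_Pn]) (auto simp: card_cfg_of)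
    then show ?thesis by (simp add: nn_integral_cmult)
  qed
  then show ?thesis by (simp add: nn_integral_lebesgue_poisson LP_nn_def)
qed

text \<open>Since \<open>(n choose m) / fact n = 1 / (fact m * fact (n - m))\<close>, the level
  series is a Cauchy product. The points outside the chosen subset sum to
  \<open>exp (c * \<beta>)\<close>. The chosen subset together with the new point is one level
  higher, and rewriting \<open>c ^ m / fact m\<close> on level \<open>m + 1\<close> produces the
  factor \<open>1 / c\<close> and the weight \<open>card \<eta>\<close>.\<close>

lemma nn_integral_majorant_op:
  fixes G :: "('d::finite) cfg \<Rightarrow> ennreal"
  assumes G [measurable]: "G \<in> borel_measurable lebesgue_poisson"
    and w: "w \<in> borel_measurable lborel" and even: "\<And>u. w (- u) = w u"
    and \<beta>: "(\<integral>\<^sup>+u. w u \<partial>lborel) = ennreal \<beta>" "0 \<le> \<beta>" and c: "0 < c"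
  shows "(\<integral>\<^sup>+\<eta>. ennreal (c ^ card \<eta>) * majorant_op w G \<eta> \<partial>lebesgue_poisson) =
    ennreal (exp (c * \<beta>) / c) * (\<integral>\<^sup>+\<eta>. ennreal (real (card \<eta>) * c ^ card \<eta>) * G \<eta> \<partial>lebesgue_poisson)"
proof -
  define J where "J m = (\<integral>\<^sup>+x. G (cfg_of m x) \<partial>Pn m)" for m
  define a where "a m = ennreal (c ^ m / fact m) * J (Suc m)" for m
  define b where "b l = ennreal ((c * \<beta>) ^ l / fact l)" for l
  note Q [measurable] = measurable_majorant_op[OF G w]
  have Qlev: "(\<integral>\<^sup>+x. majorant_op w G (cfg_of n x) \<partial>Pn n) =
      (\<Sum>m\<le>n. of_nat (n choose m) * (ennreal \<beta> ^ (n - m) * J (Suc m)))" for n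
  proof -
    have "(\<integral>\<^sup>+x. majorant_op w G (cfg_of n x) \<partial>Pn n) =
      (\<integral>\<^sup>+x. (\<Sum>S\<in>Pow {..<n}. \<integral>\<^sup>+y. G (insert y (x ` S)) * (\<Prod>i\<in>{..<n} - S. w (y - x i)) \<partial>lborel) \<partial>Pn n)"
      by (rule nn_integral_cong_AE, rule AE_mp[OF AE_inj_on_Pn]) (auto simp: majorant_op_cfg_of)
    also have "\<dots> = (\<Sum>S\<in>Pow {..<n}. \<integral>\<^sup>+x. \<integral>\<^sup>+y. G (insert y (x ` S)) * (\<Prod>i\<in>{..<n} - S. w (y - x i)) \<partial>lborel \<partial>Pn n)"
      using measurable_majorant_summand[OF _ G w]
      by (intro nn_integral_sum lborel.borel_measurable_nn_integral) auto
    also have "\<dots> = (\<Sum>S\<in>Pow {..<n}. ennreal \<beta> ^ (n - card S) * J (Suc (card S)))"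
      by (intro sum.cong refl) (simp add: nn_integral_majorant_summand[OF _ G w even] \<beta>(1) J_def)
    also have "\<dots> = (\<Sum>m\<le>n. of_nat (n choose m) * (ennreal \<beta> ^ (n - m) * J (Suc m)))"
      by (rule sum_Pow_card)
    finally show ?thesis .
  qed
  have "(\<integral>\<^sup>+\<eta>. ennreal (c ^ card \<eta>) * majorant_op w G \<eta> \<partial>lebesgue_poisson) =
     (\<Sum>n. ennreal (1 / fact n) * (ennreal (c ^ n) * (\<integral>\<^sup>+x. majorant_op w G (cfg_of n x) \<partial>Pn n)))"
    using nn_integral_level_sum[OF Q, of "\<lambda>n. ennreal (c ^ n)"] .
  also have "\<dots> = (\<Sum>n. \<Sum>m\<le>n. a m * b (n - m))"
  proof (rule suminf_cong)
    fix n
    have "ennreal (1 / fact n) * (ennreal (c ^ n) * (of_nat (n choose m) * (ennreal \<beta> ^ (n - m) * J (Suc m)))) =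
        a m * b (n - m)" if "m \<le> n" for m
    proof -
      have "1 / fact n * (c ^ n * (real (n choose m) * \<beta> ^ (n - m))) =
          c ^ m / fact m * ((c * \<beta>) ^ (n - m) / fact (n - m))"
        using that by (simp add: binomial_fact power_mult_distrib power_add[symmetric] field_simps)
      then have "ennreal (1 / fact n * (c ^ n * (real (n choose m) * \<beta> ^ (n - m)))) =
          ennreal (c ^ m / fact m * ((c * \<beta>) ^ (n - m) / fact (n - m)))" by simp
      then have "ennreal (1 / fact n) * (ennreal (c ^ n) * (of_nat (n choose m) * ennreal \<beta> ^ (n - m))) =
          ennreal (c ^ m / fact m) * b (n - m)"
        using c \<beta>(2) unfolding b_def ennreal_of_nat_eq_real_of_nat
        by (simp add: ennreal_power ennreal_mult'[symmetric])
      then show ?thesis unfolding a_def by (simp add: mult_ac)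
    qed
    then show "ennreal (1 / fact n) * (ennreal (c ^ n) * (\<integral>\<^sup>+x. majorant_op w G (cfg_of n x) \<partial>Pn n)) = (\<Sum>m\<le>n. a m * b (n - m))"
      unfolding Qlev sum_distrib_left by (intro sum.cong) auto
  qed
  also have "\<dots> = (\<Sum>m. a m) * (\<Sum>l. b l)" by (rule suminf_Cauchy_product_ennreal)
  also have "(\<Sum>l. b l) = ennreal (exp (c * \<beta>))"
  proof -
    have "(\<lambda>l. (c * \<beta>) ^ l / fact l) sums exp (c * \<beta>)"
      using exp_converges[of "c * \<beta>"] by (simp add: divide_inverse mult.commute)
    then show ?thesis unfolding b_def using c \<beta>(2)
      by (simp add: suminf_ennreal2 sums_iff)
  qed
  also have "(\<Sum>m. a m) = ennreal (1 / c) * (\<integral>\<^sup>+\<eta>. ennreal (real (card \<eta>) * c ^ card \<eta>) * G \<eta> \<partial>lebesgue_poisson)"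
  proof -
    let ?g = "\<lambda>n. ennreal (1 / fact n) * (ennreal (real n * c ^ n) * J n)"
    \<comment> \<open>The shift by one level loses nothing: the term for \<open>n = 0\<close>
      vanishes because of the factor \<open>real n\<close>.\<close>
    have "(\<Sum>n. ?g n) = (\<Sum>n. ?g (n + 1)) + (\<Sum>n<1. ?g n)"
      by (rule suminf_offset) simp
    then have "(\<integral>\<^sup>+\<eta>. ennreal (real (card \<eta>) * c ^ card \<eta>) * G \<eta> \<partial>lebesgue_poisson) = (\<Sum>n. ?g (Suc n))"
      using nn_integral_level_sum[OF G, of "\<lambda>n. ennreal (real n * c ^ n)"] by (simp add: J_def)
    also have "ennreal (1 / c) * \<dots> = (\<Sum>n. ennreal (1 / c) * ?g (Suc n))"
      by (simp add: ennreal_suminf_cmult)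
    also have "\<dots> = (\<Sum>m. a m)"
    proof (rule suminf_cong)
      fix m
      have "1 / c * (1 / fact (Suc m) * (real (Suc m) * c ^ Suc m)) = c ^ m / fact m"
        using c by (simp add: field_simps del: of_nat_Suc)
      then have "ennreal (1 / c) * (ennreal (1 / fact (Suc m)) * ennreal (real (Suc m) * c ^ Suc m)) = ennreal (c ^ m / fact m)"
        using c by (simp add: ennreal_mult[symmetric])
      then show "ennreal (1 / c) * ?g (Suc m) = a m"
        unfolding a_def by (metis mult.assoc)
    qed
    finally show ?thesis by simp
  qed
  finally show ?thesis using c
    by (simp add: mult_ac ennreal_mult divide_inverse)
qed

section \<open>Signed birth kernels: domination and comparison\<close>

definition kernel_op :: "(real^('d::finite) \<Rightarrow> real) \<Rightarrow> (real^'d \<Rightarrow> real) \<Rightarrow> ('d cfg \<Rightarrow> real) \<Rightarrow> 'd cfg \<Rightarrow> real" where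
  "kernel_op a b G \<eta> = (\<Sum>\<xi>\<in>Pow \<eta>. \<integral>y.
      (\<Prod>u\<in>\<xi>. a (y - u)) * (\<Prod>u\<in>\<eta> - \<xi>. b (y - u)) * G (insert y \<xi>) \<partial>lborel)"

lemma L2eps_eq_kernel_op:
  "L2eps z \<phi> \<epsilon> G \<eta> = z * kernel_op (\<lambda>u. exp (- \<epsilon> * \<phi> u)) (\<lambda>u. (exp (- \<epsilon> * \<phi> u) - 1) / \<epsilon>) G \<eta>"
  by (simp add: L2eps_def kernel_op_def)

lemma L2V_eq_kernel_op: "L2V z \<phi> G \<eta> = z * kernel_op (\<lambda>_. 1) (\<lambda>u. - \<phi> u) G \<eta>"
  by (simp add: L2V_def kernel_op_def mult.commute)

lemma measurable_kernel_op:
  fixes G :: "('d::finite) cfg \<Rightarrow> real"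
  assumes G: "G \<in> borel_measurable lebesgue_poisson"
    and a: "a \<in> borel_measurable lborel" and b: "b \<in> borel_measurable lborel"
  shows "kernel_op a b G \<in> borel_measurable lebesgue_poisson"
proof (rule measurable_lebesgue_poissonI)
  fix n
  let ?g = "\<lambda>S (x::nat \<Rightarrow> real^'d) y. (\<Prod>i\<in>S. a (y - x i)) * (\<Prod>i\<in>{..<n} - S. b (y - x i)) * G (insert y (x ` S))"
  show "(\<lambda>x. \<Sum>S\<in>Pow {..<n}. \<integral>y. ?g S x y \<partial>lborel) \<in> borel_measurable (Pn n)"
  proof (intro borel_measurable_sum lborel.borel_measurable_lebesgue_integral)
    fix S assume "S \<in> Pow {..<n}"
    then have S: "S \<subseteq> {..<n}" by simp
    show "(\<lambda>(x, y). ?g S x y) \<in> borel_measurable (Pn n \<Otimes>\<^sub>M lborel)"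
      using measurable_prod_shift_pair[OF S a] measurable_prod_shift_pair[of "{..<n} - S" n b] b
        measurable_compose[OF measurable_insert_image_pair[OF S] G]
      by (auto simp: case_prod_beta' intro!: borel_measurable_times)
  qed
next
  fix n and x :: "nat \<Rightarrow> real^'d" assume x: "inj_on x {..<n}"
  show "kernel_op a b G (cfg_of n x) = (\<Sum>S\<in>Pow {..<n}. \<integral>y.
     (\<Prod>i\<in>S. a (y - x i)) * (\<Prod>i\<in>{..<n} - S. b (y - x i)) * G (insert y (x ` S)) \<partial>lborel)"
    unfolding kernel_op_def cfg_of_def
    by (subst sum_Pow_image[OF x])
       (auto intro!: sum.cong Bochner_Integration.integral_cong simp: prod.reindex inj_on_subset[OF x])
qed simp

text \<open>If \<open>f\<close> is not integrable, its Bochner integral is 0 by convention and the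
  bound is trivial.\<close>

lemma ennreal_abs_integral_le: "ennreal \<bar>\<integral>x. f x \<partial>M\<bar> \<le> (\<integral>\<^sup>+x. ennreal \<bar>f x\<bar> \<partial>M)"
  using integral_norm_bound_ennreal[of M f] not_integrable_integral_eq[of M f]
  by (cases "integrable M f") simp_all

lemma ennreal_abs_sum_le: "finite A \<Longrightarrow> ennreal \<bar>\<Sum>i\<in>A. f i\<bar> \<le> (\<Sum>i\<in>A. ennreal \<bar>f i\<bar>)"
  by (simp add: ennreal_leI sum_abs)

text \<open>The size estimates for both operators need no more than these bounds: the factors on the
  retained subset are at most 1 and those on its complement are controlled by a common
  \<open>w\<close>. The renormalized and the limiting kernel both qualify with
  \<open>w = \<phi>\<close>.\<close>

locale kernel_domination =
  fixes a b w :: "real^('d::finite) \<Rightarrow> real"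
  assumes a_meas: "a \<in> borel_measurable lborel" and b_meas: "b \<in> borel_measurable lborel"
    and a_le: "\<And>u. \<bar>a u\<bar> \<le> 1" and b_le: "\<And>u. \<bar>b u\<bar> \<le> w u"
begin

lemma w_nonneg: "0 \<le> w u"
  using b_le[of u] by linarith

lemma abs_kernel_le: "\<bar>(\<Prod>u\<in>\<xi>. a (y - u)) * (\<Prod>u\<in>\<zeta>. b (y - u)) * g\<bar> \<le> \<bar>g\<bar> * (\<Prod>u\<in>\<zeta>. w (y - u))"
proof -
  have "\<bar>\<Prod>u\<in>\<xi>. a (y - u)\<bar> \<le> 1"
    unfolding abs_prod by (rule prod_le_1) (auto simp: a_le)
  moreover have "\<bar>\<Prod>u\<in>\<zeta>. b (y - u)\<bar> \<le> (\<Prod>u\<in>\<zeta>. w (y - u))"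
    unfolding abs_prod by (rule prod_mono) (auto simp: b_le)
  ultimately have "\<bar>\<Prod>u\<in>\<xi>. a (y - u)\<bar> * \<bar>\<Prod>u\<in>\<zeta>. b (y - u)\<bar> \<le> 1 * (\<Prod>u\<in>\<zeta>. w (y - u))"
    by (intro mult_mono) auto
  then have "(\<bar>\<Prod>u\<in>\<xi>. a (y - u)\<bar> * \<bar>\<Prod>u\<in>\<zeta>. b (y - u)\<bar>) * \<bar>g\<bar> \<le> (\<Prod>u\<in>\<zeta>. w (y - u)) * \<bar>g\<bar>"
    by (intro mult_right_mono) auto
  then show ?thesis by (simp add: abs_mult mult.commute)
qed

lemma nn_abs_kernel_le:
  "(\<integral>\<^sup>+y. ennreal \<bar>(\<Prod>u\<in>\<xi>. a (y - u)) * (\<Prod>u\<in>\<zeta>. b (y - u)) * G (insert y \<xi>)\<bar> \<partial>lborel) \<le>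
    (\<integral>\<^sup>+y. ennreal \<bar>G (insert y \<xi>)\<bar> * (\<Prod>u\<in>\<zeta>. ennreal (w (y - u))) \<partial>lborel)"
  by (intro nn_integral_mono)
     (simp add: prod_ennreal w_nonneg ennreal_mult'[symmetric] ennreal_leI abs_kernel_le)

lemma kernel_op_le:
  assumes "finite \<eta>"
  shows "ennreal \<bar>kernel_op a b G \<eta>\<bar> \<le> majorant_op (\<lambda>u. ennreal (w u)) (\<lambda>\<eta>. ennreal \<bar>G \<eta>\<bar>) \<eta>"
  unfolding kernel_op_def majorant_op_def using assms
  by (intro order_trans[OF ennreal_abs_sum_le] sum_mono order_trans[OF ennreal_abs_integral_le] nn_abs_kernel_le) auto

text \<open>Each summand of the majorant is bounded by the whole sum, so finiteness at
  \<open>\<eta>\<close> makes every integral in \<open>kernel_op\<close> absolutely convergent. This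
  is what permits two such integrals to be subtracted under one integral sign.\<close>

lemma integrable_kernel:
  assumes fin: "finite \<eta>" and G: "G \<in> borel_measurable lebesgue_poisson" and \<xi>: "\<xi> \<in> Pow \<eta>"
    and Q: "majorant_op (\<lambda>u. ennreal (w u)) (\<lambda>\<eta>. ennreal \<bar>G \<eta>\<bar>) \<eta> < \<infinity>"
  shows "integrable lborel (\<lambda>y. (\<Prod>u\<in>\<xi>. a (y - u)) * (\<Prod>u\<in>\<eta> - \<xi>. b (y - u)) * G (insert y \<xi>))"
proof (rule integrableI_bounded)
  have [measurable]: "a \<in> borel_measurable borel" "b \<in> borel_measurable borel"
    using a_meas b_meas by simp_all
  have "finite \<xi>" using fin \<xi> finite_subset by auto
  then have [measurable]: "(\<lambda>y. G (insert y \<xi>)) \<in> borel_measurable lborel"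
    using measurable_compose[OF measurable_insert_const G] by blast
  show "(\<lambda>y. (\<Prod>u\<in>\<xi>. a (y - u)) * (\<Prod>u\<in>\<eta> - \<xi>. b (y - u)) * G (insert y \<xi>)) \<in> borel_measurable lborel"
    by measurable
  have "(\<integral>\<^sup>+y. ennreal \<bar>(\<Prod>u\<in>\<xi>. a (y - u)) * (\<Prod>u\<in>\<eta> - \<xi>. b (y - u)) * G (insert y \<xi>)\<bar> \<partial>lborel) \<le>
     (\<integral>\<^sup>+y. ennreal \<bar>G (insert y \<xi>)\<bar> * (\<Prod>u\<in>\<eta> - \<xi>. ennreal (w (y - u))) \<partial>lborel)"
    by (rule nn_abs_kernel_le)
  also have "\<dots> \<le> majorant_op (\<lambda>u. ennreal (w u)) (\<lambda>\<eta>. ennreal \<bar>G \<eta>\<bar>) \<eta>"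
    unfolding majorant_op_def using fin \<xi>
    by (intro member_le_sum[of \<xi> "Pow \<eta>" "\<lambda>\<xi>. \<integral>\<^sup>+y. ennreal \<bar>G (insert y \<xi>)\<bar> * (\<Prod>u\<in>\<eta> - \<xi>. ennreal (w (y - u))) \<partial>lborel"]) auto
  finally show "(\<integral>\<^sup>+y. ennreal (norm ((\<Prod>u\<in>\<xi>. a (y - u)) * (\<Prod>u\<in>\<eta> - \<xi>. b (y - u)) * G (insert y \<xi>))) \<partial>lborel) < \<infinity>"
    using Q by (simp add: le_less_trans)
qed

end

text \<open>Writing \<open>p * g - p' * h = p' * (g - h) + (p - p') * g\<close> separates the
  difference of the functions from the difference of the kernels. The latter then multiplies
  \<open>G\<close> only, so the final error depends on only one of the two orbits.\<close>

lemma kernel_op_diff_le: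
  fixes a b w a' b' :: "real^('d::finite) \<Rightarrow> real" and G H :: "'d cfg \<Rightarrow> real"
  assumes "kernel_domination a b w" "kernel_domination a' b' w"
    and fin: "finite \<eta>" and G: "G \<in> borel_measurable lebesgue_poisson" and H: "H \<in> borel_measurable lebesgue_poisson"
    and \<delta>: "0 \<le> \<delta>" "\<And>\<xi> y. \<xi> \<subseteq> \<eta> \<Longrightarrow>
      \<bar>(\<Prod>u\<in>\<xi>. a (y - u)) * (\<Prod>u\<in>\<eta> - \<xi>. b (y - u)) - (\<Prod>u\<in>\<xi>. a' (y - u)) * (\<Prod>u\<in>\<eta> - \<xi>. b' (y - u))\<bar>
        \<le> \<delta> * (\<Prod>u\<in>\<eta> - \<xi>. w (y - u))"
    and QG: "majorant_op (\<lambda>u. ennreal (w u)) (\<lambda>\<eta>. ennreal \<bar>G \<eta>\<bar>) \<eta> < \<infinity>"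
    and QH: "majorant_op (\<lambda>u. ennreal (w u)) (\<lambda>\<eta>. ennreal \<bar>H \<eta>\<bar>) \<eta> < \<infinity>"
    and w: "w \<in> borel_measurable lborel"
  shows "ennreal \<bar>kernel_op a b G \<eta> - kernel_op a' b' H \<eta>\<bar> \<le>
    majorant_op (\<lambda>u. ennreal (w u)) (\<lambda>\<eta>. ennreal \<bar>G \<eta> - H \<eta>\<bar>) \<eta> +
    ennreal \<delta> * majorant_op (\<lambda>u. ennreal (w u)) (\<lambda>\<eta>. ennreal \<bar>G \<eta>\<bar>) \<eta>"
proof -
  interpret K: kernel_domination a b w by fact
  interpret K': kernel_domination a' b' w by fact
  have [measurable]: "w \<in> borel_measurable borel" using w by simp
  let ?p = "\<lambda>\<xi> y. (\<Prod>u\<in>\<xi>. a (y - u)) * (\<Prod>u\<in>\<eta> - \<xi>. b (y - u))"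
  let ?p' = "\<lambda>\<xi> y. (\<Prod>u\<in>\<xi>. a' (y - u)) * (\<Prod>u\<in>\<eta> - \<xi>. b' (y - u))"
  let ?W = "\<lambda>\<xi> y. \<Prod>u\<in>\<eta> - \<xi>. ennreal (w (y - u))"
  have term_le: "ennreal \<bar>(\<integral>y. ?p \<xi> y * G (insert y \<xi>) \<partial>lborel) - (\<integral>y. ?p' \<xi> y * H (insert y \<xi>) \<partial>lborel)\<bar> \<le>
      (\<integral>\<^sup>+y. ennreal \<bar>G (insert y \<xi>) - H (insert y \<xi>)\<bar> * ?W \<xi> y \<partial>lborel) +
      ennreal \<delta> * (\<integral>\<^sup>+y. ennreal \<bar>G (insert y \<xi>)\<bar> * ?W \<xi> y \<partial>lborel)" if \<xi>: "\<xi> \<in> Pow \<eta>" for \<xi>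
  proof -
    have "finite \<xi>" using fin \<xi> finite_subset by auto
    then have [measurable]: "(\<lambda>y. G (insert y \<xi>)) \<in> borel_measurable lborel" "(\<lambda>y. H (insert y \<xi>)) \<in> borel_measurable lborel"
      using measurable_compose[OF measurable_insert_const G] measurable_compose[OF measurable_insert_const H] by blast+
    have "ennreal \<bar>(\<integral>y. ?p \<xi> y * G (insert y \<xi>) \<partial>lborel) - (\<integral>y. ?p' \<xi> y * H (insert y \<xi>) \<partial>lborel)\<bar> =
        ennreal \<bar>\<integral>y. ?p \<xi> y * G (insert y \<xi>) - ?p' \<xi> y * H (insert y \<xi>) \<partial>lborel\<bar>"
      using K.integrable_kernel[OF fin G \<xi> QG] K'.integrable_kernel[OF fin H \<xi> QH] by simp
    also have "\<dots> \<le> (\<integral>\<^sup>+y. ennreal \<bar>?p \<xi> y * G (insert y \<xi>) - ?p' \<xi> y * H (insert y \<xi>)\<bar> \<partial>lborel)"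
      by (rule ennreal_abs_integral_le)
    also have "\<dots> \<le> (\<integral>\<^sup>+y. ennreal \<bar>G (insert y \<xi>) - H (insert y \<xi>)\<bar> * ?W \<xi> y +
        ennreal \<delta> * (ennreal \<bar>G (insert y \<xi>)\<bar> * ?W \<xi> y) \<partial>lborel)"
    proof (rule nn_integral_mono)
      fix y
      let ?g = "G (insert y \<xi>)" and ?h = "H (insert y \<xi>)" and ?w = "\<Prod>u\<in>\<eta> - \<xi>. w (y - u)"
      have w0: "0 \<le> ?w" by (intro prod_nonneg) (simp add: K.w_nonneg)
      have "?p \<xi> y * ?g - ?p' \<xi> y * ?h = ?p' \<xi> y * (?g - ?h) + (?p \<xi> y - ?p' \<xi> y) * ?g"
        by (simp add: algebra_simps)
      then have "\<bar>?p \<xi> y * ?g - ?p' \<xi> y * ?h\<bar> \<le> \<bar>?p' \<xi> y * (?g - ?h)\<bar> + \<bar>(?p \<xi> y - ?p' \<xi> y) * ?g\<bar>"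
        by (metis abs_triangle_ineq)
      also have "\<dots> \<le> \<bar>?g - ?h\<bar> * ?w + (\<delta> * ?w) * \<bar>?g\<bar>"
        using \<delta>(2)[of \<xi> y] \<xi> by (intro add_mono K'.abs_kernel_le) (auto simp: abs_mult intro!: mult_right_mono)
      finally have "ennreal \<bar>?p \<xi> y * ?g - ?p' \<xi> y * ?h\<bar> \<le> ennreal (\<bar>?g - ?h\<bar> * ?w + \<delta> * (\<bar>?g\<bar> * ?w))"
        by (intro ennreal_leI) (simp add: mult_ac)
      then show "ennreal \<bar>?p \<xi> y * ?g - ?p' \<xi> y * ?h\<bar> \<le> ennreal \<bar>?g - ?h\<bar> * ?W \<xi> y + ennreal \<delta> * (ennreal \<bar>?g\<bar> * ?W \<xi> y)"
        using w0 \<delta>(1) by (simp add: prod_ennreal K.w_nonneg ennreal_mult)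
    qed
    also have "\<dots> = (\<integral>\<^sup>+y. ennreal \<bar>G (insert y \<xi>) - H (insert y \<xi>)\<bar> * ?W \<xi> y \<partial>lborel) +
      ennreal \<delta> * (\<integral>\<^sup>+y. ennreal \<bar>G (insert y \<xi>)\<bar> * ?W \<xi> y \<partial>lborel)"
      by (simp add: nn_integral_add nn_integral_cmult)
    finally show ?thesis .
  qed
  have "ennreal \<bar>kernel_op a b G \<eta> - kernel_op a' b' H \<eta>\<bar> =
     ennreal \<bar>\<Sum>\<xi>\<in>Pow \<eta>. (\<integral>y. ?p \<xi> y * G (insert y \<xi>) \<partial>lborel) - (\<integral>y. ?p' \<xi> y * H (insert y \<xi>) \<partial>lborel)\<bar>"
    by (simp add: kernel_op_def sum_subtractf)
  also have "\<dots> \<le> (\<Sum>\<xi>\<in>Pow \<eta>. (\<integral>\<^sup>+y. ennreal \<bar>G (insert y \<xi>) - H (insert y \<xi>)\<bar> * ?W \<xi> y \<partial>lborel) +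
      ennreal \<delta> * (\<integral>\<^sup>+y. ennreal \<bar>G (insert y \<xi>)\<bar> * ?W \<xi> y \<partial>lborel))"
    using fin by (intro order_trans[OF ennreal_abs_sum_le] sum_mono term_le) auto
  also have "\<dots> = majorant_op (\<lambda>u. ennreal (w u)) (\<lambda>\<eta>. ennreal \<bar>G \<eta> - H \<eta>\<bar>) \<eta> +
    ennreal \<delta> * majorant_op (\<lambda>u. ennreal (w u)) (\<lambda>\<eta>. ennreal \<bar>G \<eta>\<bar>) \<eta>"
    by (simp add: majorant_op_def sum.distrib sum_distrib_left)
  finally show ?thesis .
qed

lemma one_minus_exp_bounds:
  fixes x :: real
  assumes "0 \<le> x"
  shows "x * exp (- x) \<le> 1 - exp (- x)" "1 - exp (- x) \<le> x"
proof -
  have "(1 + x) * exp (- x) \<le> exp x * exp (- x)"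
    using exp_ge_add_one_self[of x] by (intro mult_right_mono) auto
  then show "x * exp (- x) \<le> 1 - exp (- x)" by (simp add: algebra_simps exp_minus_inverse)
  show "1 - exp (- x) \<le> x" using exp_ge_add_one_self[of "- x"] by simp
qed

text \<open>Up to a common sign, the renormalized product lies between
  \<open>exp (- \<epsilon> * B * real (card S + card T))\<close> times the limiting product and the
  limiting product itself, because each Mayer factor lies between
  \<open>f i * exp (- \<epsilon> * f i)\<close> and \<open>f i\<close>. The inequality
  \<open>1 - exp (- s) \<le> s\<close> finishes the estimate without a telescoping sum.\<close>

lemma mayer_product_bound:
  fixes f :: "'i \<Rightarrow> real"
  assumes "finite S" "finite T" and \<epsilon>: "0 < \<epsilon>" and f: "\<And>i. 0 \<le> f i" "\<And>i. f i \<le> B"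
  shows "\<bar>(\<Prod>i\<in>S. exp (- \<epsilon> * f i)) * (\<Prod>i\<in>T. (exp (- \<epsilon> * f i) - 1) / \<epsilon>) - (\<Prod>i\<in>T. - f i)\<bar>
    \<le> \<epsilon> * B * real (card S + card T) * (\<Prod>i\<in>T. f i)"
proof -
  define r where "r i = (1 - exp (- \<epsilon> * f i)) / \<epsilon>" for i
  have r: "f i * exp (- \<epsilon> * f i) \<le> r i" "r i \<le> f i" for i
    using one_minus_exp_bounds[of "\<epsilon> * f i"] f \<epsilon> by (simp_all add: r_def field_simps)
  have F0: "0 \<le> (\<Prod>i\<in>T. f i)" by (simp add: prod_nonneg f)
  have B: "0 \<le> B" using f[of undefined] by linarith
  let ?E = "\<lambda>A. \<Prod>i\<in>A. exp (- \<epsilon> * f i)"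
  have E: "exp (- \<epsilon> * B * real (card A)) \<le> ?E A" if "finite A" for A
  proof -
    have "(\<Prod>i\<in>A. exp (- \<epsilon> * B)) \<le> ?E A" using f \<epsilon> by (intro prod_mono) auto
    then show ?thesis by (simp add: exp_of_nat2_mult[symmetric])
  qed
  have "(1 - \<epsilon> * B * real (card S + card T)) * (\<Prod>i\<in>T. f i) \<le> exp (- \<epsilon> * B * real (card S + card T)) * (\<Prod>i\<in>T. f i)"
    using exp_ge_add_one_self[of "- \<epsilon> * B * real (card S + card T)"] F0 by (intro mult_right_mono) auto
  also have "\<dots> = exp (- \<epsilon> * B * real (card S)) * exp (- \<epsilon> * B * real (card T)) * (\<Prod>i\<in>T. f i)"
    by (simp add: exp_add[symmetric] algebra_simps)
  also have "\<dots> \<le> ?E S * ?E T * (\<Prod>i\<in>T. f i)"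
    using E[OF assms(1)] E[OF assms(2)] F0 by (intro mult_mono) (auto intro!: prod_nonneg mult_nonneg_nonneg)
  also have "\<dots> = ?E S * (\<Prod>i\<in>T. f i * exp (- \<epsilon> * f i))" by (simp add: prod.distrib mult_ac)
  also have "\<dots> \<le> ?E S * (\<Prod>i\<in>T. r i)"
    using f r by (intro mult_left_mono prod_mono) (auto intro: prod_nonneg)
  finally have lower: "(\<Prod>i\<in>T. f i) - ?E S * (\<Prod>i\<in>T. r i) \<le> \<epsilon> * B * real (card S + card T) * (\<Prod>i\<in>T. f i)"
    by (simp add: algebra_simps)
  have r0: "0 \<le> r i" for i using r(1)[of i] f(1)[of i] by (meson exp_ge_zero mult_nonneg_nonneg order_trans)
  have "?E S \<le> 1" using f \<epsilon> by (intro prod_le_1) auto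
  moreover have "(\<Prod>i\<in>T. r i) \<le> (\<Prod>i\<in>T. f i)" using r r0 by (intro prod_mono) auto
  ultimately have upper: "?E S * (\<Prod>i\<in>T. r i) \<le> (\<Prod>i\<in>T. f i)"
    using mult_mono[of "?E S" 1 "\<Prod>i\<in>T. r i" "\<Prod>i\<in>T. f i"] by (simp add: prod_nonneg r0)
  \<comment> \<open>Both products over \<open>T\<close> carry the same sign
    \<open>(- 1) ^ card T\<close>, which disappears in the absolute value.\<close>
  have "(\<Prod>i\<in>T. (exp (- \<epsilon> * f i) - 1) / \<epsilon>) = (\<Prod>i\<in>T. - r i)"
    by (simp add: r_def minus_divide_left)
  then have "(\<Prod>i\<in>S. exp (- \<epsilon> * f i)) * (\<Prod>i\<in>T. (exp (- \<epsilon> * f i) - 1) / \<epsilon>) - (\<Prod>i\<in>T. - f i) =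
     (- 1) ^ card T * (?E S * (\<Prod>i\<in>T. r i) - (\<Prod>i\<in>T. f i))"
    by (simp add: prod_uminus algebra_simps)
  then show ?thesis using lower upper by (simp add: abs_mult power_abs)
qed

section \<open>Dissipativity and comparison of the generators\<close>

text \<open>The measure lives on all sets of points, but it is carried by the ranges of the maps
  \<open>cfg_of n\<close>, which contain only finite sets. The pointwise kernel bounds require
  finiteness.\<close>

lemma AE_finite_configuration: "AE \<eta> in lebesgue_poisson. finite \<eta>"
proof -
  have "Measurable.pred lebesgue_poisson (finite :: 'd::finite cfg \<Rightarrow> bool)"
    by (rule measurable_lebesgue_poissonI[where g = "\<lambda>_ _. True"]) (auto simp: cfg_of_def)
  then show ?thesis by (subst AE_lebesgue_poisson_iff) (auto simp: cfg_of_def)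
qed

text \<open>Compares \<open>n\<close> equal terms with a geometric sum. This is the price of one
  power of the configuration size when the base of the weight shrinks by the factor
  \<open>q\<close>.\<close>

lemma mult_power_le_inverse_gap:
  fixes q :: real
  assumes "0 \<le> q" "q < 1"
  shows "real n * q ^ n \<le> 1 / (1 - q)"
proof -
  have "real n * q ^ n = (\<Sum>j<n. q ^ n)" by simp
  also have "\<dots> \<le> (\<Sum>j<n. q ^ j)" using assms by (intro sum_mono power_decreasing) auto
  also have "\<dots> = (1 - q ^ n) / (1 - q)" using assms by (simp add: sum_gp_strict)
  also have "\<dots> \<le> 1 / (1 - q)" using assms by (intro divide_right_mono) auto
  finally show ?thesis .
qed

lemma ennreal_add_right_cancel_le:
  fixes x y t :: ennreal
  assumes "x + t \<le> y + t" "t < \<infinity>"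
  shows "x \<le> y"
  using assms ennreal_add_left_cancel_le[of t x y] by (auto simp: add.commute)

locale mean_field_potential =
  fixes \<phi> :: "real^('d::finite) \<Rightarrow> real" and \<beta> B z \<epsilon> :: real
  assumes \<phi>_nonneg: "\<And>u. 0 \<le> \<phi> u" and \<phi>_even: "\<And>u. \<phi> (- u) = \<phi> u"
    and \<phi>_meas: "\<phi> \<in> borel_measurable lborel" and \<phi>_int: "integrable lborel \<phi>"
    and \<beta>_eq: "\<beta> = (\<integral>u. \<phi> u \<partial>lborel)" and \<phi>_le: "\<And>u. \<phi> u \<le> B"
    and z_pos: "0 < z" and \<epsilon>_pos: "0 < \<epsilon>"
begin

abbreviation Q :: "('d cfg \<Rightarrow> real) \<Rightarrow> 'd cfg \<Rightarrow> ennreal" where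
  "Q G \<equiv> majorant_op (\<lambda>u. ennreal (\<phi> u)) (\<lambda>\<eta>. ennreal \<bar>G \<eta>\<bar>)"

lemma ren_domination:
  "kernel_domination (\<lambda>u. exp (- \<epsilon> * \<phi> u)) (\<lambda>u. (exp (- \<epsilon> * \<phi> u) - 1) / \<epsilon>) \<phi>"
proof
  have [measurable]: "\<phi> \<in> borel_measurable borel" using \<phi>_meas by simp
  show "(\<lambda>u. exp (- \<epsilon> * \<phi> u)) \<in> borel_measurable lborel"
    "(\<lambda>u. (exp (- \<epsilon> * \<phi> u) - 1) / \<epsilon>) \<in> borel_measurable lborel" by measurable
  show "\<bar>exp (- \<epsilon> * \<phi> u)\<bar> \<le> 1" for u using \<phi>_nonneg[of u] \<epsilon>_pos by simp
  show "\<bar>(exp (- \<epsilon> * \<phi> u) - 1) / \<epsilon>\<bar> \<le> \<phi> u" for u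
  proof -
    have "exp (- \<epsilon> * \<phi> u) \<le> 1" using \<phi>_nonneg[of u] \<epsilon>_pos by simp
    then show ?thesis
      using one_minus_exp_bounds(2)[of "\<epsilon> * \<phi> u"] \<phi>_nonneg[of u] \<epsilon>_pos
      by (simp add: field_simps)
  qed
qed

lemma V_domination: "kernel_domination (\<lambda>_. 1) (\<lambda>u. - \<phi> u) \<phi>"
  using \<phi>_meas \<phi>_nonneg by unfold_locales auto

lemma B_nonneg: "0 \<le> B"
  using \<phi>_nonneg[of 0] \<phi>_le[of 0] by linarith

lemma \<beta>_nonneg: "0 \<le> \<beta>"
  by (simp add: \<beta>_eq \<phi>_nonneg)

lemma measurable_Q [measurable (raw)]:
  assumes [measurable]: "G \<in> borel_measurable lebesgue_poisson"
  shows "Q G \<in> borel_measurable lebesgue_poisson"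
  by (rule measurable_majorant_op) (use \<phi>_meas in auto)

lemma nn_integral_Q:
  assumes [measurable]: "G \<in> borel_measurable lebesgue_poisson" and "0 < c"
  shows "(\<integral>\<^sup>+\<eta>. ennreal (c ^ card \<eta>) * Q G \<eta> \<partial>lebesgue_poisson) =
    ennreal (exp (c * \<beta>) / c) * (\<integral>\<^sup>+\<eta>. ennreal (real (card \<eta>) * c ^ card \<eta>) * ennreal \<bar>G \<eta>\<bar> \<partial>lebesgue_poisson)"
  using \<phi>_meas \<phi>_nonneg \<phi>_int assms
  by (intro nn_integral_majorant_op)
     (auto simp: \<phi>_even \<beta>_nonneg nn_integral_eq_integral \<beta>_eq)

lemma nn_integral_card_weight_le:
  assumes [measurable]: "G \<in> borel_measurable lebesgue_poisson" and q: "0 < q" "q < 1" and "0 < C"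
  shows "(\<integral>\<^sup>+\<eta>. ennreal (real (card \<eta>) * (q * C) ^ card \<eta>) * ennreal \<bar>G \<eta>\<bar> \<partial>lebesgue_poisson) \<le>
    ennreal (1 / (1 - q)) * (\<integral>\<^sup>+\<eta>. ennreal (C ^ card \<eta>) * ennreal \<bar>G \<eta>\<bar> \<partial>lebesgue_poisson)"
proof -
  have "ennreal (real n * (q * C) ^ n) \<le> ennreal (1 / (1 - q)) * ennreal (C ^ n)" for n
  proof -
    have "real n * q ^ n * C ^ n \<le> 1 / (1 - q) * C ^ n"
      using mult_power_le_inverse_gap[of q n] q assms(4) by (intro mult_right_mono) auto
    then show ?thesis using q assms(4)
      by (simp add: ennreal_mult'[symmetric] power_mult_distrib mult.assoc ennreal_leI)
  qed
  then have "(\<integral>\<^sup>+\<eta>. ennreal (real (card \<eta>) * (q * C) ^ card \<eta>) * ennreal \<bar>G \<eta>\<bar> \<partial>lebesgue_poisson) \<le>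
    (\<integral>\<^sup>+\<eta>. ennreal (1 / (1 - q)) * (ennreal (C ^ card \<eta>) * ennreal \<bar>G \<eta>\<bar>) \<partial>lebesgue_poisson)"
    by (intro nn_integral_mono) (simp add: mult.assoc[symmetric] mult_right_mono)
  then show ?thesis by (simp add: nn_integral_cmult)
qed

text \<open>The activity condition says precisely that the factor
  \<open>z * exp (c * \<beta>) / c\<close> coming from \<open>nn_integral_Q\<close> is at most 1, so
  birth costs no more than death gains.\<close>

lemma nn_integral_z_Q_le:
  assumes G: "G \<in> borel_measurable lebesgue_poisson" and c: "0 < c" and zc: "z * exp (c * \<beta>) \<le> c"
  shows "ennreal z * (\<integral>\<^sup>+\<eta>. ennreal (c ^ card \<eta>) * Q G \<eta> \<partial>lebesgue_poisson) \<le>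
    (\<integral>\<^sup>+\<eta>. ennreal (real (card \<eta>) * c ^ card \<eta>) * ennreal \<bar>G \<eta>\<bar> \<partial>lebesgue_poisson)"
proof -
  have "ennreal z * ennreal (exp (c * \<beta>) / c) \<le> 1"
    using zc c z_pos by (simp add: ennreal_mult'[symmetric] ennreal_leI[of _ 1, simplified] field_simps)
  then show ?thesis
    unfolding nn_integral_Q[OF G c] mult.assoc[symmetric] by (rule order_trans[OF mult_right_mono[of _ 1]]) simp_all
qed

text \<open>For \<open>G\<close> merely in \<open>L_C\<close>, the majorant is shown integrable only
  against the smaller weight \<open>q * C\<close>. Since that weight is positive, this still yields
  finiteness almost everywhere.\<close>

lemma AE_Q_finite:
  fixes q :: real
  assumes G [measurable]: "G \<in> borel_measurable lebesgue_poisson" and q: "0 < q" "q < 1" and C: "0 < C"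
    and fin: "(\<integral>\<^sup>+\<eta>. ennreal (C ^ card \<eta>) * ennreal \<bar>G \<eta>\<bar> \<partial>lebesgue_poisson) < \<infinity>"
  shows "AE \<eta> in lebesgue_poisson. Q G \<eta> < \<infinity>"
proof -
  have "(\<integral>\<^sup>+\<eta>. ennreal ((q * C) ^ card \<eta>) * Q G \<eta> \<partial>lebesgue_poisson) \<le>
    ennreal (exp (q * C * \<beta>) / (q * C)) * (ennreal (1 / (1 - q)) * (\<integral>\<^sup>+\<eta>. ennreal (C ^ card \<eta>) * ennreal \<bar>G \<eta>\<bar> \<partial>lebesgue_poisson))"
    using q C by (subst nn_integral_Q[OF G]) (auto intro!: mult_left_mono nn_integral_card_weight_le)
  also have "\<dots> < \<infinity>" using fin by (simp add: ennreal_mult_less_top)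
  finally have "AE \<eta> in lebesgue_poisson. ennreal ((q * C) ^ card \<eta>) * Q G \<eta> \<noteq> \<infinity>"
    by (intro nn_integral_PInf_AE) auto
  then show ?thesis
  proof eventually_elim
    case (elim \<eta>)
    moreover have "0 < (q * C) ^ card \<eta>" using q C by simp
    ultimately show ?case using q C by (auto simp: ennreal_mult_eq_top_iff less_top)
  qed
qed

text \<open>The kernel error for a subset \<open>\<xi>\<close> involves only
  \<open>card \<xi> + card (\<eta> - \<xi>) = card \<eta>\<close>, so it is uniform in
  \<open>\<xi>\<close> and can be taken out of the sum over subsets.\<close>

lemma L_difference_le:
  assumes fin: "finite \<eta>" and u: "u \<in> borel_measurable lebesgue_poisson" and v: "v \<in> borel_measurable lebesgue_poisson"
    and Qu: "Q u \<eta> < \<infinity>" and Qv: "Q v \<eta> < \<infinity>"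
  shows "ennreal \<bar>L2eps z \<phi> \<epsilon> u \<eta> - L2V z \<phi> v \<eta>\<bar> \<le>
    ennreal z * (Q (\<lambda>\<eta>. u \<eta> - v \<eta>) \<eta> + ennreal (\<epsilon> * B * real (card \<eta>)) * Q u \<eta>)"
proof -
  have "ennreal \<bar>kernel_op (\<lambda>u. exp (- \<epsilon> * \<phi> u)) (\<lambda>u. (exp (- \<epsilon> * \<phi> u) - 1) / \<epsilon>) u \<eta> -
        kernel_op (\<lambda>_. 1) (\<lambda>u. - \<phi> u) v \<eta>\<bar> \<le>
     Q (\<lambda>\<eta>. u \<eta> - v \<eta>) \<eta> + ennreal (\<epsilon> * B * real (card \<eta>)) * Q u \<eta>"
  proof (rule kernel_op_diff_le[OF ren_domination V_domination fin u v _ _ Qu Qv \<phi>_meas])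
    show "0 \<le> \<epsilon> * B * real (card \<eta>)" using B_nonneg \<epsilon>_pos by simp
    fix \<xi> y assume \<xi>: "\<xi> \<subseteq> \<eta>"
    then have "finite \<xi>" "finite (\<eta> - \<xi>)" "card \<xi> + card (\<eta> - \<xi>) = card \<eta>"
      using fin finite_subset[OF \<xi> fin] card_mono[OF fin \<xi>] \<xi> by (auto simp: card_Diff_subset)
    then show "\<bar>(\<Prod>u\<in>\<xi>. exp (- \<epsilon> * \<phi> (y - u))) * (\<Prod>u\<in>\<eta> - \<xi>. (exp (- \<epsilon> * \<phi> (y - u)) - 1) / \<epsilon>) -
        (\<Prod>u\<in>\<xi>. 1) * (\<Prod>u\<in>\<eta> - \<xi>. - \<phi> (y - u))\<bar>
        \<le> \<epsilon> * B * real (card \<eta>) * (\<Prod>u\<in>\<eta> - \<xi>. \<phi> (y - u))"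
      using mayer_product_bound[of \<xi> "\<eta> - \<xi>" \<epsilon> "\<lambda>u. \<phi> (y - u)" B] \<epsilon>_pos \<phi>_nonneg \<phi>_le by simp
  qed
  moreover have "\<bar>L2eps z \<phi> \<epsilon> u \<eta> - L2V z \<phi> v \<eta>\<bar> = z * \<bar>kernel_op (\<lambda>u. exp (- \<epsilon> * \<phi> u)) (\<lambda>u. (exp (- \<epsilon> * \<phi> u) - 1) / \<epsilon>) u \<eta> -
        kernel_op (\<lambda>_. 1) (\<lambda>u. - \<phi> u) v \<eta>\<bar>"
    unfolding L2eps_eq_kernel_op L2V_eq_kernel_op using z_pos
    by (simp add: right_diff_distrib[symmetric] abs_mult)
  ultimately show ?thesis using z_pos by (simp add: ennreal_mult' mult_left_mono)
qed

lemma measurable_L_ren: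
  assumes [measurable]: "G \<in> borel_measurable lebesgue_poisson"
  shows "L_ren z \<phi> \<epsilon> G \<in> borel_measurable lebesgue_poisson"
proof -
  interpret kernel_domination "\<lambda>u. exp (- \<epsilon> * \<phi> u)" "\<lambda>u. (exp (- \<epsilon> * \<phi> u) - 1) / \<epsilon>" \<phi> by (rule ren_domination)
  note [measurable] = measurable_kernel_op[OF assms a_meas b_meas]
  show ?thesis unfolding L_ren_def L1_def L2eps_eq_kernel_op by measurable
qed

lemma measurable_L_V:
  assumes [measurable]: "G \<in> borel_measurable lebesgue_poisson"
  shows "L_V z \<phi> G \<in> borel_measurable lebesgue_poisson"
proof -
  interpret kernel_domination "\<lambda>u. 1" "\<lambda>u. - \<phi> u" \<phi> by (rule V_domination)
  note [measurable] = measurable_kernel_op[OF assms a_meas b_meas]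
  show ?thesis unfolding L_V_def L1_def L2V_eq_kernel_op by measurable
qed

text \<open>Dissipativity of the limiting operator in the weaker norm, perturbed by the difference of the
  two operators.  The birth term is absorbed by the death term, and the powers of the configuration size
  that the difference produces cost one factor of the gap each.\<close>

lemma dissipative_comparison:
  assumes u [measurable]: "u \<in> borel_measurable lebesgue_poisson" and v [measurable]: "v \<in> borel_measurable lebesgue_poisson"
    and q: "0 < q" "q < 1" and C: "0 < C"
    and zq: "z * exp (q * C * \<beta>) \<le> q * C" and zq2: "z * exp (q\<^sup>2 * C * \<beta>) \<le> q\<^sup>2 * C"
    and fu: "(\<integral>\<^sup>+\<eta>. ennreal (C ^ card \<eta>) * ennreal \<bar>u \<eta>\<bar> \<partial>lebesgue_poisson) < \<infinity>"
    and fv: "(\<integral>\<^sup>+\<eta>. ennreal (C ^ card \<eta>) * ennreal \<bar>v \<eta>\<bar> \<partial>lebesgue_poisson) < \<infinity>"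
    and h: "0 \<le> h"
  shows "(\<integral>\<^sup>+\<eta>. ennreal ((q\<^sup>2 * C) ^ card \<eta>) * ennreal \<bar>u \<eta> - v \<eta>\<bar> \<partial>lebesgue_poisson) \<le>
    (\<integral>\<^sup>+\<eta>. ennreal ((q\<^sup>2 * C) ^ card \<eta>) * ennreal \<bar>u \<eta> - v \<eta> - h * (L_ren z \<phi> \<epsilon> u \<eta> - L_V z \<phi> v \<eta>)\<bar> \<partial>lebesgue_poisson) +
    ennreal (h * \<epsilon> * B / (1 - q)\<^sup>2) * (\<integral>\<^sup>+\<eta>. ennreal (C ^ card \<eta>) * ennreal \<bar>u \<eta>\<bar> \<partial>lebesgue_poisson)"
proof -
  let ?c = "q\<^sup>2 * C" and ?M = "lebesgue_poisson :: 'd cfg measure"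
  let ?w = "\<lambda>\<eta>. u \<eta> - v \<eta>"
  let ?X = "\<lambda>\<eta>. u \<eta> - v \<eta> - h * (L_ren z \<phi> \<epsilon> u \<eta> - L_V z \<phi> v \<eta>)"
  let ?D = "\<integral>\<^sup>+\<eta>. ennreal (real (card \<eta>) * ?c ^ card \<eta>) * ennreal \<bar>?w \<eta>\<bar> \<partial>?M"
  let ?R = "\<integral>\<^sup>+\<eta>. ennreal (real (card \<eta>) * ?c ^ card \<eta>) * Q u \<eta> \<partial>?M"
  let ?U = "\<integral>\<^sup>+\<eta>. ennreal (C ^ card \<eta>) * ennreal \<bar>u \<eta>\<bar> \<partial>?M"
  have c: "0 < ?c" and q2: "0 < q\<^sup>2" "q\<^sup>2 < 1" using q C by (auto simp: power_less_one_iff)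
  note [measurable] = measurable_L_ren[OF u] measurable_L_V[OF v]
  have [measurable]: "?w \<in> borel_measurable ?M" by measurable
  have pointwise: "AE \<eta> in ?M. ennreal (?c ^ card \<eta>) * ennreal \<bar>?w \<eta>\<bar> + ennreal h * (ennreal (real (card \<eta>) * ?c ^ card \<eta>) * ennreal \<bar>?w \<eta>\<bar>) \<le>
     ennreal (?c ^ card \<eta>) * ennreal \<bar>?X \<eta>\<bar> + (ennreal h * (ennreal z * (ennreal (?c ^ card \<eta>) * Q ?w \<eta>)) +
     ennreal (h * \<epsilon> * B * z) * (ennreal (real (card \<eta>) * ?c ^ card \<eta>) * Q u \<eta>))"
    using AE_finite_configuration AE_Q_finite[OF u q C fu] AE_Q_finite[OF v q C fv]
  proof eventually_elim
    case (elim \<eta>)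
    let ?n = "card \<eta>"
    let ?Y = "L2eps z \<phi> \<epsilon> u \<eta> - L2V z \<phi> v \<eta>"
    \<comment> \<open>Both operators share the death term \<open>L1\<close>, which acts on the
      difference \<open>?w\<close> as multiplication by \<open>- real ?n\<close>. Moved to the left
      it supplies the gain that later absorbs the birth term.\<close>
    have "(1 + h * real ?n) * ?w \<eta> = ?X \<eta> + h * ?Y"
      by (simp add: L_ren_def L_V_def L1_def algebra_simps)
    then have "\<bar>(1 + h * real ?n) * ?w \<eta>\<bar> \<le> \<bar>?X \<eta>\<bar> + \<bar>h * ?Y\<bar>" by (metis abs_triangle_ineq)
    then have "(1 + h * real ?n) * \<bar>?w \<eta>\<bar> \<le> \<bar>?X \<eta>\<bar> + h * \<bar>?Y\<bar>" using h by (simp add: abs_mult)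
    then have "ennreal ((1 + h * real ?n) * \<bar>?w \<eta>\<bar>) \<le> ennreal (\<bar>?X \<eta>\<bar> + h * \<bar>?Y\<bar>)" by (rule ennreal_leI)
    then have "ennreal \<bar>?w \<eta>\<bar> + ennreal h * (ennreal (real ?n) * ennreal \<bar>?w \<eta>\<bar>) \<le> ennreal \<bar>?X \<eta>\<bar> + ennreal h * ennreal \<bar>?Y\<bar>"
      using h by (simp add: ennreal_mult distrib_right mult.assoc)
    also have "\<dots> \<le> ennreal \<bar>?X \<eta>\<bar> + ennreal h * (ennreal z * (Q ?w \<eta> + ennreal (\<epsilon> * B * real ?n) * Q u \<eta>))"
      using L_difference_le[OF elim(1) u v elim(2,3)] by (intro add_left_mono mult_left_mono) auto
    finally have "ennreal (?c ^ ?n) * (ennreal \<bar>?w \<eta>\<bar> + ennreal h * (ennreal (real ?n) * ennreal \<bar>?w \<eta>\<bar>)) \<le>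
       ennreal (?c ^ ?n) * (ennreal \<bar>?X \<eta>\<bar> + ennreal h * (ennreal z * (Q ?w \<eta> + ennreal (\<epsilon> * B * real ?n) * Q u \<eta>)))"
      by (rule mult_left_mono) simp
    note weighted = this
    have expand: "ennreal (real ?n * ?c ^ ?n) = ennreal (real ?n) * ennreal (?c ^ ?n)"
      "ennreal (h * \<epsilon> * B * z) = ennreal h * ennreal \<epsilon> * ennreal B * ennreal z"
      "ennreal (\<epsilon> * B * real ?n) = ennreal \<epsilon> * ennreal B * ennreal (real ?n)"
      using c h \<epsilon>_pos z_pos B_nonneg by (simp_all add: ennreal_mult)
    show ?case using weighted unfolding expand by (simp only: distrib_left mult_ac)
  qed
  have "(\<integral>\<^sup>+\<eta>. ennreal (?c ^ card \<eta>) * ennreal \<bar>?w \<eta>\<bar> \<partial>?M) + ennreal h * ?D =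
     (\<integral>\<^sup>+\<eta>. ennreal (?c ^ card \<eta>) * ennreal \<bar>?w \<eta>\<bar> + ennreal h * (ennreal (real (card \<eta>) * ?c ^ card \<eta>) * ennreal \<bar>?w \<eta>\<bar>) \<partial>?M)"
    by (simp add: nn_integral_add nn_integral_cmult)
  also have "\<dots> \<le> (\<integral>\<^sup>+\<eta>. ennreal (?c ^ card \<eta>) * ennreal \<bar>?X \<eta>\<bar> + (ennreal h * (ennreal z * (ennreal (?c ^ card \<eta>) * Q ?w \<eta>)) +
     ennreal (h * \<epsilon> * B * z) * (ennreal (real (card \<eta>) * ?c ^ card \<eta>) * Q u \<eta>)) \<partial>?M)"
    by (rule nn_integral_mono_AE[OF pointwise])
  also have "\<dots> = (\<integral>\<^sup>+\<eta>. ennreal (?c ^ card \<eta>) * ennreal \<bar>?X \<eta>\<bar> \<partial>?M) +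
      (ennreal h * (ennreal z * (\<integral>\<^sup>+\<eta>. ennreal (?c ^ card \<eta>) * Q ?w \<eta> \<partial>?M)) + ennreal (h * \<epsilon> * B * z) * ?R)"
    by (simp add: nn_integral_add nn_integral_cmult)
  also have "\<dots> \<le> (\<integral>\<^sup>+\<eta>. ennreal (?c ^ card \<eta>) * ennreal \<bar>?X \<eta>\<bar> \<partial>?M) +
      (ennreal h * ?D + ennreal (h * \<epsilon> * B / (1 - q)\<^sup>2) * ?U)"
  proof (intro add_left_mono add_mono mult_left_mono)
    show "ennreal z * (\<integral>\<^sup>+\<eta>. ennreal (?c ^ card \<eta>) * Q ?w \<eta> \<partial>?M) \<le> ?D"
      by (rule nn_integral_z_Q_le) (use c zq2 in auto)
    \<comment> \<open>The size factor from the kernel comparison is paid by passing from the weight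
      \<open>q\<^sup>2 * C\<close> to \<open>q * C\<close>. The birth bound at \<open>q * C\<close>
      then creates a second size factor, paid by passing on to \<open>C\<close>; together they give
      \<open>(1 - q)\<^sup>2\<close> in the denominator.\<close>
    have "?R \<le> (\<integral>\<^sup>+\<eta>. ennreal (1 / (1 - q)) * (ennreal ((q * C) ^ card \<eta>) * Q u \<eta>) \<partial>?M)"
    proof (rule nn_integral_mono)
      fix \<eta> :: "'d cfg"
      have "real (card \<eta>) * q ^ card \<eta> * (q * C) ^ card \<eta> \<le> 1 / (1 - q) * (q * C) ^ card \<eta>"
        using mult_power_le_inverse_gap[of q "card \<eta>"] q C by (intro mult_right_mono) auto
      moreover have "real (card \<eta>) * ?c ^ card \<eta> = real (card \<eta>) * q ^ card \<eta> * (q * C) ^ card \<eta>"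
        by (simp add: power_mult_distrib power2_eq_square)
      ultimately have "ennreal (real (card \<eta>) * ?c ^ card \<eta>) \<le> ennreal (1 / (1 - q) * (q * C) ^ card \<eta>)"
        by (intro ennreal_leI) (simp only:)
      also have "\<dots> = ennreal (1 / (1 - q)) * ennreal ((q * C) ^ card \<eta>)"
        using q by (intro ennreal_mult') simp
      finally have "ennreal (real (card \<eta>) * ?c ^ card \<eta>) \<le> ennreal (1 / (1 - q)) * ennreal ((q * C) ^ card \<eta>)" .
      then show "ennreal (real (card \<eta>) * ?c ^ card \<eta>) * Q u \<eta> \<le> ennreal (1 / (1 - q)) * (ennreal ((q * C) ^ card \<eta>) * Q u \<eta>)"
        by (simp add: mult.assoc[symmetric] mult_right_mono)
    qed
    also have "\<dots> = ennreal (1 / (1 - q)) * (\<integral>\<^sup>+\<eta>. ennreal ((q * C) ^ card \<eta>) * Q u \<eta> \<partial>?M)"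
      by (simp add: nn_integral_cmult)
    finally have "ennreal z * ?R \<le> ennreal z * (ennreal (1 / (1 - q)) * (\<integral>\<^sup>+\<eta>. ennreal ((q * C) ^ card \<eta>) * Q u \<eta> \<partial>?M))"
      by (rule mult_left_mono) simp
    also have "\<dots> = ennreal (1 / (1 - q)) * (ennreal z * (\<integral>\<^sup>+\<eta>. ennreal ((q * C) ^ card \<eta>) * Q u \<eta> \<partial>?M))"
      by (rule mult.left_commute)
    also have "\<dots> \<le> ennreal (1 / (1 - q)) * (ennreal (1 / (1 - q)) * ?U)"
      using q C zq by (intro mult_left_mono order_trans[OF nn_integral_z_Q_le nn_integral_card_weight_le]) auto
    finally have "ennreal (h * \<epsilon> * B) * (ennreal z * ?R) \<le> ennreal (h * \<epsilon> * B) * (ennreal (1 / (1 - q)) * (ennreal (1 / (1 - q)) * ?U))"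
      by (rule mult_left_mono) simp
    moreover have "ennreal (h * \<epsilon> * B * z) = ennreal (h * \<epsilon> * B) * ennreal z"
      using h \<epsilon>_pos B_nonneg by (intro ennreal_mult') simp
    moreover have "ennreal (h * \<epsilon> * B / (1 - q)\<^sup>2) = ennreal (h * \<epsilon> * B) * (ennreal (1 / (1 - q)) * ennreal (1 / (1 - q)))"
      using q h \<epsilon>_pos B_nonneg by (simp add: ennreal_mult[symmetric] power2_eq_square)
    ultimately show "ennreal (h * \<epsilon> * B * z) * ?R \<le> ennreal (h * \<epsilon> * B / (1 - q)\<^sup>2) * ?U"
      by (simp only: mult.assoc)
  qed auto
  finally have "(\<integral>\<^sup>+\<eta>. ennreal (?c ^ card \<eta>) * ennreal \<bar>?w \<eta>\<bar> \<partial>?M) + ennreal h * ?D \<le>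
     ((\<integral>\<^sup>+\<eta>. ennreal (?c ^ card \<eta>) * ennreal \<bar>?X \<eta>\<bar> \<partial>?M) + ennreal (h * \<epsilon> * B / (1 - q)\<^sup>2) * ?U) + ennreal h * ?D"
    by (simp only: add_ac)
  \<comment> \<open>The death gain occurs on both sides and can be cancelled in
    \<open>ennreal\<close> only because it is finite. The gap between \<open>q\<^sup>2 * C\<close>
    and \<open>C\<close> again pays for its size factor.\<close>
  moreover have "ennreal h * ?D < \<infinity>"
  proof -
    have "(\<integral>\<^sup>+\<eta>. ennreal (C ^ card \<eta>) * ennreal \<bar>?w \<eta>\<bar> \<partial>?M) \<le>
       (\<integral>\<^sup>+\<eta>. ennreal (C ^ card \<eta>) * ennreal \<bar>u \<eta>\<bar> + ennreal (C ^ card \<eta>) * ennreal \<bar>v \<eta>\<bar> \<partial>?M)"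
    proof (rule nn_integral_mono)
      fix \<eta>
      have "ennreal \<bar>?w \<eta>\<bar> \<le> ennreal (\<bar>u \<eta>\<bar> + \<bar>v \<eta>\<bar>)" by (intro ennreal_leI abs_triangle_ineq4)
      then have "ennreal \<bar>?w \<eta>\<bar> \<le> ennreal \<bar>u \<eta>\<bar> + ennreal \<bar>v \<eta>\<bar>" by simp
      then show "ennreal (C ^ card \<eta>) * ennreal \<bar>?w \<eta>\<bar> \<le>
          ennreal (C ^ card \<eta>) * ennreal \<bar>u \<eta>\<bar> + ennreal (C ^ card \<eta>) * ennreal \<bar>v \<eta>\<bar>"
        unfolding distrib_left[symmetric] by (rule mult_left_mono) simp
    qed
    also have "\<dots> < \<infinity>" using fu fv by (simp add: nn_integral_add)
    finally have "ennreal (1 / (1 - q\<^sup>2)) * (\<integral>\<^sup>+\<eta>. ennreal (C ^ card \<eta>) * ennreal \<bar>?w \<eta>\<bar> \<partial>?M) < \<infinity>"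
      by (simp add: ennreal_mult_less_top)
    from le_less_trans[OF nn_integral_card_weight_le[OF _ q2 C] this]
    show ?thesis by (simp add: ennreal_mult_less_top)
  qed
  ultimately show ?thesis by (rule ennreal_add_right_cancel_le)
qed

end

section \<open>Calculus of the weighted norms\<close>

lemma in_L_iff:
  assumes "0 \<le> C"
  shows "in_L C G \<longleftrightarrow> G \<in> borel_measurable lebesgue_poisson \<and>
    (\<integral>\<^sup>+\<eta>. ennreal (C ^ card \<eta>) * ennreal \<bar>G \<eta>\<bar> \<partial>lebesgue_poisson) < \<infinity>"
proof (cases "G \<in> borel_measurable lebesgue_poisson")
  case True
  note [measurable] = True
  have "(\<integral>\<^sup>+\<eta>. ennreal (C ^ card \<eta>) * ennreal \<bar>G \<eta>\<bar> \<partial>lebesgue_poisson) = LP_nn (\<lambda>\<eta>. ennreal (\<bar>G \<eta>\<bar> * C ^ card \<eta>))"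
    using assms by (subst nn_integral_lebesgue_poisson[symmetric]) (auto simp: ennreal_mult mult.commute)
  then show ?thesis using True by (simp add: in_L_def lp_measurable_iff)
qed (simp add: in_L_def lp_measurable_iff)

lemma in_L_measurable: "in_L C G \<Longrightarrow> G \<in> borel_measurable lebesgue_poisson"
  by (simp add: in_L_def lp_measurable_iff)

lemma ennreal_L_norm:
  assumes "0 \<le> C" "in_L C G"
  shows "ennreal (L_norm C G) = (\<integral>\<^sup>+\<eta>. ennreal (C ^ card \<eta>) * ennreal \<bar>G \<eta>\<bar> \<partial>lebesgue_poisson)"
proof -
  note [measurable] = in_L_measurable[OF assms(2)]
  have "(\<integral>\<^sup>+\<eta>. ennreal (C ^ card \<eta>) * ennreal \<bar>G \<eta>\<bar> \<partial>lebesgue_poisson) = LP_nn (\<lambda>\<eta>. ennreal (\<bar>G \<eta>\<bar> * C ^ card \<eta>))"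
    using assms by (subst nn_integral_lebesgue_poisson[symmetric]) (auto simp: ennreal_mult mult.commute)
  then show ?thesis using assms(2) by (simp add: L_norm_def in_L_def less_top[symmetric])
qed

lemma L_norm_nonneg: "0 \<le> L_norm C G"
  by (simp add: L_norm_def)

lemma in_L_cmult [intro]:
  assumes "0 \<le> C" "in_L C f"
  shows "in_L C (\<lambda>\<eta>. a * f \<eta>)"
proof -
  note [measurable] = in_L_measurable[OF assms(2)]
  have "(\<integral>\<^sup>+\<eta>. ennreal (C ^ card \<eta>) * ennreal \<bar>a * f \<eta>\<bar> \<partial>lebesgue_poisson) =
     (\<integral>\<^sup>+\<eta>. ennreal \<bar>a\<bar> * (ennreal (C ^ card \<eta>) * ennreal \<bar>f \<eta>\<bar>) \<partial>lebesgue_poisson)"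
    by (simp add: abs_mult ennreal_mult mult_ac)
  also have "\<dots> = ennreal \<bar>a\<bar> * (\<integral>\<^sup>+\<eta>. ennreal (C ^ card \<eta>) * ennreal \<bar>f \<eta>\<bar> \<partial>lebesgue_poisson)"
    by (simp add: nn_integral_cmult)
  also have "\<dots> < \<infinity>" using assms by (simp add: in_L_iff ennreal_mult_less_top)
  finally show ?thesis using assms by (simp add: in_L_iff)
qed

lemma L_norm_cmult:
  assumes "0 \<le> C" "in_L C f"
  shows "L_norm C (\<lambda>\<eta>. a * f \<eta>) = \<bar>a\<bar> * L_norm C f"
proof -
  note [measurable] = in_L_measurable[OF assms(2)]
  have "ennreal (L_norm C (\<lambda>\<eta>. a * f \<eta>)) = (\<integral>\<^sup>+\<eta>. ennreal \<bar>a\<bar> * (ennreal (C ^ card \<eta>) * ennreal \<bar>f \<eta>\<bar>) \<partial>lebesgue_poisson)"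
    using assms by (subst ennreal_L_norm) (auto simp: abs_mult ennreal_mult mult_ac)
  also have "\<dots> = ennreal (\<bar>a\<bar> * L_norm C f)"
    by (simp add: nn_integral_cmult ennreal_L_norm[OF assms, symmetric] ennreal_mult L_norm_nonneg)
  finally show ?thesis by (simp add: L_norm_nonneg)
qed

text \<open>A triangle inequality for any number of terms that also delivers membership. It lets the
  later telescoping estimates, correction terms included, be carried out in a single step from a
  pointwise bound.\<close>

lemma L_norm_le_sum_list:
  assumes C: "0 \<le> C" and g: "g \<in> borel_measurable lebesgue_poisson"
    and fs: "\<forall>f\<in>set fs. in_L C f" and le: "\<And>\<eta>. \<bar>g \<eta>\<bar> \<le> sum_list (map (\<lambda>f. \<bar>f \<eta>\<bar>) fs)"
  shows "in_L C g" "L_norm C g \<le> sum_list (map (L_norm C) fs)"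
proof -
  have "(\<integral>\<^sup>+\<eta>. ennreal (C ^ card \<eta>) * ennreal (sum_list (map (\<lambda>f. \<bar>f \<eta>\<bar>) fs)) \<partial>lebesgue_poisson) =
      ennreal (sum_list (map (L_norm C) fs)) \<and>
      (\<lambda>\<eta>. sum_list (map (\<lambda>f. \<bar>f \<eta>\<bar>) fs)) \<in> borel_measurable lebesgue_poisson"
    using fs
  proof (induction fs)
    case (Cons f fs)
    then have [measurable]: "f \<in> borel_measurable lebesgue_poisson"
      "(\<lambda>\<eta>. sum_list (map (\<lambda>f. \<bar>f \<eta>\<bar>) fs)) \<in> borel_measurable lebesgue_poisson"
      by (auto dest: in_L_measurable)
    have "0 \<le> sum_list (map (\<lambda>f. \<bar>f \<eta>\<bar>) fs)" for \<eta> by (rule sum_list_nonneg) auto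
    moreover have "0 \<le> sum_list (map (L_norm C) fs)" by (rule sum_list_nonneg) (auto simp: L_norm_nonneg)
    ultimately show ?case using Cons C
      by (simp add: distrib_left nn_integral_add ennreal_L_norm L_norm_nonneg)
  qed simp
  then have *: "(\<integral>\<^sup>+\<eta>. ennreal (C ^ card \<eta>) * ennreal \<bar>g \<eta>\<bar> \<partial>lebesgue_poisson) \<le> ennreal (sum_list (map (L_norm C) fs))"
    using le by (metis (no_types, lifting) nn_integral_mono mult_left_mono ennreal_leI zero_le)
  show L: "in_L C g" using g C le_less_trans[OF *] by (simp add: in_L_iff)
  have "0 \<le> sum_list (map (L_norm C) fs)" by (rule sum_list_nonneg) (auto simp: L_norm_nonneg)
  then show "L_norm C g \<le> sum_list (map (L_norm C) fs)"
    using * by (simp add: ennreal_L_norm[OF C L, symmetric])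
qed

lemma in_L_add [intro]:
  assumes "0 \<le> C" "in_L C f" "in_L C g"
  shows "in_L C (\<lambda>\<eta>. f \<eta> + g \<eta>)"
proof (rule L_norm_le_sum_list(1)[where fs = "[f, g]"])
  show "(\<lambda>\<eta>. f \<eta> + g \<eta>) \<in> borel_measurable lebesgue_poisson"
    using assms by (intro borel_measurable_add in_L_measurable)
qed (use assms in \<open>auto simp: abs_triangle_ineq\<close>)

lemma in_L_diff [intro]:
  assumes "0 \<le> C" "in_L C f" "in_L C g"
  shows "in_L C (\<lambda>\<eta>. f \<eta> - g \<eta>)"
proof (rule L_norm_le_sum_list(1)[where fs = "[f, g]"])
  show "(\<lambda>\<eta>. f \<eta> - g \<eta>) \<in> borel_measurable lebesgue_poisson"
    using assms by (intro borel_measurable_diff in_L_measurable)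
qed (use assms in \<open>auto simp: abs_triangle_ineq4\<close>)

lemma in_L_divide [intro]: "0 \<le> C \<Longrightarrow> in_L C f \<Longrightarrow> in_L C (\<lambda>\<eta>. f \<eta> / h)"
  using in_L_cmult[of C f "1 / h"] by simp

lemma L_norm_divide: "0 \<le> C \<Longrightarrow> in_L C f \<Longrightarrow> L_norm C (\<lambda>\<eta>. f \<eta> / h) = L_norm C f / \<bar>h\<bar>"
  using L_norm_cmult[of C f "1 / h"] by simp

lemma L_norm_minus_commute: "L_norm C (\<lambda>\<eta>. f \<eta> - g \<eta>) = L_norm C (\<lambda>\<eta>. g \<eta> - f \<eta>)"
  by (simp add: L_norm_def abs_minus_commute)

lemma L_norm_weaker:
  assumes c: "0 \<le> c" "c \<le> C" and f: "in_L C f"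
  shows "in_L c f" "L_norm c f \<le> L_norm C f"
proof -
  have *: "(\<integral>\<^sup>+\<eta>. ennreal (c ^ card \<eta>) * ennreal \<bar>f \<eta>\<bar> \<partial>lebesgue_poisson) \<le> (\<integral>\<^sup>+\<eta>. ennreal (C ^ card \<eta>) * ennreal \<bar>f \<eta>\<bar> \<partial>lebesgue_poisson)"
    using c by (intro nn_integral_mono mult_right_mono ennreal_leI power_mono) auto
  show L: "in_L c f" using f c le_less_trans[OF *] in_L_iff[of C f] in_L_iff[of c f] by auto
  show "L_norm c f \<le> L_norm C f"
    using * c f L by (simp add: ennreal_L_norm[symmetric] L_norm_nonneg)
qed

lemma ennreal_le_add_multD:
  assumes "ennreal a \<le> ennreal b + ennreal k * ennreal n" "0 \<le> b" "0 \<le> k" "0 \<le> n"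
  shows "a \<le> b + k * n"
  using assms by (simp add: ennreal_mult[symmetric] ennreal_plus[symmetric] del: ennreal_plus)

context mean_field_potential
begin

text \<open>The weight gap lemma with factor \<open>1/2\<close>: passing from \<open>2 * C\<close>
  to \<open>C\<close> pays for the one power of the size produced by the death term.\<close>

lemma nn_integral_L_finite:
  assumes C: "0 < C" and G: "in_L (2 * C) G"
  shows "(\<integral>\<^sup>+\<eta>. ennreal (real (card \<eta>) * C ^ card \<eta>) * ennreal \<bar>G \<eta>\<bar> \<partial>lebesgue_poisson) < \<infinity>"
proof -
  have "(\<integral>\<^sup>+\<eta>. ennreal (real (card \<eta>) * (1/2 * (2 * C)) ^ card \<eta>) * ennreal \<bar>G \<eta>\<bar> \<partial>lebesgue_poisson) \<le>
    ennreal (1 / (1 - 1/2)) * (\<integral>\<^sup>+\<eta>. ennreal ((2 * C) ^ card \<eta>) * ennreal \<bar>G \<eta>\<bar> \<partial>lebesgue_poisson)"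
    using C in_L_measurable[OF G] by (intro nn_integral_card_weight_le) auto
  also have "\<dots> < \<infinity>" using G C by (simp add: in_L_iff ennreal_mult_less_top)
  finally show ?thesis by simp
qed

text \<open>Birth and death terms are both controlled by the size-weighted integral of
  \<open>G\<close>, which is finite on \<open>L_{2C}\<close>. Hence every element of
  \<open>L_{2C}\<close> has an image in \<open>L_C\<close>, as membership in the core of the
  generator demands.\<close>

lemma in_L_kernel_perturbation:
  assumes C: "0 < C" and G: "in_L (2 * C) G" and "kernel_domination a b \<phi>"
  shows "in_L C (\<lambda>\<eta>. L1 G \<eta> + z * kernel_op a b G \<eta>)"
proof -
  interpret K: kernel_domination a b \<phi> by fact
  note G_meas [measurable] = in_L_measurable[OF G]
  note [measurable] = measurable_kernel_op[OF G_meas K.a_meas K.b_meas]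
  have "AE \<eta> in lebesgue_poisson. ennreal (C ^ card \<eta>) * ennreal \<bar>L1 G \<eta> + z * kernel_op a b G \<eta>\<bar> \<le>
     ennreal (real (card \<eta>) * C ^ card \<eta>) * ennreal \<bar>G \<eta>\<bar> + ennreal z * (ennreal (C ^ card \<eta>) * Q G \<eta>)"
    using AE_finite_configuration
  proof eventually_elim
    case (elim \<eta>)
    have "\<bar>L1 G \<eta> + z * kernel_op a b G \<eta>\<bar> \<le> real (card \<eta>) * \<bar>G \<eta>\<bar> + z * \<bar>kernel_op a b G \<eta>\<bar>"
      using abs_triangle_ineq[of "L1 G \<eta>" "z * kernel_op a b G \<eta>"] z_pos by (simp add: L1_def abs_mult)
    then have "ennreal \<bar>L1 G \<eta> + z * kernel_op a b G \<eta>\<bar> \<le> ennreal (real (card \<eta>) * \<bar>G \<eta>\<bar> + z * \<bar>kernel_op a b G \<eta>\<bar>)"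
      by (rule ennreal_leI)
    also have "\<dots> = ennreal (real (card \<eta>)) * ennreal \<bar>G \<eta>\<bar> + ennreal z * ennreal \<bar>kernel_op a b G \<eta>\<bar>"
      using z_pos by (simp add: ennreal_mult)
    also have "\<dots> \<le> ennreal (real (card \<eta>)) * ennreal \<bar>G \<eta>\<bar> + ennreal z * Q G \<eta>"
      by (intro add_left_mono mult_left_mono K.kernel_op_le elim) auto
    finally have "ennreal (C ^ card \<eta>) * ennreal \<bar>L1 G \<eta> + z * kernel_op a b G \<eta>\<bar> \<le>
        ennreal (C ^ card \<eta>) * (ennreal (real (card \<eta>)) * ennreal \<bar>G \<eta>\<bar> + ennreal z * Q G \<eta>)"
      by (rule mult_left_mono) simp
    also have "\<dots> = ennreal (real (card \<eta>) * C ^ card \<eta>) * ennreal \<bar>G \<eta>\<bar> + ennreal z * (ennreal (C ^ card \<eta>) * Q G \<eta>)"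
      using C by (simp add: ennreal_mult distrib_left mult_ac)
    finally show ?case .
  qed
  from nn_integral_mono_AE[OF this]
  have "(\<integral>\<^sup>+\<eta>. ennreal (C ^ card \<eta>) * ennreal \<bar>L1 G \<eta> + z * kernel_op a b G \<eta>\<bar> \<partial>lebesgue_poisson) \<le>
     (\<integral>\<^sup>+\<eta>. ennreal (real (card \<eta>) * C ^ card \<eta>) * ennreal \<bar>G \<eta>\<bar> \<partial>lebesgue_poisson) +
      ennreal z * (\<integral>\<^sup>+\<eta>. ennreal (C ^ card \<eta>) * Q G \<eta> \<partial>lebesgue_poisson)"
    by (simp add: nn_integral_add nn_integral_cmult)
  also have "\<dots> < \<infinity>"
    using nn_integral_L_finite[OF C G] C
    by (simp add: nn_integral_Q[OF G_meas] ennreal_mult_less_top)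
  finally show ?thesis using C by (simp add: in_L_iff L1_def)
qed

lemma in_L_L_ren: "0 < C \<Longrightarrow> in_L (2 * C) G \<Longrightarrow> in_L C (L_ren z \<phi> \<epsilon> G)"
  using in_L_kernel_perturbation[OF _ _ ren_domination] by (simp add: L_ren_def[abs_def] L2eps_eq_kernel_op)

lemma in_L_L_V: "0 < C \<Longrightarrow> in_L (2 * C) G \<Longrightarrow> in_L C (L_V z \<phi> G)"
  using in_L_kernel_perturbation[OF _ _ V_domination] by (simp add: L_V_def[abs_def] L2V_eq_kernel_op)

lemma L_norm_comparison:
  assumes C: "0 < C" and q: "0 < q" "q < 1"
    and zq: "z * exp (q * C * \<beta>) \<le> q * C" and zq2: "z * exp (q\<^sup>2 * C * \<beta>) \<le> q\<^sup>2 * C"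
    and u: "in_L C u" "in_L C (L_ren z \<phi> \<epsilon> u)" and v: "in_L C v" "in_L C (L_V z \<phi> v)"
    and h: "0 \<le> h"
  shows "L_norm (q\<^sup>2 * C) (\<lambda>\<eta>. u \<eta> - v \<eta>) \<le>
    L_norm (q\<^sup>2 * C) (\<lambda>\<eta>. u \<eta> - v \<eta> - h * (L_ren z \<phi> \<epsilon> u \<eta> - L_V z \<phi> v \<eta>)) +
    h * \<epsilon> * B / (1 - q)\<^sup>2 * L_norm C u"
proof -
  have "q\<^sup>2 * C \<le> 1 * C" using C q by (intro mult_right_mono) (auto simp: power_le_one_iff)
  then have c: "0 \<le> q\<^sup>2 * C" "q\<^sup>2 * C \<le> C" using C by auto
  have w: "in_L C (\<lambda>\<eta>. u \<eta> - v \<eta>)" using u v C by auto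
  have X: "in_L C (\<lambda>\<eta>. u \<eta> - v \<eta> - h * (L_ren z \<phi> \<epsilon> u \<eta> - L_V z \<phi> v \<eta>))"
    using u v C by (intro in_L_diff in_L_cmult) auto
  have K: "0 \<le> h * \<epsilon> * B / (1 - q)\<^sup>2" using h \<epsilon>_pos B_nonneg by simp
  have "ennreal (L_norm (q\<^sup>2 * C) (\<lambda>\<eta>. u \<eta> - v \<eta>)) \<le>
    ennreal (L_norm (q\<^sup>2 * C) (\<lambda>\<eta>. u \<eta> - v \<eta> - h * (L_ren z \<phi> \<epsilon> u \<eta> - L_V z \<phi> v \<eta>))) +
    ennreal (h * \<epsilon> * B / (1 - q)\<^sup>2) * ennreal (L_norm C u)"
    using dissipative_comparison[OF in_L_measurable[OF u(1)] in_L_measurable[OF v(1)] q C zq zq2 _ _ h]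
      u(1) v(1) C
    by (simp add: ennreal_L_norm[OF c(1) L_norm_weaker(1)[OF c w]] ennreal_L_norm[OF c(1) L_norm_weaker(1)[OF c X]]
        ennreal_L_norm[OF less_imp_le[OF C] u(1)] in_L_iff)
  then show ?thesis by (rule ennreal_le_add_multD) (simp_all only: L_norm_nonneg K)
qed

end

section \<open>Comparison of the semigroups\<close>

text \<open>After subtracting a line of slope \<open>K + \<delta>\<close>, consider the earliest
  time whose value is at least the final one. It cannot be positive, since the step hypothesis would
  produce an earlier such time. A single admissible \<open>h\<close> at each time suffices.\<close>

lemma left_growth_bound:
  fixes N :: "real \<Rightarrow> real"
  assumes t: "0 \<le> t" and cont: "continuous_on {0..t} N"
    and step: "\<And>s \<delta>. 0 < s \<Longrightarrow> s \<le> t \<Longrightarrow> 0 < \<delta> \<Longrightarrow> \<exists>h. 0 < h \<and> h \<le> s \<and> N s \<le> N (s - h) + h * (K + \<delta>)"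
  shows "N t \<le> N 0 + K * t"
proof -
  have bound: "N t \<le> N 0 + (K + \<delta>) * t" if \<delta>: "0 < \<delta>" for \<delta>
  proof -
    define g where "g s = N s - (K + \<delta>) * s" for s
    \<comment> \<open>Continuity makes this set closed, so that its infimum belongs to it.\<close>
    define S where "S = {s \<in> {0..t}. g t \<le> g s}"
    have "continuous_on {0..t} g" unfolding g_def by (intro continuous_intros cont)
    then have "closed S" unfolding S_def
      by (intro continuous_on_closed_Collect_le continuous_on_const closed_atLeastAtMost)
    moreover have "t \<in> S" "bdd_below S" using t by (auto simp: S_def intro!: bdd_belowI[of _ 0])
    ultimately have "Inf S \<in> S" by (intro closed_contains_Inf) auto
    then have s: "0 \<le> Inf S" "Inf S \<le> t" "g t \<le> g (Inf S)" by (auto simp: S_def)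
    have "Inf S = 0"
    proof (rule ccontr)
      assume "Inf S \<noteq> 0"
      with s(1) have "0 < Inf S" by simp
      from step[OF this s(2) \<delta>] obtain h where h: "0 < h" "h \<le> Inf S" "N (Inf S) \<le> N (Inf S - h) + h * (K + \<delta>)" by blast
      then have "g (Inf S) \<le> g (Inf S - h)" by (simp add: g_def algebra_simps)
      with s h have "Inf S - h \<in> S" by (auto simp: S_def)
      then have "Inf S \<le> Inf S - h" using \<open>bdd_below S\<close> by (rule cInf_lower)
      with h(1) show False by simp
    qed
    with s(3) show ?thesis by (simp add: g_def)
  qed
  show ?thesis
  proof (rule field_le_epsilon)
    fix e :: real assume e: "0 < e"
    \<comment> \<open>The denominator \<open>t + 1\<close> keeps the excess slope positive and
      finite even for \<open>t = 0\<close>, and its total contribution below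
      \<open>e\<close>.\<close>
    have "N t \<le> N 0 + (K + e / (t + 1)) * t" using e t by (intro bound) auto
    also have "\<dots> = N 0 + K * t + e * (t / (t + 1))" by (simp add: algebra_simps)
    also have "\<dots> \<le> N 0 + K * t + e" using e t by (simp add: field_simps)
    finally show "N t \<le> N 0 + K * t + e" .
  qed
qed

lemma abs_add_diff_le: "x = a + b - c \<Longrightarrow> \<bar>x\<bar> \<le> \<bar>a\<bar> + \<bar>b\<bar> + \<bar>c\<bar>" for a b c x :: real
  by simp

section \<open>Orbits of a contraction semigroup, with functions identified up to norm zero\<close>

locale L_contraction_semigroup =
  fixes C :: real and T :: "real \<Rightarrow> (('d::finite) cfg \<Rightarrow> real) \<Rightarrow> ('d cfg \<Rightarrow> real)"
  assumes C_nonneg: "0 \<le> C" and semigroup: "C0_contraction_semigroup C T"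
begin

lemma in_L_T [intro]: "0 \<le> t \<Longrightarrow> in_L C G \<Longrightarrow> in_L C (T t G)"
  and contraction: "0 \<le> t \<Longrightarrow> in_L C G \<Longrightarrow> L_norm C (T t G) \<le> L_norm C G"
  and T_linear: "0 \<le> t \<Longrightarrow> in_L C G1 \<Longrightarrow> in_L C G2 \<Longrightarrow>
      L_norm C (\<lambda>\<eta>. T t (\<lambda>\<xi>. a * G1 \<xi> + b * G2 \<xi>) \<eta> - (a * T t G1 \<eta> + b * T t G2 \<eta>)) = 0"
  and T_zero: "in_L C G \<Longrightarrow> L_norm C (\<lambda>\<eta>. T 0 G \<eta> - G \<eta>) = 0"
  and T_add: "0 \<le> s \<Longrightarrow> 0 \<le> t \<Longrightarrow> in_L C G \<Longrightarrow> L_norm C (\<lambda>\<eta>. T (s + t) G \<eta> - T s (T t G) \<eta>) = 0"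
  and strongly_continuous: "in_L C G \<Longrightarrow> ((\<lambda>t. L_norm C (\<lambda>\<eta>. T t G \<eta> - G \<eta>)) \<longlongrightarrow> 0) (at_right 0)"
  using semigroup unfolding C0_contraction_semigroup_def by blast+

lemma L_norm_le_sum:
  assumes "in_L C g" "\<forall>f\<in>set fs. in_L C f" "\<And>\<eta>. \<bar>g \<eta>\<bar> \<le> sum_list (map (\<lambda>f. \<bar>f \<eta>\<bar>) fs)"
  shows "L_norm C g \<le> sum_list (map (L_norm C) fs)"
  using L_norm_le_sum_list(2)[OF C_nonneg in_L_measurable] assms by blast

lemmas L_intros = in_L_diff[OF C_nonneg] in_L_add[OF C_nonneg] in_L_cmult[OF C_nonneg] in_L_divide[OF C_nonneg] in_L_T

lemma T_diff:
  assumes t: "0 \<le> t" and G: "in_L C G" "in_L C H"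
  shows "L_norm C (\<lambda>\<eta>. T t G \<eta> - T t H \<eta>) \<le> L_norm C (\<lambda>\<eta>. G \<eta> - H \<eta>)"
proof -
  let ?D = "\<lambda>\<xi>. 1 * G \<xi> + (- 1) * H \<xi>"
  \<comment> \<open>The defect of linearity, a function of norm zero.\<close>
  let ?E = "\<lambda>\<eta>. T t ?D \<eta> - (1 * T t G \<eta> + (- 1) * T t H \<eta>)"
  have D: "in_L C ?D" using G by (intro L_intros)
  have "L_norm C (\<lambda>\<eta>. T t G \<eta> - T t H \<eta>) \<le> sum_list (map (L_norm C) [?E, T t ?D])"
    using G D t by (intro L_norm_le_sum) (auto intro!: L_intros)
  also have "\<dots> \<le> L_norm C ?D" using T_linear[OF t G, of 1 "- 1"] contraction[OF t D] by simp
  finally show ?thesis by simp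
qed

lemma T_quotient:
  assumes t: "0 \<le> t" and G: "in_L C G" "in_L C H" "in_L C F"
  shows "L_norm C (\<lambda>\<eta>. (T t G \<eta> - T t H \<eta>) / h - T t F \<eta>) \<le> L_norm C (\<lambda>\<eta>. (G \<eta> - H \<eta>) / h - F \<eta>)"
proof -
  let ?D = "\<lambda>\<xi>. 1 / h * G \<xi> + (- 1 / h) * H \<xi>"
  let ?E = "\<lambda>\<eta>. T t ?D \<eta> - (1 / h * T t G \<eta> + (- 1 / h) * T t H \<eta>)"
  have D: "in_L C ?D" using G by (intro L_intros)
  have "L_norm C (\<lambda>\<eta>. (T t G \<eta> - T t H \<eta>) / h - T t F \<eta>) \<le> sum_list (map (L_norm C) [?E, \<lambda>\<eta>. T t ?D \<eta> - T t F \<eta>])"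
  proof (rule L_norm_le_sum)
    fix \<eta>
    have "(T t G \<eta> - T t H \<eta>) / h = 1 / h * T t G \<eta> + (- 1 / h) * T t H \<eta>" by (simp add: diff_divide_distrib)
    then show "\<bar>(T t G \<eta> - T t H \<eta>) / h - T t F \<eta>\<bar> \<le> sum_list (map (\<lambda>f. \<bar>f \<eta>\<bar>) [?E, \<lambda>\<eta>. T t ?D \<eta> - T t F \<eta>])"
      by simp
  qed (use G D t in \<open>auto intro!: L_intros\<close>)
  also have "\<dots> \<le> L_norm C (\<lambda>\<eta>. ?D \<eta> - F \<eta>)" using T_linear[OF t G(1,2), of "1 / h" "- 1 / h"] T_diff[OF t D G(3)] by simp
  also have "(\<lambda>\<eta>. ?D \<eta> - F \<eta>) = (\<lambda>\<eta>. (G \<eta> - H \<eta>) / h - F \<eta>)" by (simp add: diff_divide_distrib)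
  finally show ?thesis .
qed

lemma T_shift:
  assumes "0 \<le> s" "0 \<le> h" "in_L C G"
  shows "L_norm C (\<lambda>\<eta>. T (s + h) G \<eta> - T s G \<eta>) \<le> L_norm C (\<lambda>\<eta>. T h G \<eta> - G \<eta>)"
proof -
  have "L_norm C (\<lambda>\<eta>. T (s + h) G \<eta> - T s G \<eta>) \<le>
     sum_list (map (L_norm C) [\<lambda>\<eta>. T (s + h) G \<eta> - T s (T h G) \<eta>, \<lambda>\<eta>. T s (T h G) \<eta> - T s G \<eta>])"
    using assms by (intro L_norm_le_sum) (auto intro!: L_intros)
  also have "\<dots> \<le> L_norm C (\<lambda>\<eta>. T h G \<eta> - G \<eta>)"
    using T_add[OF assms] T_diff[OF assms(1) in_L_T[OF assms(2,3)] assms(3)] by simp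
  finally show ?thesis .
qed

text \<open>Contractivity bounds the displacement between times \<open>r\<close> and
  \<open>s\<close> by the displacement of \<open>G\<close> over the time
  \<open>\<bar>r - s\<bar>\<close>. Continuity from both sides therefore follows from right
  continuity at zero.\<close>

lemma T_shift_tendsto:
  assumes "in_L C G" "0 \<le> s"
  shows "((\<lambda>r. L_norm C (\<lambda>\<eta>. T r G \<eta> - T s G \<eta>)) \<longlongrightarrow> 0) (at s within {0..})"
proof -
  define \<omega> where "\<omega> h = L_norm C (\<lambda>\<eta>. T h G \<eta> - G \<eta>)" for h
  have \<omega>0: "\<omega> 0 = 0" using T_zero[OF assms(1)] by (simp add: \<omega>_def)
  have le: "L_norm C (\<lambda>\<eta>. T r G \<eta> - T s G \<eta>) \<le> \<omega> \<bar>r - s\<bar>" if "0 \<le> r" for r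
  proof (cases "s \<le> r")
    case True
    then show ?thesis using T_shift[OF assms(2), of "r - s" G] assms by (simp add: \<omega>_def)
  next
    case False
    then show ?thesis using T_shift[OF that, of "s - r" G] assms
      by (simp add: \<omega>_def L_norm_minus_commute[of C "T r G"])
  qed
  show ?thesis
  proof (rule tendstoI)
    fix e :: real assume e: "0 < e"
    have "\<forall>\<^sub>F h in at_right 0. dist (\<omega> h) 0 < e" using strongly_continuous[OF assms(1)] e unfolding \<omega>_def by (rule tendstoD)
    then obtain d where d: "0 < d" "\<And>h. 0 < h \<Longrightarrow> h < d \<Longrightarrow> dist (\<omega> h) 0 < e"
      by (auto simp: eventually_at_right_field)
    have "dist (L_norm C (\<lambda>\<eta>. T r G \<eta> - T s G \<eta>)) 0 < e" if "r \<in> {0..}" "dist r s < d" for r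
    proof (cases "r = s")
      case True then show ?thesis using e le[of s] \<omega>0 assms L_norm_nonneg[of C "\<lambda>\<eta>. T s G \<eta> - T s G \<eta>"] by simp
    next
      case False
      with that d(2)[of "\<bar>r - s\<bar>"] have "\<omega> \<bar>r - s\<bar> < e" by (auto simp: dist_real_def)
      with le[of r] that show ?thesis using L_norm_nonneg[of C "\<lambda>\<eta>. T r G \<eta> - T s G \<eta>"] by simp
    qed
    then show "\<forall>\<^sub>F r in at s within {0..}. dist (L_norm C (\<lambda>\<eta>. T r G \<eta> - T s G \<eta>)) 0 < e"
      using d(1) by (auto simp: eventually_at)
  qed
qed

text \<open>The operator \<open>T s\<close> commutes with forming difference quotients and is
  contractive, so the generator maps \<open>T s G\<close> to \<open>T s F\<close>. The terms
  \<open>?A\<close> and \<open>?B\<close> account for \<open>T h (T s G)\<close>,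
  \<open>T (s + h) G\<close> and \<open>T s (T h G)\<close> agreeing only up to norm zero.\<close>

lemma right_derivative:
  assumes G: "in_L C G" "in_L C F" and s: "0 \<le> s"
    and lim: "((\<lambda>h. L_norm C (\<lambda>\<eta>. (T h G \<eta> - G \<eta>) / h - F \<eta>)) \<longlongrightarrow> 0) (at_right 0)"
  shows "((\<lambda>h. L_norm C (\<lambda>\<eta>. (T h (T s G) \<eta> - T s G \<eta>) / h - T s F \<eta>)) \<longlongrightarrow> 0) (at_right 0)"
proof (rule tendsto_sandwich[OF _ _ tendsto_const lim])
  show "\<forall>\<^sub>F h in at_right 0. L_norm C (\<lambda>\<eta>. (T h (T s G) \<eta> - T s G \<eta>) / h - T s F \<eta>) \<le>
      L_norm C (\<lambda>\<eta>. (T h G \<eta> - G \<eta>) / h - F \<eta>)"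
    unfolding eventually_at_right_field
  proof (intro exI[of _ 1] conjI allI impI)
    fix h :: real assume h: "0 < h"
    let ?A = "\<lambda>\<eta>. (T (h + s) G \<eta> - T h (T s G) \<eta>) / h" and ?B = "\<lambda>\<eta>. (T (s + h) G \<eta> - T s (T h G) \<eta>) / h"
      and ?D = "\<lambda>\<eta>. (T s (T h G) \<eta> - T s G \<eta>) / h - T s F \<eta>"
    have L: "in_L C ?A" "in_L C ?B" "in_L C ?D" "in_L C (\<lambda>\<eta>. (T h (T s G) \<eta> - T s G \<eta>) / h - T s F \<eta>)"
      using G s h by (intro L_intros; simp)+
    have "L_norm C (\<lambda>\<eta>. (T h (T s G) \<eta> - T s G \<eta>) / h - T s F \<eta>) \<le> sum_list (map (L_norm C) [?A, ?B, ?D])"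
    proof (rule L_norm_le_sum)
      fix \<eta>
      have eq: "(T h (T s G) \<eta> - T s G \<eta>) / h - T s F \<eta> = ?B \<eta> + ?D \<eta> - ?A \<eta>"
        by (simp add: diff_divide_distrib add.commute)
      show "\<bar>(T h (T s G) \<eta> - T s G \<eta>) / h - T s F \<eta>\<bar> \<le> sum_list (map (\<lambda>f. \<bar>f \<eta>\<bar>) [?A, ?B, ?D])"
        using abs_add_diff_le[OF eq] by simp
    qed (use L in auto)
    also have "\<dots> = L_norm C ?D"
      using T_add[of h s G] T_add[of s h G] G s h
      by (simp add: L_norm_divide[OF C_nonneg] L_intros)
    also have "\<dots> \<le> L_norm C (\<lambda>\<eta>. (T h G \<eta> - G \<eta>) / h - F \<eta>)"
      using G s h by (intro T_quotient L_intros) auto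
    finally show "L_norm C (\<lambda>\<eta>. (T h (T s G) \<eta> - T s G \<eta>) / h - T s F \<eta>) \<le> L_norm C (\<lambda>\<eta>. (T h G \<eta> - G \<eta>) / h - F \<eta>)" .
  qed simp
qed (simp add: L_norm_nonneg)

text \<open>The backward quotient at \<open>s\<close> is \<open>T (s - h)\<close> applied to the
  forward quotient at zero, so it approaches \<open>T (s - h) F\<close> rather than
  \<open>T s F\<close>. Strong continuity on \<open>F\<close> closes this gap.\<close>

lemma left_derivative:
  assumes G: "in_L C G" "in_L C F" and s: "0 < s"
    and lim: "((\<lambda>h. L_norm C (\<lambda>\<eta>. (T h G \<eta> - G \<eta>) / h - F \<eta>)) \<longlongrightarrow> 0) (at_right 0)"
  shows "((\<lambda>h. L_norm C (\<lambda>\<eta>. (T s G \<eta> - T (s - h) G \<eta>) / h - T s F \<eta>)) \<longlongrightarrow> 0) (at_right 0)"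
proof (rule tendsto_sandwich[OF _ _ tendsto_const])
  show "((\<lambda>h. L_norm C (\<lambda>\<eta>. (T h G \<eta> - G \<eta>) / h - F \<eta>) + L_norm C (\<lambda>\<eta>. T h F \<eta> - F \<eta>)) \<longlongrightarrow> 0) (at_right 0)"
    using tendsto_add[OF lim strongly_continuous[OF G(2)]] by simp
  show "\<forall>\<^sub>F h in at_right 0. L_norm C (\<lambda>\<eta>. (T s G \<eta> - T (s - h) G \<eta>) / h - T s F \<eta>) \<le>
      L_norm C (\<lambda>\<eta>. (T h G \<eta> - G \<eta>) / h - F \<eta>) + L_norm C (\<lambda>\<eta>. T h F \<eta> - F \<eta>)"
    unfolding eventually_at_right_field
  proof (intro exI[of _ s] conjI allI impI s)
    fix h :: real assume h: "0 < h" "h < s"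
    let ?r = "s - h"
    let ?A = "\<lambda>\<eta>. (T s G \<eta> - T ?r (T h G) \<eta>) / h" and ?D = "\<lambda>\<eta>. (T ?r (T h G) \<eta> - T ?r G \<eta>) / h - T ?r F \<eta>"
      and ?E = "\<lambda>\<eta>. T s F \<eta> - T ?r F \<eta>"
    have L: "in_L C ?A" "in_L C ?D" "in_L C ?E" "in_L C (\<lambda>\<eta>. (T s G \<eta> - T (s - h) G \<eta>) / h - T s F \<eta>)"
      using G s h by (intro L_intros; simp)+
    have "L_norm C (\<lambda>\<eta>. (T s G \<eta> - T (s - h) G \<eta>) / h - T s F \<eta>) \<le> sum_list (map (L_norm C) [?A, ?D, ?E])"
    proof (rule L_norm_le_sum)
      fix \<eta>
      have eq: "(T s G \<eta> - T (s - h) G \<eta>) / h - T s F \<eta> = ?A \<eta> + ?D \<eta> - ?E \<eta>"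
        by (simp add: diff_divide_distrib)
      show "\<bar>(T s G \<eta> - T (s - h) G \<eta>) / h - T s F \<eta>\<bar> \<le> sum_list (map (\<lambda>f. \<bar>f \<eta>\<bar>) [?A, ?D, ?E])"
        using abs_add_diff_le[OF eq] by simp
    qed (use L in auto)
    also have "\<dots> = L_norm C ?D + L_norm C ?E"
      using T_add[of ?r h G] G s h
      by (simp add: L_norm_divide[OF C_nonneg] L_intros)
    also have "\<dots> \<le> L_norm C (\<lambda>\<eta>. (T h G \<eta> - G \<eta>) / h - F \<eta>) + L_norm C (\<lambda>\<eta>. T h F \<eta> - F \<eta>)"
      using G s h T_shift[of ?r h F] by (intro add_mono T_quotient L_intros) auto
    finally show "L_norm C (\<lambda>\<eta>. (T s G \<eta> - T (s - h) G \<eta>) / h - T s F \<eta>) \<le>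
      L_norm C (\<lambda>\<eta>. (T h G \<eta> - G \<eta>) / h - F \<eta>) + L_norm C (\<lambda>\<eta>. T h F \<eta> - F \<eta>)" .
  qed
qed (simp add: L_norm_nonneg)

text \<open>An element of the core is approximated by the constant sequence, so the closure
  condition holds for it with \<open>F = Op G\<close>.\<close>

lemma generator_core:
  assumes gen: "generator_is_closure C T Op" and G: "in_L (2 * C) G" "in_L C G" "in_L C (Op G)"
  shows "((\<lambda>h. L_norm C (\<lambda>\<eta>. (T h G \<eta> - G \<eta>) / h - Op G \<eta>)) \<longlongrightarrow> 0) (at_right 0)"
proof -
  have "L_norm C (\<lambda>\<eta> :: 'd cfg. 0) = 0" by (simp add: L_norm_def LP_nn_def)
  then have "\<exists>Gs. (\<forall>n. in_L (2 * C) (Gs n) \<and> in_L C (Op (Gs n))) \<and>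
     (\<lambda>n. L_norm C (\<lambda>\<eta>. Gs n \<eta> - G \<eta>)) \<longlonglongrightarrow> 0 \<and> (\<lambda>n. L_norm C (\<lambda>\<eta>. Op (Gs n) \<eta> - Op G \<eta>)) \<longlonglongrightarrow> 0"
    using G by (intro exI[of _ "\<lambda>_. G"]) simp
  then show ?thesis using gen G unfolding generator_is_closure_def by blast
qed

end

context mean_field_potential
begin

text \<open>On the closure, \<open>u'\<close> and \<open>v'\<close> are only limits of the explicit
  operators, which need not make sense on \<open>u\<close> and \<open>v\<close>. Every term of the
  comparison is continuous in the \<open>L_C\<close> norm of the approximations and of their images,
  so the estimate for the approximations passes to the limit.\<close>

lemma closure_comparison:
  assumes C: "0 < C" and q: "0 < q" "q < 1"
    and zq: "z * exp (q * C * \<beta>) \<le> q * C" and zq2: "z * exp (q\<^sup>2 * C * \<beta>) \<le> q\<^sup>2 * C"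
    and L: "in_L C u" "in_L C u'" "in_L C v" "in_L C v'" and h: "0 \<le> h"
    and us: "\<And>n::nat. in_L (2 * C) (us n)" "\<And>n. in_L C (L_ren z \<phi> \<epsilon> (us n))"
      "(\<lambda>n. L_norm C (\<lambda>\<eta>. us n \<eta> - u \<eta>)) \<longlonglongrightarrow> 0" "(\<lambda>n. L_norm C (\<lambda>\<eta>. L_ren z \<phi> \<epsilon> (us n) \<eta> - u' \<eta>)) \<longlonglongrightarrow> 0"
    and vs: "\<And>n::nat. in_L (2 * C) (vs n)" "\<And>n. in_L C (L_V z \<phi> (vs n))"
      "(\<lambda>n. L_norm C (\<lambda>\<eta>. vs n \<eta> - v \<eta>)) \<longlonglongrightarrow> 0" "(\<lambda>n. L_norm C (\<lambda>\<eta>. L_V z \<phi> (vs n) \<eta> - v' \<eta>)) \<longlonglongrightarrow> 0"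
  shows "L_norm (q\<^sup>2 * C) (\<lambda>\<eta>. u \<eta> - v \<eta>) \<le>
    L_norm (q\<^sup>2 * C) (\<lambda>\<eta>. u \<eta> - v \<eta> - h * (u' \<eta> - v' \<eta>)) + h * \<epsilon> * B / (1 - q)\<^sup>2 * L_norm C u"
proof -
  let ?c = "q\<^sup>2 * C" and ?K = "h * \<epsilon> * B / (1 - q)\<^sup>2"
  have "q\<^sup>2 * C \<le> 1 * C" using C q by (intro mult_right_mono) (auto simp: power_le_one_iff)
  then have c: "0 \<le> ?c" "?c \<le> C" using C by auto
  have K: "0 \<le> ?K" using h \<epsilon>_pos B_nonneg by simp
  have C0: "0 \<le> C" using C by simp
  note weak = L_norm_weaker(1)[OF c] and weak_le = L_norm_weaker(2)[OF c]
  note [intro!] = in_L_diff[OF C0] in_L_cmult[OF C0]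
  have us': "in_L C (us n)" and vs': "in_L C (vs n)" for n
    using us(1)[of n] vs(1)[of n] L_norm_weaker(1)[of C "2 * C"] C by auto
  define a where "a n = L_norm C (\<lambda>\<eta>. us n \<eta> - u \<eta>)" for n
  define a' where "a' n = L_norm C (\<lambda>\<eta>. L_ren z \<phi> \<epsilon> (us n) \<eta> - u' \<eta>)" for n
  define b where "b n = L_norm C (\<lambda>\<eta>. vs n \<eta> - v \<eta>)" for n
  define b' where "b' n = L_norm C (\<lambda>\<eta>. L_V z \<phi> (vs n) \<eta> - v' \<eta>)" for n
  \<comment> \<open>The errors \<open>a n\<close> and \<open>b n\<close> each occur twice, once on
    the left of the comparison and once in the residual. The images contribute with the factor
    \<open>h\<close>, and \<open>?K * a n\<close> comes from replacing the norm of
    \<open>us n\<close> by that of \<open>u\<close>.\<close>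
  define e where "e n = 2 * a n + 2 * b n + h * a' n + h * b' n + ?K * a n" for n
  have "e \<longlonglongrightarrow> 2 * 0 + 2 * 0 + h * 0 + h * 0 + ?K * 0"
    unfolding e_def a_def b_def a'_def b'_def by (intro tendsto_intros us vs)
  then have e0: "e \<longlonglongrightarrow> 0" by simp
  let ?X = "L_norm ?c (\<lambda>\<eta>. u \<eta> - v \<eta> - h * (u' \<eta> - v' \<eta>))"
  have bound: "L_norm ?c (\<lambda>\<eta>. u \<eta> - v \<eta>) \<le> ?X + ?K * L_norm C u + e n" for n
  proof -
    let ?du = "\<lambda>\<eta>. us n \<eta> - u \<eta>" and ?dv = "\<lambda>\<eta>. vs n \<eta> - v \<eta>"
    let ?du' = "\<lambda>\<eta>. h * (L_ren z \<phi> \<epsilon> (us n) \<eta> - u' \<eta>)" and ?dv' = "\<lambda>\<eta>. h * (L_V z \<phi> (vs n) \<eta> - v' \<eta>)"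
    have dL: "in_L C ?du" "in_L C ?dv" "in_L C ?du'" "in_L C ?dv'"
      using L us(2) vs(2) us' vs' by auto
    have du': "L_norm C ?du' = h * a' n" and dv': "L_norm C ?dv' = h * b' n"
      using L us(2) vs(2) h by (simp_all add: L_norm_cmult[OF C0] in_L_diff[OF C0] a'_def b'_def)
    have "L_norm ?c (\<lambda>\<eta>. u \<eta> - v \<eta>) \<le> sum_list (map (L_norm ?c) [\<lambda>\<eta>. us n \<eta> - vs n \<eta>, ?du, ?dv])"
      using L us' vs' dL by (intro L_norm_le_sum_list(2)[OF c(1) in_L_measurable[of C]]) (auto intro!: weak)
    also have "\<dots> \<le> L_norm ?c (\<lambda>\<eta>. us n \<eta> - vs n \<eta>) + (a n + b n)"
      using weak_le[OF dL(1)] weak_le[OF dL(2)] by (simp add: a_def b_def)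
    finally have 1: "L_norm ?c (\<lambda>\<eta>. u \<eta> - v \<eta>) \<le> L_norm ?c (\<lambda>\<eta>. us n \<eta> - vs n \<eta>) + (a n + b n)" .
    have 2: "L_norm ?c (\<lambda>\<eta>. us n \<eta> - vs n \<eta>) \<le>
       L_norm ?c (\<lambda>\<eta>. us n \<eta> - vs n \<eta> - h * (L_ren z \<phi> \<epsilon> (us n) \<eta> - L_V z \<phi> (vs n) \<eta>)) + ?K * L_norm C (us n)"
      using us us' vs vs' by (intro L_norm_comparison C q zq zq2 h)
    have "L_norm ?c (\<lambda>\<eta>. us n \<eta> - vs n \<eta> - h * (L_ren z \<phi> \<epsilon> (us n) \<eta> - L_V z \<phi> (vs n) \<eta>)) \<le>
       sum_list (map (L_norm ?c) [\<lambda>\<eta>. u \<eta> - v \<eta> - h * (u' \<eta> - v' \<eta>), ?du, ?dv, ?du', ?dv'])"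
    proof (rule L_norm_le_sum_list(2)[OF c(1) in_L_measurable[of C]])
      fix \<eta>
      have "us n \<eta> - vs n \<eta> - h * (L_ren z \<phi> \<epsilon> (us n) \<eta> - L_V z \<phi> (vs n) \<eta>) =
         (u \<eta> - v \<eta> - h * (u' \<eta> - v' \<eta>)) + ?du \<eta> - ?dv \<eta> - ?du' \<eta> + ?dv' \<eta>" by (simp add: algebra_simps)
      then show "\<bar>us n \<eta> - vs n \<eta> - h * (L_ren z \<phi> \<epsilon> (us n) \<eta> - L_V z \<phi> (vs n) \<eta>)\<bar> \<le>
         sum_list (map (\<lambda>f. \<bar>f \<eta>\<bar>) [\<lambda>\<eta>. u \<eta> - v \<eta> - h * (u' \<eta> - v' \<eta>), ?du, ?dv, ?du', ?dv'])"
        unfolding list.map sum_list.Cons sum_list.Nil by linarith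
    qed (use L us' vs' us(2) vs(2) dL in \<open>auto intro!: weak\<close>)
    also have "\<dots> \<le> ?X + (a n + b n + h * a' n + h * b' n)"
      using weak_le[OF dL(1)] weak_le[OF dL(2)] weak_le[OF dL(3)] weak_le[OF dL(4)]
      by (simp add: du' dv') (simp add: a_def b_def)
    finally have 3: "L_norm ?c (\<lambda>\<eta>. us n \<eta> - vs n \<eta> - h * (L_ren z \<phi> \<epsilon> (us n) \<eta> - L_V z \<phi> (vs n) \<eta>)) \<le>
       ?X + (a n + b n + h * a' n + h * b' n)" .
    have "L_norm C (us n) \<le> L_norm C u + a n"
    proof -
      have "L_norm C (us n) \<le> sum_list (map (L_norm C) [u, ?du])"
        using us' L dL by (intro L_norm_le_sum_list(2)[OF C0 in_L_measurable]) auto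
      then show ?thesis by (simp add: a_def)
    qed
    then have "?K * L_norm C (us n) \<le> ?K * (L_norm C u + a n)" using K by (rule mult_left_mono)
    then have "?K * L_norm C (us n) \<le> ?K * L_norm C u + ?K * a n" by (simp only: distrib_left)
    with 1 2 3 show ?thesis unfolding e_def by linarith
  qed
  have "(\<lambda>n. ?X + ?K * L_norm C u + e n) \<longlonglongrightarrow> ?X + ?K * L_norm C u + 0"
    by (intro tendsto_intros e0)
  then show ?thesis using LIMSEQ_le_const[of _ _ "L_norm ?c (\<lambda>\<eta>. u \<eta> - v \<eta>)"] bound by fastforce
qed

text \<open>At each positive time the implicit estimate is applied to the two orbit values and their
  generator images. Its residual is the orbit difference at time \<open>s - h\<close> plus a term of
  order \<open>o(h)\<close>, which is exactly the step required by
  \<open>left_growth_bound\<close>.\<close>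

lemma semigroup_comparison:
  assumes C: "0 < C" and q: "0 < q" "q < 1"
    and zq: "z * exp (q * C * \<beta>) \<le> q * C" and zq2: "z * exp (q\<^sup>2 * C * \<beta>) \<le> q\<^sup>2 * C"
    and S: "C0_contraction_semigroup C S" "generator_is_closure C S (L_ren z \<phi> \<epsilon>)"
    and T: "C0_contraction_semigroup C T" "generator_is_closure C T (L_V z \<phi>)"
    and G: "in_L (2 * C) G" and t: "0 \<le> t"
  shows "L_norm (q\<^sup>2 * C) (\<lambda>\<eta>. S t G \<eta> - T t G \<eta>) \<le> \<epsilon> * t * (B / (1 - q)\<^sup>2) * L_norm C G"
proof -
  let ?c = "q\<^sup>2 * C"
  interpret S: L_contraction_semigroup C S using C S by unfold_locales auto
  interpret T: L_contraction_semigroup C T using C T by unfold_locales auto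
  have "q\<^sup>2 * C \<le> 1 * C" using C q by (intro mult_right_mono) (auto simp: power_le_one_iff)
  then have c: "0 \<le> ?c" "?c \<le> C" using C by auto
  have C0: "0 \<le> C" using C by simp
  note weak = L_norm_weaker(1)[OF c] and weak_le = L_norm_weaker(2)[OF c]
  have GC: "in_L C G" using L_norm_weaker(1)[of C "2 * C"] C G by simp
  define F where "F = L_ren z \<phi> \<epsilon> G"
  define H where "H = L_V z \<phi> G"
  have FH: "in_L C F" "in_L C H" unfolding F_def H_def by (rule in_L_L_ren[OF C G] in_L_L_V[OF C G])+
  have Sd: "((\<lambda>h. L_norm C (\<lambda>\<eta>. (S h G \<eta> - G \<eta>) / h - F \<eta>)) \<longlongrightarrow> 0) (at_right 0)"
    using S.generator_core[OF S(2) G GC] FH by (simp add: F_def)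
  have Td: "((\<lambda>h. L_norm C (\<lambda>\<eta>. (T h G \<eta> - G \<eta>) / h - H \<eta>)) \<longlongrightarrow> 0) (at_right 0)"
    using T.generator_core[OF T(2) G GC] FH by (simp add: H_def)
  define N where "N s = L_norm ?c (\<lambda>\<eta>. S s G \<eta> - T s G \<eta>)" for s
  define K where "K = \<epsilon> * B / (1 - q)\<^sup>2 * L_norm C G"
  have wL: "in_L C (\<lambda>\<eta>. S s G \<eta> - T s G \<eta>)" if "0 \<le> s" for s
    using that GC by (auto intro!: in_L_diff[OF C0])
  have N_le: "N r - N s \<le> L_norm C (\<lambda>\<eta>. S r G \<eta> - S s G \<eta>) + L_norm C (\<lambda>\<eta>. T r G \<eta> - T s G \<eta>)"
    if "0 \<le> r" "0 \<le> s" for r s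
  proof -
    have d: "in_L C (\<lambda>\<eta>. S r G \<eta> - S s G \<eta>)" "in_L C (\<lambda>\<eta>. T r G \<eta> - T s G \<eta>)"
      using that GC by (auto intro!: in_L_diff[OF C0])
    have "N r \<le> sum_list (map (L_norm ?c) [\<lambda>\<eta>. S s G \<eta> - T s G \<eta>, \<lambda>\<eta>. S r G \<eta> - S s G \<eta>, \<lambda>\<eta>. T r G \<eta> - T s G \<eta>])"
      unfolding N_def using wL that d
      by (intro L_norm_le_sum_list(2)[OF c(1) in_L_measurable[of C]]) (auto intro!: weak)
    then show ?thesis using weak_le[OF d(1)] weak_le[OF d(2)] by (simp add: N_def)
  qed
  have "continuous_on {0..t} N"
    unfolding continuous_on_def
  proof
    fix s assume s: "s \<in> {0..t}"
    let ?m = "\<lambda>r. L_norm C (\<lambda>\<eta>. S r G \<eta> - S s G \<eta>) + L_norm C (\<lambda>\<eta>. T r G \<eta> - T s G \<eta>)"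
    have m: "(?m \<longlongrightarrow> 0) (at s within {0..t})"
    proof -
      have "(?m \<longlongrightarrow> 0 + 0) (at s within {0..})"
        using s by (intro tendsto_add S.T_shift_tendsto T.T_shift_tendsto GC) auto
      then show ?thesis by (simp add: tendsto_within_subset)
    qed
    have "\<bar>N r - N s\<bar> \<le> ?m r" if "r \<in> {0..t}" for r
      using N_le[of r s] N_le[of s r] s that
      by (simp add: L_norm_minus_commute[of C "S s G"] L_norm_minus_commute[of C "T s G"] abs_le_iff)
    then have "((\<lambda>r. N r - N s) \<longlongrightarrow> 0) (at s within {0..t})"
      by (intro Lim_null_comparison[OF _ m]) (auto simp: eventually_at_filter)
    then show "(N \<longlongrightarrow> N s) (at s within {0..t})" by (rule LIM_zero_cancel)
  qed
  then have "N t \<le> N 0 + K * t"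
  proof (rule left_growth_bound[OF t])
    fix s \<delta> :: real assume s: "0 < s" "s \<le> t" and \<delta>: "0 < \<delta>"
    let ?u = "S s G" and ?u' = "S s F" and ?v = "T s G" and ?v' = "T s H"
    have L: "in_L C ?u" "in_L C ?u'" "in_L C ?v" "in_L C ?v'" using s GC FH by auto
    obtain us where us: "\<forall>n. in_L (2 * C) (us n) \<and> in_L C (L_ren z \<phi> \<epsilon> (us n))"
      "(\<lambda>n. L_norm C (\<lambda>\<eta>. us n \<eta> - ?u \<eta>)) \<longlonglongrightarrow> 0" "(\<lambda>n. L_norm C (\<lambda>\<eta>. L_ren z \<phi> \<epsilon> (us n) \<eta> - ?u' \<eta>)) \<longlonglongrightarrow> 0"
      using S(2) S.right_derivative[OF GC FH(1) less_imp_le[OF s(1)] Sd] L unfolding generator_is_closure_def by blast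
    obtain vs where vs: "\<forall>n. in_L (2 * C) (vs n) \<and> in_L C (L_V z \<phi> (vs n))"
      "(\<lambda>n. L_norm C (\<lambda>\<eta>. vs n \<eta> - ?v \<eta>)) \<longlonglongrightarrow> 0" "(\<lambda>n. L_norm C (\<lambda>\<eta>. L_V z \<phi> (vs n) \<eta> - ?v' \<eta>)) \<longlonglongrightarrow> 0"
      using T(2) T.right_derivative[OF GC FH(2) less_imp_le[OF s(1)] Td] L unfolding generator_is_closure_def by blast
    \<comment> \<open>The errors of the two backward quotients, measured in the stronger
      \<open>L_C\<close> norm, in which the derivatives exist.\<close>
    let ?l = "\<lambda>h. L_norm C (\<lambda>\<eta>. (S s G \<eta> - S (s - h) G \<eta>) / h - S s F \<eta>) + L_norm C (\<lambda>\<eta>. (T s G \<eta> - T (s - h) G \<eta>) / h - T s H \<eta>)"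
    have "(?l \<longlongrightarrow> 0 + 0) (at_right 0)"
      by (intro tendsto_add S.left_derivative[OF GC FH(1) s(1) Sd] T.left_derivative[OF GC FH(2) s(1) Td])
    then have "\<forall>\<^sub>F h in at_right 0. ?l h < \<delta>" using \<delta> by (intro order_tendstoD(2)) auto
    then obtain d where d: "0 < d" "\<And>h. 0 < h \<Longrightarrow> h < d \<Longrightarrow> ?l h < \<delta>"
      by (auto simp: eventually_at_right_field)
    \<comment> \<open>Half of \<open>d\<close> makes \<open>h < d\<close> strict, and the cap
      \<open>s\<close> keeps \<open>s - h\<close> nonnegative.\<close>
    define h where "h = min (d / 2) s"
    have h: "0 < h" "h \<le> s" "h < d" using d(1) s by (auto simp: h_def min_def)
    let ?A = "\<lambda>\<eta>. h * ((S s G \<eta> - S (s - h) G \<eta>) / h - S s F \<eta>)" and ?D = "\<lambda>\<eta>. h * ((T s G \<eta> - T (s - h) G \<eta>) / h - T s H \<eta>)"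
    have AD0: "in_L C (\<lambda>\<eta>. (S s G \<eta> - S (s - h) G \<eta>) / h - S s F \<eta>)" "in_L C (\<lambda>\<eta>. (T s G \<eta> - T (s - h) G \<eta>) / h - T s H \<eta>)"
      using h s GC L by (auto intro!: in_L_diff[OF C0] in_L_divide[OF C0])
    have AD: "in_L C ?A" "in_L C ?D" using AD0 by (auto intro!: in_L_cmult[OF C0])
    have XL: "in_L C (\<lambda>\<eta>. ?u \<eta> - ?v \<eta> - h * (?u' \<eta> - ?v' \<eta>))"
      using L by (auto intro!: in_L_diff[OF C0] in_L_cmult[OF C0])
    have "N s \<le> L_norm ?c (\<lambda>\<eta>. ?u \<eta> - ?v \<eta> - h * (?u' \<eta> - ?v' \<eta>)) + h * \<epsilon> * B / (1 - q)\<^sup>2 * L_norm C ?u"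
      unfolding N_def using us vs h
      by (intro closure_comparison[where us = us and vs = vs] C q zq zq2 L) auto
    also have "L_norm ?c (\<lambda>\<eta>. ?u \<eta> - ?v \<eta> - h * (?u' \<eta> - ?v' \<eta>)) \<le>
       sum_list (map (L_norm ?c) [\<lambda>\<eta>. S (s - h) G \<eta> - T (s - h) G \<eta>, ?A, ?D])"
    proof (rule L_norm_le_sum_list(2)[OF c(1) in_L_measurable[OF XL]])
      fix \<eta>
      have "?u \<eta> - ?v \<eta> - h * (?u' \<eta> - ?v' \<eta>) = (S (s - h) G \<eta> - T (s - h) G \<eta>) + ?A \<eta> - ?D \<eta>"
        using h(1) by (simp add: field_simps)
      from abs_add_diff_le[OF this]
      show "\<bar>?u \<eta> - ?v \<eta> - h * (?u' \<eta> - ?v' \<eta>)\<bar> \<le> sum_list (map (\<lambda>f. \<bar>f \<eta>\<bar>) [\<lambda>\<eta>. S (s - h) G \<eta> - T (s - h) G \<eta>, ?A, ?D])"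
        by simp
    qed (use AD wL[of "s - h"] h in \<open>auto intro!: weak\<close>)
    also have "\<dots> \<le> N (s - h) + h * ?l h"
      using weak_le[OF AD(1)] weak_le[OF AD(2)] h(1)
      by (simp only: L_norm_cmult[OF C0 AD0(1)] L_norm_cmult[OF C0 AD0(2)])
         (simp add: N_def distrib_left)
    also have "h * ?l h \<le> h * \<delta>" using d(2)[OF h(1,3)] h(1) by (intro mult_left_mono) auto
    \<comment> \<open>Contractivity in \<open>L_C\<close> turns the error along the orbit into one
      governed by the initial datum, so the growth rate does not depend on \<open>s\<close>.\<close>
    also have "h * \<epsilon> * B / (1 - q)\<^sup>2 * L_norm C ?u \<le> h * K"
    proof -
      have "h * \<epsilon> * B / (1 - q)\<^sup>2 * L_norm C ?u \<le> h * \<epsilon> * B / (1 - q)\<^sup>2 * L_norm C G"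
        using S.contraction[OF less_imp_le[OF s(1)] GC] h \<epsilon>_pos B_nonneg by (intro mult_left_mono) auto
      then show ?thesis by (simp add: K_def mult_ac)
    qed
    finally have "N s \<le> N (s - h) + h * (K + \<delta>)" by (simp add: algebra_simps)
    then show "\<exists>h>0. h \<le> s \<and> N s \<le> N (s - h) + h * (K + \<delta>)" using h by blast
  qed
  \<comment> \<open>At time zero both semigroups are the identity only up to norm zero, so
    \<open>N 0\<close> does not vanish by definition.\<close>
  moreover have "N 0 \<le> 0"
  proof -
    have d: "in_L C (\<lambda>\<eta>. S 0 G \<eta> - G \<eta>)" "in_L C (\<lambda>\<eta>. T 0 G \<eta> - G \<eta>)"
      using GC by (auto intro!: in_L_diff[OF C0])
    have "N 0 \<le> sum_list (map (L_norm ?c) [\<lambda>\<eta>. S 0 G \<eta> - G \<eta>, \<lambda>\<eta>. T 0 G \<eta> - G \<eta>])"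
      unfolding N_def using wL[of 0] d
      by (intro L_norm_le_sum_list(2)[OF c(1) in_L_measurable[of C]]) (auto intro!: weak)
    then show ?thesis using weak_le[OF d(1)] weak_le[OF d(2)] S.T_zero[OF GC] T.T_zero[OF GC] by simp
  qed
  ultimately show ?thesis by (simp add: N_def K_def mult_ac)
qed

end

section \<open>Duality\<close>

lemma K_bound_iff:
  assumes [measurable]: "k \<in> borel_measurable lebesgue_poisson"
  shows "K_bound C k M \<longleftrightarrow> (AE \<eta> in lebesgue_poisson. \<bar>k \<eta>\<bar> \<le> M * C ^ card \<eta>)"
proof -
  have "Measurable.pred lebesgue_poisson (\<lambda>\<eta>. \<bar>k \<eta>\<bar> \<le> M * C ^ card \<eta>)" by measurable
  from AE_lebesgue_poisson_iff[OF this] show ?thesis by (simp add: K_bound_def)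
qed

lemma in_K_nonneg_bound:
  assumes c: "0 \<le> c" and k: "in_K c k"
  shows "\<exists>M\<ge>0. K_bound c k M"
proof -
  have km: "k \<in> borel_measurable lebesgue_poisson" using k by (simp add: in_K_def lp_measurable_iff)
  obtain M where "K_bound c k M" using k by (auto simp: in_K_def)
  then have "AE \<eta> in lebesgue_poisson. \<bar>k \<eta>\<bar> \<le> max 0 M * c ^ card \<eta>"
    unfolding K_bound_iff[OF km]
  proof eventually_elim
    case (elim \<eta>)
    also have "M * c ^ card \<eta> \<le> max 0 M * c ^ card \<eta>" using c by (intro mult_right_mono) auto
    finally show ?case .
  qed
  then show ?thesis by (intro exI[of _ "max 0 M"]) (simp add: K_bound_iff[OF km])
qed

lemma K_norm_nonneg:
  assumes "0 \<le> c" "in_K c k"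
  shows "0 \<le> K_norm c k"
  unfolding K_norm_def using in_K_nonneg_bound[OF assms] by (intro cInf_greatest) auto

lemma in_L_integrable:
  assumes C: "0 \<le> C" and G: "in_L C G"
  shows "integrable lebesgue_poisson (\<lambda>\<eta>. G \<eta> * C ^ card \<eta>)"
    and "(\<integral>\<eta>. \<bar>G \<eta>\<bar> * C ^ card \<eta> \<partial>lebesgue_poisson) = L_norm C G"
proof -
  note [measurable] = in_L_measurable[OF G]
  have "(\<integral>\<^sup>+\<eta>. ennreal (\<bar>G \<eta>\<bar> * C ^ card \<eta>) \<partial>lebesgue_poisson) = ennreal (L_norm C G)"
    using C by (simp add: ennreal_L_norm[OF C G] ennreal_mult mult.commute)
  then show "integrable lebesgue_poisson (\<lambda>\<eta>. G \<eta> * C ^ card \<eta>)"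
    "(\<integral>\<eta>. \<bar>G \<eta>\<bar> * C ^ card \<eta> \<partial>lebesgue_poisson) = L_norm C G"
    using C by (auto simp: integrable_iff_bounded abs_mult integral_eq_nn_integral L_norm_nonneg)
qed

lemma pairing_bound:
  assumes C: "0 \<le> C" and G: "in_L C G" and k: "k \<in> borel_measurable lebesgue_poisson" "K_bound C k M"
  shows "integrable lebesgue_poisson (\<lambda>\<eta>. G \<eta> * k \<eta>)"
    and "pairing G k = (\<integral>\<eta>. G \<eta> * k \<eta> \<partial>lebesgue_poisson)"
    and "\<bar>pairing G k\<bar> \<le> M * L_norm C G"
proof -
  note [measurable] = in_L_measurable[OF G] k(1)
  have le: "AE \<eta> in lebesgue_poisson. norm (G \<eta> * k \<eta>) \<le> M * (\<bar>G \<eta>\<bar> * C ^ card \<eta>)"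
    using k(2)[unfolded K_bound_iff[OF k(1)]]
  proof eventually_elim
    case (elim \<eta>)
    then have "\<bar>G \<eta>\<bar> * \<bar>k \<eta>\<bar> \<le> \<bar>G \<eta>\<bar> * (M * C ^ card \<eta>)" by (intro mult_left_mono) auto
    then show ?case by (simp add: abs_mult mult_ac)
  qed
  have "integrable lebesgue_poisson (\<lambda>\<eta>. \<bar>G \<eta> * C ^ card \<eta>\<bar>)"
    using in_L_integrable(1)[OF C G] by (rule integrable_abs)
  then have i: "integrable lebesgue_poisson (\<lambda>\<eta>. M * (\<bar>G \<eta>\<bar> * C ^ card \<eta>))" using C by (simp add: abs_mult)
  show int: "integrable lebesgue_poisson (\<lambda>\<eta>. G \<eta> * k \<eta>)"
    by (rule Bochner_Integration.integrable_bound[OF i]) (use le in \<open>auto intro: order_trans\<close>)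
  show eq: "pairing G k = (\<integral>\<eta>. G \<eta> * k \<eta> \<partial>lebesgue_poisson)"
    by (simp add: pairing_def integral_lebesgue_poisson[OF int])
  have "norm (\<integral>\<eta>. G \<eta> * k \<eta> \<partial>lebesgue_poisson) \<le> (\<integral>\<eta>. M * (\<bar>G \<eta>\<bar> * C ^ card \<eta>) \<partial>lebesgue_poisson)"
    by (rule order_trans[OF integral_norm_bound integral_mono_AE[OF integrable_norm[OF int] i le]])
  then show "\<bar>pairing G k\<bar> \<le> M * L_norm C G" by (simp add: eq in_L_integrable(2)[OF C G])
qed

text \<open>A Lebesgue--Poisson exponential: the product over the points of a strictly positive
  integrable function \<open>g\<close>. Its norm is \<open>exp (C * I)\<close> with \<open>I\<close>
  the integral of \<open>g\<close>, hence finite for every \<open>C\<close>.\<close>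

lemma exists_positive_in_L:
  assumes C: "0 \<le> C"
  shows "\<exists>\<rho> :: ('d::finite) cfg \<Rightarrow> real. in_L C \<rho> \<and> (\<forall>\<eta>. 0 < \<rho> \<eta>)"
proof -
  obtain g :: "real^'d \<Rightarrow> ennreal" where g: "g \<in> borel_measurable lborel" "integral\<^sup>N lborel g \<noteq> \<infinity>"
    "\<And>x. 0 < g x" "\<And>x. g x < \<infinity>"
    using sigma_finite_measure.Ex_finite_integrable_function[OF sigma_finite_lborel] by (auto simp: space_lborel)
  define \<rho> where "\<rho> \<eta> = (\<Prod>y\<in>\<eta>. enn2real (g y))" for \<eta> :: "'d cfg"
  have [measurable]: "g \<in> borel_measurable borel" using g(1) by simp
  have pos: "0 < enn2real (g x)" for x using g(3,4)[of x] by (simp add: enn2real_positive_iff)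
  have inj: "\<rho> (cfg_of n x) = (\<Prod>i<n. enn2real (g (x i)))" if "inj_on x {..<n}" for n x
    using that by (simp add: \<rho>_def cfg_of_def prod.reindex)
  have \<rho>_meas [measurable]: "\<rho> \<in> borel_measurable lebesgue_poisson"
  proof (rule measurable_lebesgue_poissonI)
    show "(\<lambda>x. \<Prod>i<n. enn2real (g (x i))) \<in> borel_measurable (Pn n)" for n
      by (intro borel_measurable_prod measurable_compose[OF measurable_Pn_component]) auto
  qed (auto simp: inj)
  \<comment> \<open>On infinite sets the product is 1 by convention, so positivity holds on the
    whole space.\<close>
  have \<rho>_pos: "0 < \<rho> \<eta>" for \<eta> unfolding \<rho>_def by (rule prod_pos) (simp add: pos)
  define I where "I = enn2real (integral\<^sup>N lborel g)"
  have I: "integral\<^sup>N lborel g = ennreal I" "0 \<le> I" using g(2) by (auto simp: I_def less_top)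
  interpret product_sigma_finite "\<lambda>_::nat. lborel :: (real^'d) measure"
    by (rule product_sigma_finite_lborel)
  have level: "(\<integral>\<^sup>+x. ennreal \<bar>\<rho> (cfg_of n x)\<bar> \<partial>Pn n) = ennreal (I ^ n)" for n
  proof -
    have "(\<integral>\<^sup>+x. ennreal \<bar>\<rho> (cfg_of n x)\<bar> \<partial>Pn n) = (\<integral>\<^sup>+x. (\<Prod>i<n. g (x i)) \<partial>Pn n)"
    proof (rule nn_integral_cong_AE, rule AE_mp[OF AE_inj_on_Pn], rule AE_I2, rule impI)
      fix x :: "nat \<Rightarrow> real^'d" assume "inj_on x {..<n}"
      then have "\<bar>\<rho> (cfg_of n x)\<bar> = (\<Prod>i<n. enn2real (g (x i)))" by (subst abs_of_pos[OF \<rho>_pos]) (rule inj)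
      then show "ennreal \<bar>\<rho> (cfg_of n x)\<bar> = (\<Prod>i<n. g (x i))" using g(4) by (simp add: prod_ennreal[symmetric])
    qed
    also have "\<dots> = (\<Prod>i<n. integral\<^sup>N lborel g)"
      unfolding Pn_def by (rule product_nn_integral_prod) auto
    finally show ?thesis by (simp add: I ennreal_power)
  qed
  have "(\<integral>\<^sup>+\<eta>. ennreal (C ^ card \<eta>) * ennreal \<bar>\<rho> \<eta>\<bar> \<partial>lebesgue_poisson) = (\<Sum>n. ennreal (1 / fact n) * (ennreal (C ^ n) * ennreal (I ^ n)))"
    by (subst nn_integral_level_sum) (simp_all add: level)
  also have "\<dots> = (\<Sum>n. ennreal ((C * I) ^ n / fact n))"
    using C I by (simp add: ennreal_mult[symmetric] power_mult_distrib)
  also have "\<dots> = ennreal (exp (C * I))"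
    using C I exp_converges[of "C * I"]
    by (subst suminf_ennreal2) (auto simp: divide_inverse mult.commute sums_iff)
  finally show ?thesis using C \<rho>_pos \<rho>_meas by (intro exI[of _ \<rho>]) (simp add: in_L_iff)
qed

text \<open>Test with the sign of \<open>D\<close> on the set where the bound fails, damped by a
  strictly positive weight. The damping puts the test function into \<open>L_{2C}\<close>, where the
  orbit comparison is available, and its positivity forces the bad set to be null.\<close>

lemma K_bound_by_duality:
  assumes C: "0 < C" and D: "in_K C D" and M: "0 \<le> M"
    and le: "\<And>G. in_L (2 * C) G \<Longrightarrow> pairing G D \<le> M * L_norm C G"
  shows "K_bound C D M"
proof -
  have D_meas [measurable]: "D \<in> borel_measurable lebesgue_poisson" using D by (simp add: in_K_def lp_measurable_iff)
  obtain M' where M': "K_bound C D M'" using D by (auto simp: in_K_def)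
  obtain \<rho> :: "'a cfg \<Rightarrow> real" where \<rho>: "in_L (2 * C) \<rho>" "\<And>\<eta>. 0 < \<rho> \<eta>"
    using exists_positive_in_L[of "2 * C"] C by auto
  note [measurable] = in_L_measurable[OF \<rho>(1)]
  define P where "P \<eta> \<longleftrightarrow> M * C ^ card \<eta> < \<bar>D \<eta>\<bar>" for \<eta>
  have [measurable]: "Measurable.pred lebesgue_poisson P" unfolding P_def by measurable
  define G where "G \<eta> = (if P \<eta> then sgn (D \<eta>) * \<rho> \<eta> else 0)" for \<eta>
  have G_meas [measurable]: "G \<in> borel_measurable lebesgue_poisson" unfolding G_def by measurable
  have G2: "in_L (2 * C) G"
    by (rule L_norm_le_sum_list(1)[where fs = "[\<rho>]"]) (use C \<rho> in \<open>auto simp: G_def abs_mult abs_sgn_eq less_imp_le\<close>)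
  have GC: "in_L C G" using L_norm_weaker(1)[of C "2 * C" G] C G2 by simp
  note C0 = less_imp_le[OF C]
  have iD: "integrable lebesgue_poisson (\<lambda>\<eta>. G \<eta> * D \<eta>)" and eqD: "pairing G D = (\<integral>\<eta>. G \<eta> * D \<eta> \<partial>lebesgue_poisson)"
    using pairing_bound[OF C0 GC D_meas M'] by auto
  have iM: "integrable lebesgue_poisson (\<lambda>\<eta>. M * (\<bar>G \<eta>\<bar> * C ^ card \<eta>))"
    using integrable_abs[OF in_L_integrable(1)[OF C0 GC]] C by (simp add: abs_mult)
  \<comment> \<open>The excess of \<open>\<bar>D \<eta>\<bar>\<close> over its bound, weighted by
    \<open>\<rho>\<close>. It is nonnegative and the hypothesis makes its integral
    nonpositive.\<close>
  let ?f = "\<lambda>\<eta>. G \<eta> * D \<eta> - M * (\<bar>G \<eta>\<bar> * C ^ card \<eta>)"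
  have f: "?f \<eta> = (if P \<eta> then (\<bar>D \<eta>\<bar> - M * C ^ card \<eta>) * \<rho> \<eta> else 0)" for \<eta>
  proof (cases "P \<eta>")
    case True
    have "0 \<le> M * C ^ card \<eta>" using M C by simp
    then have "D \<eta> \<noteq> 0" using True unfolding P_def by auto
    then have "\<bar>G \<eta>\<bar> = \<rho> \<eta>" "G \<eta> * D \<eta> = \<bar>D \<eta>\<bar> * \<rho> \<eta>" using True \<rho>(2)[of \<eta>]
      by (auto simp: G_def abs_mult abs_sgn_eq sgn_if)
    then show ?thesis using True by (simp add: algebra_simps)
  qed (simp add: G_def)
  have f0: "0 \<le> ?f \<eta>" for \<eta> unfolding f using \<rho>(2)[of \<eta>] by (auto simp: P_def)
  have "(\<integral>\<eta>. ?f \<eta> \<partial>lebesgue_poisson) = pairing G D - M * L_norm C G"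
    using iD iM by (simp add: eqD in_L_integrable(2)[OF C0 GC])
  then have "(\<integral>\<eta>. ?f \<eta> \<partial>lebesgue_poisson) \<le> 0" using le[OF G2] by simp
  moreover have "0 \<le> (\<integral>\<eta>. ?f \<eta> \<partial>lebesgue_poisson)" using f0 by (intro integral_nonneg_AE) auto
  ultimately have "(\<integral>\<eta>. ?f \<eta> \<partial>lebesgue_poisson) = 0" by simp
  then have "AE \<eta> in lebesgue_poisson. ?f \<eta> = 0"
    using integral_nonneg_eq_0_iff_AE[OF Bochner_Integration.integrable_diff[OF iD iM]] f0 by auto
  then have "AE \<eta> in lebesgue_poisson. \<bar>D \<eta>\<bar> \<le> M * C ^ card \<eta>"
  proof eventually_elim
    case (elim \<eta>)
    then show ?case unfolding f using \<rho>(2)[of \<eta>] by (auto simp: P_def split: if_splits)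
  qed
  then show ?thesis by (simp add: K_bound_iff)
qed

section \<open>The function \<open>x * exp (- x)\<close> and the threshold
  \<open>alpha1\<close>\<close>

lemma mult_exp_minus_less:
  fixes x y :: real
  assumes "x < y" "y \<le> 1"
  shows "x * exp (- x) < y * exp (- y)"
proof (rule DERIV_pos_imp_increasing_open[OF assms(1)])
  fix s assume s: "x < s" "s < y"
  have "((\<lambda>s. s * exp (- s)) has_real_derivative (1 - s) * exp (- s)) (at s)"
    by (auto intro!: derivative_eq_intros simp: algebra_simps)
  then show "\<exists>d. ((\<lambda>s. s * exp (- s)) has_real_derivative d) (at s) \<and> 0 < d" using s assms by force
qed (intro continuous_intros)

lemma mult_exp_minus_greater:
  fixes x y :: real
  assumes "x < y" "1 \<le> x"
  shows "y * exp (- y) < x * exp (- x)"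
proof (rule DERIV_neg_imp_decreasing_open[OF assms(1)])
  fix s assume s: "x < s" "s < y"
  have "((\<lambda>s. s * exp (- s)) has_real_derivative (1 - s) * exp (- s)) (at s)"
    by (auto intro!: derivative_eq_intros simp: algebra_simps)
  then show "\<exists>d. ((\<lambda>s. s * exp (- s)) has_real_derivative d) (at s) \<and> d < 0" using s assms
    by (intro exI[of _ "(1 - s) * exp (- s)"]) (auto simp: mult_less_0_iff)
qed (intro continuous_intros)

text \<open>The intermediate value theorem on \<open>[0, x]\<close> gives a root and strict
  monotonicity up to 1 makes it unique, which justifies the definite description in
  \<open>x1_root\<close>.\<close>

lemma x1_root_eq:
  assumes "0 < z" "0 < \<beta>" "0 < x" "x \<le> 1" "z * \<beta> \<le> x * exp (- x)"
  shows "x1_root z \<beta> * exp (- x1_root z \<beta>) = z * \<beta>"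
proof -
  have "\<exists>r\<ge>0. r \<le> x \<and> r * exp (- r) = z * \<beta>"
    using assms by (intro IVT') (auto intro!: continuous_intros)
  then obtain r where r: "0 \<le> r" "r \<le> x" "r * exp (- r) = z * \<beta>" by blast
  have "r \<noteq> 0" using r(3) assms by auto
  then have P: "0 < r \<and> r \<le> 1 \<and> r * exp (- r) = z * \<beta>" using r assms by auto
  have "s = r" if "0 < s \<and> s \<le> 1 \<and> s * exp (- s) = z * \<beta>" for s
    using that P mult_exp_minus_less[of s r] mult_exp_minus_less[of r s] by (cases s r rule: linorder_cases) auto
  then have "0 < x1_root z \<beta> \<and> x1_root z \<beta> \<le> 1 \<and> x1_root z \<beta> * exp (- x1_root z \<beta>) = z * \<beta>"
    unfolding x1_root_def by (rule theI[where P = "\<lambda>x. 0 < x \<and> x \<le> 1 \<and> x * exp (- x) = z * \<beta>", OF P])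
  then show ?thesis by simp
qed

text \<open>After multiplication by \<open>\<beta>\<close> the claim is
  \<open>z * \<beta> \<le> x * exp (- x)\<close> at \<open>x = \<alpha> * C * \<beta>\<close>. For
  \<open>C * \<beta> > 1\<close> the threshold keeps \<open>x\<close> above 1, on the decreasing
  branch, and the value at \<open>C * \<beta>\<close> is a lower bound. Otherwise \<open>x\<close>
  lies on the increasing branch beyond the root \<open>x1_root z \<beta>\<close>.\<close>

lemma activity_bound:
  fixes C \<beta> z \<alpha> :: real
  assumes C: "1 < C" and \<beta>: "0 < \<beta>" and z: "0 < z" "z \<le> C * exp (- C * \<beta>)"
    and \<alpha>: "alpha1 C z \<beta> < \<alpha>" "\<alpha> < 1"
  shows "z * exp (\<alpha> * C * \<beta>) \<le> \<alpha> * C"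
proof -
  let ?x = "\<alpha> * C * \<beta>"
  have CB: "0 < C * \<beta>" using C \<beta> by simp
  have z\<beta>: "z * \<beta> \<le> C * \<beta> * exp (- (C * \<beta>))" using mult_right_mono[OF z(2), of \<beta>] \<beta> by (simp add: mult_ac)
  have "?x < C * \<beta>" using mult_strict_right_mono[OF \<alpha>(2) CB] by (simp add: mult.assoc)
  have "z * \<beta> \<le> ?x * exp (- ?x)"
  proof (cases "C * \<beta> > 1")
    case True
    then have "1 / (C * \<beta>) < \<alpha>" using \<alpha>(1) by (simp add: alpha1_def)
    then have "1 < ?x" using CB by (simp add: divide_less_eq mult.assoc)
    with mult_exp_minus_greater[OF \<open>?x < C * \<beta>\<close>] z\<beta> show ?thesis by simp
  next
    case False
    then have "x1_root z \<beta> / (C * \<beta>) < \<alpha>" using \<alpha>(1) by (simp add: alpha1_def)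
    then have "x1_root z \<beta> < ?x" using CB by (simp add: divide_less_eq mult.assoc)
    moreover have "?x \<le> 1" using \<open>?x < C * \<beta>\<close> False by simp
    ultimately have "x1_root z \<beta> * exp (- x1_root z \<beta>) < ?x * exp (- ?x)" by (rule mult_exp_minus_less)
    with x1_root_eq[OF z(1) \<beta> CB _ z\<beta>] False show ?thesis by simp
  qed
  then have "z * \<beta> * exp ?x \<le> ?x * exp (- ?x) * exp ?x" by (intro mult_right_mono) auto
  then have "\<beta> * (z * exp ?x) \<le> \<beta> * (\<alpha> * C)" by (simp add: mult_ac exp_minus_inverse mult_exp_exp)
  then show ?thesis using \<beta> by simp
qed

context mean_field_potential
begin

text \<open>The pairing moves the difference of the adjoint images onto the orbits of a test
  function. Because \<open>k\<close> lies in the smaller space with base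
  \<open>q\<^sup>2 * C\<close>, the orbit difference needs to be small only in the weaker norm. The
  bound holds for every admissible \<open>M\<close> for \<open>k\<close>, and the infimum over
  \<open>M\<close> gives the norm.\<close>

lemma K_norm_adjoint_difference:
  assumes C: "0 < C" and q: "0 < q" "q < 1"
    and zq: "z * exp (q * C * \<beta>) \<le> q * C" and zq2: "z * exp (q\<^sup>2 * C * \<beta>) \<le> q\<^sup>2 * C"
    and S: "C0_contraction_semigroup C S" "generator_is_closure C S (L_ren z \<phi> \<epsilon>)"
    and T: "C0_contraction_semigroup C T" "generator_is_closure C T (L_V z \<phi>)"
    and k: "in_K (q\<^sup>2 * C) k" and t: "0 \<le> t"
    and k1: "is_adjoint_image C S t k k1" and k2: "is_adjoint_image C T t k k2"
  shows "K_norm C (\<lambda>\<eta>. k1 \<eta> - k2 \<eta>) \<le> \<epsilon> * t * (B / (1 - q)\<^sup>2) * K_norm (q\<^sup>2 * C) k"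
proof -
  let ?c = "q\<^sup>2 * C" and ?D = "\<lambda>\<eta>. k1 \<eta> - k2 \<eta>" and ?e = "\<epsilon> * t * (B / (1 - q)\<^sup>2)"
  interpret S: L_contraction_semigroup C S using C S by unfold_locales auto
  interpret T: L_contraction_semigroup C T using C T by unfold_locales auto
  have "q\<^sup>2 * C \<le> 1 * C" using C q by (intro mult_right_mono) (auto simp: power_le_one_iff)
  then have c: "0 \<le> ?c" "?c \<le> C" "0 < ?c" using C q by auto
  note C0 = less_imp_le[OF C]
  note weak = L_norm_weaker(1)[OF c(1,2)]
  have e0: "0 \<le> ?e" using \<epsilon>_pos t B_nonneg by simp
  have km: "k \<in> borel_measurable lebesgue_poisson" and
    k1m: "k1 \<in> borel_measurable lebesgue_poisson" and k2m: "k2 \<in> borel_measurable lebesgue_poisson"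
    using k k1 k2 by (auto simp: in_K_def is_adjoint_image_def lp_measurable_iff)
  note [measurable] = k1m k2m
  obtain M1 M2 where M12: "K_bound C k1 M1" "K_bound C k2 M2"
    using k1 k2 by (auto simp: in_K_def is_adjoint_image_def)
  \<comment> \<open>This crude bound only secures that pairings with the difference converge; its
    size does not enter the estimate.\<close>
  have "AE \<eta> in lebesgue_poisson. \<bar>?D \<eta>\<bar> \<le> (M1 + M2) * C ^ card \<eta>"
    using M12(1)[unfolded K_bound_iff[OF k1m]] M12(2)[unfolded K_bound_iff[OF k2m]]
    by eventually_elim (simp add: distrib_right)
  then have DK: "K_bound C ?D (M1 + M2)" "in_K C ?D"
    by (auto simp: K_bound_iff in_K_def lp_measurable_iff)
  have main: "K_norm C ?D \<le> ?e * M" if M: "0 \<le> M" "K_bound ?c k M" for M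
  proof -
    have "K_bound C ?D (?e * M)"
    proof (rule K_bound_by_duality[OF C DK(2)])
      fix G :: "'d cfg \<Rightarrow> real" assume G: "in_L (2 * C) G"
      have GC: "in_L C G" using L_norm_weaker(1)[of C "2 * C"] C G by simp
      have L: "in_L C (S t G)" "in_L C (T t G)" using GC t by auto
      then have Ld: "in_L ?c (\<lambda>\<eta>. S t G \<eta> - T t G \<eta>)" by (intro weak in_L_diff[OF C0])
      note p1 = pairing_bound[OF C0 GC k1m M12(1)] and p2 = pairing_bound[OF C0 GC k2m M12(2)]
        and pD = pairing_bound[OF C0 GC _ DK(1)]
        and pS = pairing_bound[OF c(1) weak[OF L(1)] km M(2)] and pT = pairing_bound[OF c(1) weak[OF L(2)] km M(2)]
        and pd = pairing_bound[OF c(1) Ld km M(2)]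
      have "pairing G ?D = pairing G k1 - pairing G k2"
        using p1(1) p2(1) pD(1) by (simp add: p1(2) p2(2) pD(2) right_diff_distrib)
      also have "\<dots> = pairing (S t G) k - pairing (T t G) k"
        using k1 k2 GC by (simp add: is_adjoint_image_def)
      also have "\<dots> = pairing (\<lambda>\<eta>. S t G \<eta> - T t G \<eta>) k"
        using pS(1) pT(1) by (simp add: pS(2) pT(2) pd(2) left_diff_distrib)
      also have "\<dots> \<le> M * L_norm ?c (\<lambda>\<eta>. S t G \<eta> - T t G \<eta>)" using pd(3) by simp
      also have "\<dots> \<le> M * (?e * L_norm C G)"
        using semigroup_comparison[OF C q zq zq2 S T G t] M(1) by (rule mult_left_mono)
      finally show "pairing G ?D \<le> ?e * M * L_norm C G" by (simp add: mult_ac)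
    qed (rule mult_nonneg_nonneg[OF e0 M(1)])
    moreover have "0 \<le> ?e * M" by (rule mult_nonneg_nonneg[OF e0 M(1)])
    ultimately show ?thesis unfolding K_norm_def by (intro cInf_lower) (auto intro!: bdd_belowI[of _ 0])
  qed
  obtain M0 where M0: "0 \<le> M0" "K_bound ?c k M0" using in_K_nonneg_bound[OF c(1) k] by blast
  show ?thesis
  \<comment> \<open>Passing to the infimum divides by \<open>?e\<close>, so the case
    \<open>?e = 0\<close>, for instance \<open>t = 0\<close>, is treated apart.\<close>
  proof (cases "?e = 0")
    case True
    then show ?thesis using main[OF M0] by (simp only: mult_zero_left)
  next
    case False
    then have e: "0 < ?e" using e0 by linarith
    have "K_norm C ?D / ?e \<le> K_norm ?c k"
      unfolding K_norm_def[of ?c k]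
    proof (rule cInf_greatest)
      show "{M. 0 \<le> M \<and> K_bound ?c k M} \<noteq> {}" using M0 by blast
      fix M assume "M \<in> {M. 0 \<le> M \<and> K_bound ?c k M}"
      then have "K_norm C ?D \<le> ?e * M" by (intro main) auto
      then show "K_norm C ?D / ?e \<le> M" by (simp only: pos_divide_le_eq[OF e] mult.commute)
    qed
    then show ?thesis using e by (simp only: pos_divide_le_eq mult.commute)
  qed
qed

end

theorem mainTheorem10:
  fixes C \<alpha> \<phi>bar :: real
  assumes "C > 1"
  shows "\<exists>A>0. \<forall>(\<phi> :: real^'d \<Rightarrow> real) \<beta> z.
     ((\<forall>x. 0 \<le> \<phi> x) \<and> (\<forall>x. \<phi> (- x) = \<phi> x) \<and> \<phi> \<in> borel_measurable lborel \<and>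
      integrable lborel \<phi> \<and> \<beta> = (\<integral>x. \<phi> x \<partial>lborel) \<and> 0 < \<beta> \<and>
      0 < z \<and> z \<le> min (C * exp (- C * \<beta>)) (2 * C * exp (- 2 * C * \<beta>)) \<and>
      (C * \<beta> = ln 2 \<longrightarrow> z < C / 2) \<and>
      bdd_above (range \<phi>) \<and> (SUP x. \<phi> x) = \<phi>bar \<and>
      alpha1 C z \<beta> < \<alpha> \<and> \<alpha> < 1)
     \<longrightarrow>
     (\<forall>\<epsilon>>0. \<forall>Tren TV.
        (C0_contraction_semigroup C Tren \<and> generator_is_closure C Tren (L_ren z \<phi> \<epsilon>) \<and>
         C0_contraction_semigroup C TV \<and> generator_is_closure C TV (L_V z \<phi>))
        \<longrightarrow>
        (\<forall>k t k1 k2. in_K (\<alpha> * C) k \<and> 0 \<le> t \<and>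
            is_adjoint_image C Tren t k k1 \<and> is_adjoint_image C TV t k k2
            \<longrightarrow> K_norm C (\<lambda>\<eta>. k1 \<eta> - k2 \<eta>) \<le> \<epsilon> * t * A * K_norm (\<alpha> * C) k))"
proof (intro exI[of _ "\<bar>\<phi>bar\<bar> / (1 - sqrt \<alpha>)\<^sup>2 + 1"] conjI allI impI; (elim conjE)?)
  \<comment> \<open>The constant is fixed before any potential is given, so the sign of
    \<open>\<phi>bar\<close> is unknown here. The absolute value and the added 1 make it positive in
    every case.\<close>
  show "0 < \<bar>\<phi>bar\<bar> / (1 - sqrt \<alpha>)\<^sup>2 + 1" by (intro add_nonneg_pos) auto
next
  fix \<phi> :: "real^'d \<Rightarrow> real" and \<beta> z \<epsilon> t :: real and Tren TV k k1 k2
  assume \<phi>: "\<forall>x. 0 \<le> \<phi> x" "\<forall>x. \<phi> (- x) = \<phi> x" "\<phi> \<in> borel_measurable lborel" "integrable lborel \<phi>"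
      "\<beta> = (\<integral>x. \<phi> x \<partial>lborel)" "bdd_above (range \<phi>)" "(SUP x. \<phi> x) = \<phi>bar"
    and \<beta>: "0 < \<beta>" and z: "0 < z" "z \<le> min (C * exp (- C * \<beta>)) (2 * C * exp (- 2 * C * \<beta>))"
    and \<alpha>: "alpha1 C z \<beta> < \<alpha>" "\<alpha> < 1" and \<epsilon>: "0 < \<epsilon>"
    and semigroups: "C0_contraction_semigroup C Tren" "generator_is_closure C Tren (L_ren z \<phi> \<epsilon>)"
      "C0_contraction_semigroup C TV" "generator_is_closure C TV (L_V z \<phi>)"
    and k: "in_K (\<alpha> * C) k" "0 \<le> t" "is_adjoint_image C Tren t k k1" "is_adjoint_image C TV t k k2"
  have \<phi>_le: "\<phi> x \<le> \<phi>bar" for x using cSUP_upper[OF UNIV_I \<phi>(6), of x] \<phi>(7) by simp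
  interpret mean_field_potential \<phi> \<beta> \<phi>bar z \<epsilon>
    by unfold_locales (use \<phi> \<phi>_le z \<epsilon> in auto)
  define q where "q = sqrt \<alpha>"
  \<comment> \<open>This entry of the maximum keeps \<open>\<alpha>\<close> away from zero, so that
    \<open>sqrt \<alpha>\<close> is positive and squares back to \<open>\<alpha>\<close>.\<close>
  have "1 / 2 \<le> alpha1 C z \<beta>"
    by (cases "C * \<beta> > 1") (simp_all only: alpha1_def if_True if_False max.cobounded1)
  then have \<alpha>0: "0 < \<alpha>" using \<alpha>(1) by linarith
  then have q: "0 < q" "q < 1" "q\<^sup>2 = \<alpha>" using \<alpha>(2) by (auto simp: q_def)
  \<comment> \<open>Hence \<open>q\<close> as well as \<open>\<alpha>\<close> lies strictly between
    \<open>alpha1 C z \<beta>\<close> and 1, and \<open>activity_bound\<close> applies to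
    both.\<close>
  have "\<alpha> \<le> q" using q by (metis less_imp_le mult_le_one mult_right_le_one_le power2_eq_square)
  then have q\<alpha>: "alpha1 C z \<beta> < q" using \<alpha>(1) by linarith
  have z': "z \<le> C * exp (- C * \<beta>)" using z(2) by simp
  have "K_norm C (\<lambda>\<eta>. k1 \<eta> - k2 \<eta>) \<le> \<epsilon> * t * (\<phi>bar / (1 - q)\<^sup>2) * K_norm (q\<^sup>2 * C) k"
    using activity_bound[OF assms \<beta> z(1) z' q\<alpha> q(2)] activity_bound[OF assms \<beta> z(1) z' \<alpha>] assms k
    by (intro K_norm_adjoint_difference[OF _ q(1,2) _ _ semigroups]) (auto simp: q(3))
  also have "\<dots> \<le> \<epsilon> * t * (\<bar>\<phi>bar\<bar> / (1 - sqrt \<alpha>)\<^sup>2 + 1) * K_norm (q\<^sup>2 * C) k"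
  proof (intro mult_right_mono mult_left_mono)
    have "\<phi>bar / (1 - q)\<^sup>2 \<le> \<bar>\<phi>bar\<bar> / (1 - sqrt \<alpha>)\<^sup>2" unfolding q_def by (intro divide_right_mono) auto
    then show "\<phi>bar / (1 - q)\<^sup>2 \<le> \<bar>\<phi>bar\<bar> / (1 - sqrt \<alpha>)\<^sup>2 + 1" by simp
    show "0 \<le> K_norm (q\<^sup>2 * C) k" using k(1) \<alpha>0 assms by (intro K_norm_nonneg) (auto simp: q(3))
  qed (use \<epsilon> k in auto)
  finally show "K_norm C (\<lambda>\<eta>. k1 \<eta> - k2 \<eta>) \<le> \<epsilon> * t * (\<bar>\<phi>bar\<bar> / (1 - sqrt \<alpha>)\<^sup>2 + 1) * K_norm (\<alpha> * C) k"
    by (simp add: q(3))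
qed

end
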